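(* Fix an integer $n\ge 1$ and $\alpha\in[0,1]$. For each integer $d>0$ let $f$ be a random polynomial in $H_{[\alpha d,d]}$ (functions on $S^n$). Then $$\mathbb{E}\,\mathrm{Vol}(Z_{S^n}(f))=\Theta(d)\qquad (d\to\infty),$$ that is, there exist constants $c_1,c_2>0$, depending only on $n$ and $\alpha$, such that $c_1 d\le \mathbb{E}\,\mathrm{Vol}(Z_{S^n}(f))\le c_2 d$ for all $d$ large enough.
   Context: $S^n\subset\mathbb{R}^{n+1}$ is the unit sphere with its round metric. For $l\in\mathbb{N}$, $H_{n,l}$ is the space of real spherical harmonics of degree $l$ on $S^n$, i.e. functions with $\Delta_{S^n}g=-l(l+n-1)g$ (equivalently, restrictions to $S^n$ of real homogeneous harmonic polynomials of degree $l$ in $n+1$ variables); $d(n,l)=\dim H_{n,l}$. For $\alpha\in[0,1]$ and an integer $d>0$, let $[\alpha d,d]$ denote the index set of natural numbers $l$ with $\lfloor\alpha d\rfloor\le l\le d$ and $d-l$ even. Define $H_{[\alpha d,d]}=\bigoplus_{l\in[\alpha d,d]}H_{n,l}$ (an $L^2(S^n)$-orthogonal direct sum), and $D_\alpha=\dim H_{[\alpha d,d]}$. For $\alpha=0$ this is the space of restrictions to $S^n$ of all real homogeneous polynomials of degree $d$ in $n+1$ variables; for $\alpha=1$ it is $H_{n,d}$. A random polynomial in $H_{[\alpha d,d]}$ is $f=\sum_{l\in[\alpha d,d]}\sum_{i=1}^{d(n,l)}\xi_l^iY_l^i$, where $\{Y_l^i\}_{i=1}^{d(n,l)}$ is an $L^2(S^n)$-orthonormal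 basis of $H_{n,l}$ and the $\xi_l^i$ are independent centered Gaussians with variance $D_\alpha^{-1}$ (the law does not depend on the choice of bases). $Z_{S^n}(f)=\{x\in S^n: f(x)=0\}$, which is almost surely a smooth hypersurface, and $\mathrm{Vol}$ denotes its $(n-1)$-dimensional volume (the number of points if $n=1$). *)

theory Defs
  imports "HOL-Probability.Probability" "HOL-Library.Function_Algebras"
begin

instantiation "fun" :: (type, real_vector) real_vector
begin

definition scaleR_fun :: "real \<Rightarrow> ('a \<Rightarrow> 'b) \<Rightarrow> 'a \<Rightarrow> 'b"
  where "scaleR_fun c f = (\<lambda>x. c *\<^sub>R f x)"

instance
  by standard (auto simp: scaleR_fun_def fun_eq_iff scaleR_add_right scaleR_add_left)

end

text \<open>
  Throughout, the ambient space \<open>\<real>\<^sup>n\<^sup>+\<^sup>1\<close> is \<open>real ^ 'm\<close> with \<open>CARD('m) = n + 1\<close>, and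
  \<open>S\<^sup>n\<close> is \<open>sphere 0 1\<close>.
\<close>

definition laplacian :: "(real ^ 'm \<Rightarrow> real) \<Rightarrow> real ^ 'm \<Rightarrow> real"
  where "laplacian p x = (\<Sum>i\<in>UNIV. (deriv ^^ 2) (\<lambda>t. p (x + t *\<^sub>R axis i 1)) 0)"

definition harmonic_homogeneous_polynomial :: "nat \<Rightarrow> (real ^ 'm \<Rightarrow> real) \<Rightarrow> bool"
  where "harmonic_homogeneous_polynomial l p \<longleftrightarrow>
    real_polynomial_function p \<and>
    (\<forall>c x. p (c *\<^sub>R x) = c ^ l * p x) \<and>
    (\<forall>x. laplacian p x = 0)"

text \<open>
  A function on the sphere is represented by its extension by zero, so that equality and linear
  independence of functions on the sphere are equality and linear independence of elements of
  the function type.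
\<close>

definition sphere_restrict :: "(real ^ 'm \<Rightarrow> real) \<Rightarrow> real ^ 'm \<Rightarrow> real"
  where "sphere_restrict p = (\<lambda>x. if x \<in> sphere 0 1 then p x else 0)"

definition spherical_harmonics :: "nat \<Rightarrow> (real ^ 'm \<Rightarrow> real) set"
  where "spherical_harmonics l = sphere_restrict ` {p. harmonic_homogeneous_polynomial l p}"

definition degree_range :: "real \<Rightarrow> nat \<Rightarrow> nat set"
  where "degree_range \<alpha> d = {l. \<lfloor>\<alpha> * real d\<rfloor> \<le> int l \<and> l \<le> d \<and> even (d - l)}"

definition harmonics_range :: "real \<Rightarrow> nat \<Rightarrow> (real ^ 'm \<Rightarrow> real) set"
  where "harmonics_range \<alpha> d =
    {\<Sum>l\<in>degree_range \<alpha> d. g l |g. \<forall>l\<in>degree_range \<alpha> d. g l \<in> spherical_harmonics l}"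

text \<open>
  The surface measure of the round unit sphere in polar coordinates:
  \<open>\<sigma>(A) = (n + 1) \<lambda>({r x | 0 < r < 1, x \<in> A})\<close>. It is given as a Borel measure on the ambient
  space that is concentrated on the sphere; \<open>sgn x\<close> is \<open>x\<close> divided by its norm.
\<close>

definition sphere_measure :: "(real ^ 'm) measure"
  where "sphere_measure =
    scale_measure (of_nat CARD('m)) (distr (restrict_space lborel (ball 0 1)) borel sgn)"

definition sphere_inner :: "(real ^ 'm \<Rightarrow> real) \<Rightarrow> (real ^ 'm \<Rightarrow> real) \<Rightarrow> real"
  where "sphere_inner f g = (LINT x|sphere_measure. f x * g x)"

definition orthonormal_basis :: "(real ^ 'm \<Rightarrow> real) set \<Rightarrow> (nat \<Rightarrow> real ^ 'm \<Rightarrow> real) \<Rightarrow> bool"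
  where "orthonormal_basis H Y \<longleftrightarrow>
    (\<forall>i\<in>{1..dim H}. \<forall>j\<in>{1..dim H}. sphere_inner (Y i) (Y j) = (if i = j then 1 else 0)) \<and>
    span (Y ` {1..dim H}) = H"

definition random_polynomial ::
  "'w measure \<Rightarrow> real \<Rightarrow> nat \<Rightarrow> ('w \<Rightarrow> real ^ 'm \<Rightarrow> real) \<Rightarrow> bool"
  where "random_polynomial M \<alpha> d f \<longleftrightarrow>
    prob_space M \<and>
    (\<exists>(Y :: nat \<Rightarrow> nat \<Rightarrow> real ^ 'm \<Rightarrow> real) (\<xi> :: nat \<Rightarrow> nat \<Rightarrow> 'w \<Rightarrow> real).
      let L = degree_range \<alpha> d;
          I = (\<lambda>l. {1..dim (spherical_harmonics l :: (real ^ 'm \<Rightarrow> real) set)});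
          D = dim (harmonics_range \<alpha> d :: (real ^ 'm \<Rightarrow> real) set)
      in (\<forall>l\<in>L. orthonormal_basis (spherical_harmonics l) (Y l)) \<and>
         prob_space.indep_vars M (\<lambda>_. borel) (\<lambda>(l, i). \<xi> l i) (SIGMA l:L. I l) \<and>
         (\<forall>l\<in>L. \<forall>i\<in>I l.
            distributed M lborel (\<xi> l i) (\<lambda>x. ennreal (normal_density 0 (sqrt (1 / real D)) x))) \<and>
         (\<forall>\<omega>\<in>space M. f \<omega> = (\<Sum>l\<in>L. \<Sum>i\<in>I l. \<xi> l i \<omega> *\<^sub>R Y l i)))"

text \<open>
  The \<open>k\<close>-dimensional Hausdorff measure with the normalization that makes it agree with
  Riemannian volume on \<open>k\<close>-dimensional submanifolds; for \<open>k = 0\<close> it is counting measure. The empty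
  set is treated separately because \<open>0 ^ 0 = 1\<close>, and boundedness is required because
  \<^const>\<open>diameter\<close> is only meaningful for bounded sets.
\<close>

definition hausdorff_weight :: "nat \<Rightarrow> 'a::metric_space set \<Rightarrow> ennreal"
  where "hausdorff_weight k U =
    (if U = {} then 0 else ennreal (unit_ball_vol (real k) * (diameter U / 2) ^ k))"

definition hausdorff_premeasure :: "nat \<Rightarrow> real \<Rightarrow> 'a::metric_space set \<Rightarrow> ennreal"
  where "hausdorff_premeasure k \<delta> A =
    (INF U \<in> {U :: nat \<Rightarrow> 'a set. A \<subseteq> (\<Union>i. U i) \<and> (\<forall>i. bounded (U i) \<and> diameter (U i) \<le> \<delta>)}.
      \<Sum>i. hausdorff_weight k (U i))"

definition hausdorff_measure :: "nat \<Rightarrow> 'a::metric_space set \<Rightarrow> ennreal"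
  where "hausdorff_measure k A = (SUP \<delta>\<in>{0<..}. hausdorff_premeasure k \<delta> A)"

definition sphere_zeros :: "(real ^ 'm \<Rightarrow> real) \<Rightarrow> (real ^ 'm) set"
  where "sphere_zeros f = {x \<in> sphere 0 1. f x = 0}"

end

theory Submission
  imports Defs
begin

text \<open>
  Write \<open>f = \<Sum>\<eta>\<^sub>a Q\<^sub>a\<close> with standard Gaussians \<open>\<eta>\<^sub>a\<close>, and let \<open>L\<^sub>j\<^sub>k = x\<^sub>j \<partial>\<^sub>k - x\<^sub>k \<partial>\<^sub>j\<close>. These operators act skewly on
  each \<open>H\<^sub>n\<^sub>,\<^sub>l\<close> and \<open>\<Sum>L\<^sub>j\<^sub>k\<^sup>2 = - 2 l (l + n - 1)\<close> there. Hence the variance \<open>\<kappa>\<close> of \<open>f x\<close> is constant on the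
  sphere, \<open>f x\<close> and \<open>L\<^sub>j\<^sub>k f x\<close> are uncorrelated (so independent), and the variance of \<open>L\<^sub>j\<^sub>k f x\<close> is at most
  of order \<open>d\<^sup>2 \<kappa>\<close>.

  Upper bound: cover the sphere by order \<open>\<delta>\<^sup>-\<^sup>n\<close> balls of radius \<open>\<delta>\<close>. A ball around \<open>x\<close> meets the zero set only if
  \<open>\<bar>f x\<bar>\<close> is at most about \<open>\<delta> \<Sum>\<bar>L\<^sub>j\<^sub>k f x\<bar>\<close>, which by independence has probability of order \<open>\<delta> d\<close>; let \<open>\<delta> \<rightarrow> 0\<close> and use
  Fatou's lemma.

  Lower bound: if \<open>f\<close> changes sign between \<open>y\<close> and its rotation by an angle \<open>\<theta>\<close> of order \<open>1 / d\<close>, then \<open>y\<close> lies in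
  the tube swept out by rotating the zero set back by at most \<open>\<theta>\<close>, whose surface measure is at most of order
  \<open>\<theta>\<close> times the volume of the zero set. The sign changes with probability bounded below on average, because
  for some coordinate plane the mean square increment of the \<open>Q\<^sub>a\<close> is of order one; this uses that most of the
  dimension of \<open>H\<^bsub>[\<alpha>d,d]\<^esub>\<close> sits in degrees \<open>l \<ge> d / 2\<close>, as \<open>dim H\<^sub>n\<^sub>,\<^sub>l \<le> dim H\<^sub>n\<^sub>,\<^sub>l\<^sub>+\<^sub>2\<close>.
\<close>

text \<open>The mesh limit is taken for fixed d: the second-order Taylor remainders of the Q_a
  depend on the chosen basis without control and must vanish with the mesh, so that only the
  variances of f x and L_jk f x, which come from kernel identities, survive in the constants.
  Rotations replace charts. Their generators are globally defined operators on polynomials that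
  preserve degree and harmonicity, and their flows preserve the surface measure, so integration by
  parts has no boundary or Jacobian terms. The volume of the zero set is nowhere shown to be
  measurable in \<omega>. As \<open>nn_integral\<close> is monotone for arbitrary functions, it
  suffices to trap the volume between a measurable multiple of a surface measure and the lower limit
  of measurable counts. Both constants depend on n alone and serve for every d \<ge> 1: \<alpha>
  enters only through \<open>degree_range\<close>, and the pairing of low with high degrees is
  possible for each \<alpha>.\<close>

section \<open>Partial derivatives of polynomial functions\<close>

definition pd :: "'m \<Rightarrow> (real ^ 'm \<Rightarrow> real) \<Rightarrow> real ^ 'm \<Rightarrow> real"
  where "pd i p x = deriv (\<lambda>t. p (x + t *\<^sub>R axis i 1)) 0"

text \<open>Translation along the coordinate line carries the derivative at s to the derivative at
  0. The admissible derivatives coincide, so \<open>deriv\<close> returns the same value whether or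
  not one exists.\<close>

lemma laplacian_eq_pd: "laplacian p x = (\<Sum>i\<in>UNIV. pd i (pd i p) x)"
proof -
  have "deriv (\<lambda>t. p (x + t *\<^sub>R axis i 1)) s = pd i p (x + s *\<^sub>R axis i 1)" for i s
  proof -
    have "((\<lambda>t. p (x + t *\<^sub>R axis i 1)) has_field_derivative D) (at s) \<longleftrightarrow>
        ((\<lambda>t. p ((x + s *\<^sub>R axis i 1) + t *\<^sub>R axis i 1)) has_field_derivative D) (at 0)" for D
      using DERIV_shift[of "\<lambda>t. p (x + t *\<^sub>R axis i 1)" D 0 s]
      by (simp add: algebra_simps)
    then show ?thesis
      by (simp add: deriv_def pd_def)
  qed
  then have "deriv (\<lambda>t. p (x + t *\<^sub>R axis i 1)) = (\<lambda>s. pd i p (x + s *\<^sub>R axis i 1))" for i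
    by auto
  then show ?thesis
    by (simp add: laplacian_def numeral_2_eq_2 pd_def)
qed

lemma sum_axis_mult [simp]: "(\<Sum>j\<in>UNIV. axis i (1::real) $ j * h j) = h i" for i :: "'m::finite"
proof -
  have "(\<Sum>j\<in>UNIV. axis i (1::real) $ j * h j) = (\<Sum>j\<in>UNIV. if j = i then h j else 0)"
    by (rule sum.cong) (auto simp: axis_def)
  then show ?thesis by simp
qed

lemma pd_of_has_derivative:
  fixes p :: "real ^ 'm::finite \<Rightarrow> real"
  assumes "(p has_derivative p') (at x)"
  shows "pd i p x = p' (axis i 1)"
proof -
  have "((\<lambda>t. p (x + t *\<^sub>R axis i 1)) has_derivative (\<lambda>t. p' (t *\<^sub>R axis i 1))) (at 0)"
    by (rule has_derivative_compose[where g = p])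
      (auto intro!: derivative_eq_intros simp: assms)
  moreover have "p' (t *\<^sub>R axis i 1) = p' (axis i 1) * t" for t
    using has_derivative_linear[OF assms] by (simp add: linear_cmul)
  ultimately have "((\<lambda>t. p (x + t *\<^sub>R axis i 1)) has_field_derivative p' (axis i 1)) (at 0)"
    by (simp add: has_field_derivative_def)
  then show ?thesis
    by (simp add: pd_def DERIV_imp_deriv)
qed

lemma real_polynomial_function_has_derivative_pd:
  fixes p :: "real ^ 'm::finite \<Rightarrow> real"
  assumes "real_polynomial_function p"
  shows "(p has_derivative (\<lambda>v. \<Sum>i\<in>UNIV. v $ i * pd i p x)) (at x)"
proof -
  obtain p' where p': "(p has_derivative p') (at x)"
    using differentiable_at_real_polynomial_function[OF assms] by (auto simp: differentiable_def)
  have "p' = (\<lambda>v. \<Sum>i\<in>UNIV. v $ i * pd i p x)"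
  proof
    fix v
    have "p' v = p' (\<Sum>i\<in>UNIV. (v $ i) *\<^sub>R axis i 1)"
      by (simp only: scalar_mult_eq_scaleR[symmetric] basis_expansion)
    also have "\<dots> = (\<Sum>i\<in>UNIV. (v $ i) *\<^sub>R p' (axis i 1))"
      using has_derivative_linear[OF p'] by (simp add: linear_sum linear_cmul)
    finally show "p' v = (\<Sum>i\<in>UNIV. v $ i * pd i p x)"
      by (simp add: pd_of_has_derivative[OF p'])
  qed
  then show ?thesis
    using p' by simp
qed

lemma pd_const [simp]: "pd i (\<lambda>x. c) = (\<lambda>x. 0)"
  by (auto simp: pd_def)

lemma pd_linear:
  fixes f :: "real ^ 'm::finite \<Rightarrow> real"
  assumes "bounded_linear f"
  shows "pd i f = (\<lambda>x. f (axis i 1))"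
  using pd_of_has_derivative[OF bounded_linear_imp_has_derivative[OF assms]] by auto

lemma pd_nth: "pd i (\<lambda>x. x $ j) = (\<lambda>x. if i = j then 1 else 0)"
  by (subst pd_linear) (auto simp: bounded_linear_vec_nth axis_def)

lemma pd_add:
  fixes f g :: "real ^ 'm::finite \<Rightarrow> real"
  assumes "real_polynomial_function f" "real_polynomial_function g"
  shows "pd i (\<lambda>x. f x + g x) = (\<lambda>x. pd i f x + pd i g x)"
  using pd_of_has_derivative[OF has_derivative_add[OF
      assms[THEN real_polynomial_function_has_derivative_pd]]]
  by (auto simp: fun_eq_iff)

lemma pd_mult:
  fixes f g :: "real ^ 'm::finite \<Rightarrow> real"
  assumes "real_polynomial_function f" "real_polynomial_function g"
  shows "pd i (\<lambda>x. f x * g x) = (\<lambda>x. f x * pd i g x + pd i f x * g x)"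
  using pd_of_has_derivative[OF has_derivative_mult[OF
      assms[THEN real_polynomial_function_has_derivative_pd]]]
  by (auto simp: fun_eq_iff)

lemma real_polynomial_function_nth [intro, simp]:
  "real_polynomial_function (\<lambda>x::real ^ 'm::finite. x $ i)"
  by (rule real_polynomial_function.intros(1)) (rule bounded_linear_vec_nth)

lemma real_polynomial_function_const' [intro, simp]: "real_polynomial_function (\<lambda>x. c)"
  by (rule real_polynomial_function.intros(2))

lemma real_polynomial_function_pd [intro, simp]:
  fixes p :: "real ^ 'm::finite \<Rightarrow> real"
  assumes "real_polynomial_function p"
  shows "real_polynomial_function (pd i p)"
  using assms
proof (induction p rule: real_polynomial_function.induct)
  case (linear f)
  then show ?case by (simp add: pd_linear)
next
  case (const c)
  then show ?case by simp
next
  case (add f g)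
  then show ?case by (simp add: pd_add real_polynomial_function.intros(3))
next
  case (mult f g)
  then show ?case
    by (simp add: pd_mult real_polynomial_function.intros(3) real_polynomial_function.intros(4))
qed

lemma pd_cmult:
  fixes f :: "real ^ 'm::finite \<Rightarrow> real"
  assumes "real_polynomial_function f"
  shows "pd i (\<lambda>x. c * f x) = (\<lambda>x. c * pd i f x)"
  using pd_mult[of "\<lambda>x. c" f i] assms by simp

lemma pd_uminus:
  fixes f :: "real ^ 'm::finite \<Rightarrow> real"
  assumes "real_polynomial_function f"
  shows "pd i (\<lambda>x. - f x) = (\<lambda>x. - pd i f x)"
  using pd_cmult[of f i "-1"] assms by simp

lemma pd_diff:
  fixes f g :: "real ^ 'm::finite \<Rightarrow> real"
  assumes "real_polynomial_function f" "real_polynomial_function g"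
  shows "pd i (\<lambda>x. f x - g x) = (\<lambda>x. pd i f x - pd i g x)"
  using pd_add[of f "\<lambda>x. - g x" i] pd_uminus[of g i] assms
  by (simp add: real_polynomial_function_minus)

lemma pd_sum:
  fixes f :: "'a \<Rightarrow> real ^ 'm::finite \<Rightarrow> real"
  assumes "finite A" "\<And>a. a \<in> A \<Longrightarrow> real_polynomial_function (f a)"
  shows "pd i (\<lambda>x. \<Sum>a\<in>A. f a x) = (\<lambda>x. \<Sum>a\<in>A. pd i (f a) x)"
  using assms
proof (induction A rule: finite_induct)
  case (insert a A)
  have "real_polynomial_function (\<lambda>x. \<Sum>a\<in>A. f a x)"
    by (rule real_polynomial_function_sum) (use insert in auto)
  then show ?case
    using insert by (simp add: pd_add)
qed simp

text \<open>Induction over the construction of polynomial functions reduces the symmetry of second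
  derivatives to the Leibniz rule, whose two cross terms swap.\<close>

lemma pd_commute:
  fixes p :: "real ^ 'm::finite \<Rightarrow> real"
  assumes "real_polynomial_function p"
  shows "pd i (pd j p) = pd j (pd i p)"
  using assms
proof (induction p rule: real_polynomial_function.induct)
  case (mult f g)
  then show ?case
    by (simp add: pd_mult pd_add real_polynomial_function.intros(4) algebra_simps)
qed (simp_all add: pd_linear pd_add)

lemmas polynomial_intros = real_polynomial_function.intros(3) real_polynomial_function.intros(4)
  real_polynomial_function_diff real_polynomial_function_minus real_polynomial_function_pd
  real_polynomial_function_nth real_polynomial_function_const' real_polynomial_function_sum

lemmas pd_simps = pd_add pd_mult pd_diff pd_nth pd_sum polynomial_intros

text \<open>The chain rule behind three later expansions: along rays (Euler's identity), along
  rotation orbits and along chords of the sphere.\<close>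

lemma real_polynomial_function_along_curve:
  fixes p :: "real ^ 'm::finite \<Rightarrow> real"
  assumes "real_polynomial_function p" and "(\<gamma> has_vector_derivative \<gamma>') (at t)"
  shows "((\<lambda>t. p (\<gamma> t)) has_real_derivative (\<Sum>i\<in>UNIV. \<gamma>' $ i * pd i p (\<gamma> t))) (at t)"
proof -
  have "((\<lambda>t. p (\<gamma> t)) has_derivative (\<lambda>s. \<Sum>i\<in>UNIV. (s *\<^sub>R \<gamma>') $ i * pd i p (\<gamma> t))) (at t)"
    using has_derivative_compose[OF assms(2)[unfolded has_vector_derivative_def]
        real_polynomial_function_has_derivative_pd[OF assms(1)]] .
  moreover have "(\<Sum>i\<in>UNIV. (s *\<^sub>R \<gamma>') $ i * pd i p (\<gamma> t)) =
      (\<Sum>i\<in>UNIV. \<gamma>' $ i * pd i p (\<gamma> t)) * s" for s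
    by (simp add: sum_distrib_left mult_ac)
  ultimately show ?thesis
    by (simp add: has_field_derivative_def)
qed

section \<open>The infinitesimal rotations\<close>

text \<open>The derivative along the flow \<open>rot j k\<close> (see
  \<open>has_real_derivative_rot\<close>), hence tangent to every sphere centred at 0.\<close>

definition rot_deriv :: "'m \<Rightarrow> 'm \<Rightarrow> (real ^ 'm \<Rightarrow> real) \<Rightarrow> real ^ 'm \<Rightarrow> real"
  where "rot_deriv j k p = (\<lambda>x. x $ j * pd k p x - x $ k * pd j p x)"

lemma real_polynomial_function_rot_deriv [intro, simp]:
  fixes p :: "real ^ 'm::finite \<Rightarrow> real"
  assumes "real_polynomial_function p"
  shows "real_polynomial_function (rot_deriv j k p)"
  using assms unfolding rot_deriv_def by (intro polynomial_intros)

lemma rot_deriv_mult: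
  fixes p q :: "real ^ 'm::finite \<Rightarrow> real"
  assumes "real_polynomial_function p" "real_polynomial_function q"
  shows "rot_deriv j k (\<lambda>x. p x * q x) = (\<lambda>x. rot_deriv j k p x * q x + p x * rot_deriv j k q x)"
  using assms by (auto simp: rot_deriv_def pd_mult algebra_simps)

lemma rot_deriv_sum:
  fixes f :: "'a \<Rightarrow> real ^ 'm::finite \<Rightarrow> real"
  assumes "finite A" "\<And>a. a \<in> A \<Longrightarrow> real_polynomial_function (f a)"
  shows "rot_deriv j k (\<lambda>x. \<Sum>a\<in>A. f a x) = (\<lambda>x. \<Sum>a\<in>A. rot_deriv j k (f a) x)"
  using assms by (auto simp: rot_deriv_def pd_sum sum_subtractf sum_distrib_left)

lemma pd_scale:
  fixes p :: "real ^ 'm::finite \<Rightarrow> real"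
  assumes "real_polynomial_function p"
  shows "pd i (\<lambda>x. p (c *\<^sub>R x)) x = c * pd i p (c *\<^sub>R x)"
proof -
  have "((\<lambda>x. p (c *\<^sub>R x)) has_derivative (\<lambda>v. \<Sum>i\<in>UNIV. (c *\<^sub>R v) $ i * pd i p (c *\<^sub>R x))) (at x)"
    by (rule has_derivative_compose[OF _ real_polynomial_function_has_derivative_pd[OF assms]])
      (auto intro!: derivative_eq_intros)
  from pd_of_has_derivative[OF this, of i] show ?thesis
    by (simp add: mult.assoc sum_distrib_left[symmetric])
qed

text \<open>Keeping the factor \<open>c\<close> on the left avoids both the exponent l - 1, which is
  truncated for l = 0, and a division by \<open>c\<close>.\<close>

lemma homogeneous_pd:
  fixes p :: "real ^ 'm::finite \<Rightarrow> real"
  assumes "real_polynomial_function p" and hom: "\<And>c x. p (c *\<^sub>R x) = c ^ l * p x"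
  shows "c * pd i p (c *\<^sub>R x) = c ^ l * pd i p x"
  using pd_scale[OF assms(1), of i c x] pd_cmult[OF assms(1), of i "c ^ l"] by (simp add: hom)

lemma euler_identity:
  fixes p :: "real ^ 'm::finite \<Rightarrow> real"
  assumes p: "real_polynomial_function p" and hom: "\<And>c x. p (c *\<^sub>R x) = c ^ l * p x"
  shows "(\<Sum>i\<in>UNIV. x $ i * pd i p x) = real l * p x"
proof -
  have "((\<lambda>c. c *\<^sub>R x) has_vector_derivative x) (at 1)"
    by (auto intro!: derivative_eq_intros simp: has_vector_derivative_def)
  from real_polynomial_function_along_curve[OF p this]
  have "((\<lambda>c. p (c *\<^sub>R x)) has_real_derivative (\<Sum>i\<in>UNIV. x $ i * pd i p x)) (at 1)"
    by simp
  moreover have "((\<lambda>c. c ^ l * p x) has_real_derivative real l * p x) (at 1)"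
    by (auto intro!: derivative_eq_intros)
  ultimately show ?thesis
    using DERIV_unique by (simp add: hom)
qed

section \<open>Harmonic homogeneous polynomials and the Casimir operator\<close>

abbreviation "harmonic \<equiv> harmonic_homogeneous_polynomial"

lemma harmonicD:
  assumes "harmonic l p"
  shows harmonic_polynomial: "real_polynomial_function p"
    and harmonic_scale: "p (c *\<^sub>R x) = c ^ l * p x"
    and harmonic_laplacian: "(\<Sum>i\<in>UNIV. pd i (pd i p) x) = 0"
  using assms by (auto simp: harmonic_homogeneous_polynomial_def laplacian_eq_pd)

lemma harmonic_zero: "harmonic l (\<lambda>x :: real ^ 'm::finite. 0)"
  by (auto simp: harmonic_homogeneous_polynomial_def laplacian_eq_pd)

lemma harmonic_add:
  fixes p q :: "real ^ 'm::finite \<Rightarrow> real"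
  assumes "harmonic l p" "harmonic l q"
  shows "harmonic l (\<lambda>x. p x + q x)"
  using assms unfolding harmonic_homogeneous_polynomial_def laplacian_eq_pd
  by (auto simp: pd_simps sum.distrib algebra_simps)

lemma harmonic_cmult:
  fixes p :: "real ^ 'm::finite \<Rightarrow> real"
  assumes "harmonic l p"
  shows "harmonic l (\<lambda>x. c * p x)"
  using assms unfolding harmonic_homogeneous_polynomial_def laplacian_eq_pd
  by (auto simp: pd_cmult sum_distrib_left[symmetric] polynomial_intros)

lemma pd_pd_mult_nth:
  fixes p :: "real ^ 'm::finite \<Rightarrow> real"
  assumes p: "real_polynomial_function p"
  shows "pd i (pd i (\<lambda>x. x $ j * p x)) x = x $ j * pd i (pd i p) x + (if i = j then 2 * pd i p x else 0)"
  using p by (cases "i = j") (simp_all add: pd_simps)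

text \<open>Differentiating Euler's identity for \<open>p\<close> gives the one for its partial
  derivative, without speaking of homogeneity of degree l - 1.\<close>

lemma euler_identity_pd:
  fixes p :: "real ^ 'm::finite \<Rightarrow> real"
  assumes h: "harmonic l p"
  shows "(\<Sum>i\<in>UNIV. x $ i * pd i (pd e p) x) = (real l - 1) * pd e p x"
proof -
  note p = harmonicD[OF h]
  have "pd e (\<lambda>x. \<Sum>i\<in>UNIV. x $ i * pd i p x) x = pd e p x + (\<Sum>i\<in>UNIV. x $ i * pd e (pd i p) x)"
    using p(1) by (simp add: pd_simps sum.distrib if_distrib[of "\<lambda>a. a * _"] cong: if_cong)
  moreover have "pd e (\<lambda>x. \<Sum>i\<in>UNIV. x $ i * pd i p x) x = real l * pd e p x"
    by (simp only: euler_identity[OF p(1,2)] pd_cmult[OF p(1)])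
  ultimately show ?thesis
    by (simp add: pd_commute[OF p(1), of _ e] algebra_simps)
qed

lemma laplacian_pd_harmonic:
  fixes p :: "real ^ 'm::finite \<Rightarrow> real"
  assumes h: "harmonic l p"
  shows "(\<Sum>i\<in>UNIV. pd i (pd i (pd a p)) x) = 0"
proof -
  note p = harmonicD[OF h]
  have "(\<Sum>i\<in>UNIV. pd i (pd i (pd a p)) x) = (\<Sum>i\<in>UNIV. pd a (pd i (pd i p)) x)"
  proof (rule sum.cong[OF refl])
    fix i
    show "pd i (pd i (pd a p)) x = pd a (pd i (pd i p)) x"
      by (simp only: pd_commute[OF p(1), of i a]
          pd_commute[OF real_polynomial_function_pd[OF p(1)], of i a])
  qed
  also have "\<dots> = pd a (\<lambda>x. \<Sum>i\<in>UNIV. pd i (pd i p) x) x"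
    using p(1) by (simp add: pd_sum)
  finally show ?thesis
    by (simp add: p(3))
qed

text \<open>The Laplacian commutes with infinitesimal rotations: the cross terms 2 d_j d_k p and 2
  d_k d_j p of the Leibniz rule cancel.\<close>

lemma harmonic_rot_deriv:
  fixes p :: "real ^ 'm::finite \<Rightarrow> real"
  assumes h: "harmonic l p"
  shows "harmonic l (rot_deriv j k p)"
  unfolding harmonic_homogeneous_polynomial_def laplacian_eq_pd
proof (intro conjI allI)
  note p = harmonicD[OF h]
  show "real_polynomial_function (rot_deriv j k p)"
    using p(1) by simp
  show "rot_deriv j k p (c *\<^sub>R x) = c ^ l * rot_deriv j k p x" for c x
  proof -
    have "rot_deriv j k p (c *\<^sub>R x) =
        x $ j * (c * pd k p (c *\<^sub>R x)) - x $ k * (c * pd j p (c *\<^sub>R x))"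
      by (simp add: rot_deriv_def)
    then show ?thesis
      by (simp only: homogeneous_pd[OF p(1,2)]) (simp add: rot_deriv_def algebra_simps)
  qed
  show "(\<Sum>i\<in>UNIV. pd i (pd i (rot_deriv j k p)) x) = 0" for x
  proof -
    have "pd i (pd i (rot_deriv j k p)) x =
        pd i (pd i (\<lambda>x. x $ j * pd k p x)) x - pd i (pd i (\<lambda>x. x $ k * pd j p x)) x" for i
      using p(1) by (simp add: rot_deriv_def pd_diff polynomial_intros)
    then have "(\<Sum>i\<in>UNIV. pd i (pd i (rot_deriv j k p)) x) =
        x $ j * (\<Sum>i\<in>UNIV. pd i (pd i (pd k p)) x) - x $ k * (\<Sum>i\<in>UNIV. pd i (pd i (pd j p)) x)
        + 2 * pd j (pd k p) x - 2 * pd k (pd j p) x"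
      using p(1)
      by (simp add: pd_pd_mult_nth sum_subtractf sum.distrib sum_distrib_left sum.delta)
    then show ?thesis
      using pd_commute[OF p(1), of j k] by (simp add: laplacian_pd_harmonic[OF h])
  qed
qed

text \<open>Ordered pairs count each plane twice, whence the factor 2. The second-order part
  contains |x|^2 times the Laplacian of \<open>p\<close>, which is 0; what remains is a polynomial
  in the Euler operator, which acts on \<open>p\<close> as the scalar l.\<close>

lemma sum_rot_deriv_squared:
  fixes p :: "real ^ 'm::finite \<Rightarrow> real"
  assumes h: "harmonic l p"
  shows "(\<Sum>j\<in>UNIV. \<Sum>k\<in>UNIV. rot_deriv j k (rot_deriv j k p) x) =
    - 2 * (real l * (real l + real CARD('m) - 2)) * p x"
proof -
  note p = harmonicD[OF h]
  define E where "E = (\<lambda>x. \<Sum>i\<in>UNIV. x $ i * pd i p x)"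
  have E: "E = (\<lambda>x. real l * p x)"
    using euler_identity[OF p(1,2)] by (auto simp: E_def)
  have EE: "(\<Sum>j\<in>UNIV. \<Sum>k\<in>UNIV. x $ j * x $ k * pd k (pd j p) x) = real l * (real l - 1) * p x"
  proof -
    have "(\<Sum>j\<in>UNIV. \<Sum>k\<in>UNIV. x $ j * x $ k * pd k (pd j p) x) = (\<Sum>j\<in>UNIV. x $ j * ((real l - 1) * pd j p x))"
      by (simp only: euler_identity_pd[OF h, symmetric] sum_distrib_left mult.assoc)
    also have "\<dots> = (real l - 1) * E x"
      by (simp add: E_def sum_distrib_left mult.left_commute)
    finally show ?thesis by (simp add: E)
  qed
  \<comment> \<open>On the diagonal the left-hand side is 0; the last summand is the derivative of
    x_j hitting itself and cancels the two first-order terms there.\<close>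
  have L: "rot_deriv j k (rot_deriv j k p) x =
      (x $ j)\<^sup>2 * pd k (pd k p) x + (x $ k)\<^sup>2 * pd j (pd j p) x - 2 * (x $ j * x $ k * pd k (pd j p) x)
      - x $ j * pd j p x - x $ k * pd k p x + (if j = k then 2 * (x $ j * pd j p x) else 0)" for j k
  proof (cases "j = k")
    case True
    then show ?thesis
      using p(1) by (simp add: rot_deriv_def pd_simps power2_eq_square algebra_simps)
  next
    case False
    then show ?thesis
      using p(1)
      by (simp add: rot_deriv_def pd_simps power2_eq_square algebra_simps pd_commute[OF p(1), of j k])
  qed
  have 1: "(\<Sum>j\<in>UNIV. \<Sum>k\<in>UNIV. (x $ j)\<^sup>2 * pd k (pd k p) x) = 0"
    by (simp add: sum_distrib_left[symmetric] p(3))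
  have 2: "(\<Sum>j\<in>UNIV. \<Sum>k\<in>UNIV. (x $ k)\<^sup>2 * pd j (pd j p) x) = 0"
    by (subst sum.swap) (rule 1)
  have 3: "(\<Sum>j\<in>UNIV. \<Sum>k\<in>(UNIV :: 'm set). x $ j * pd j p x) = real CARD('m) * E x"
    by (simp add: E_def sum_distrib_left)
  have 4: "(\<Sum>j\<in>(UNIV :: 'm set). \<Sum>k\<in>UNIV. x $ k * pd k p x) = real CARD('m) * E x"
    by (subst sum.swap) (rule 3)
  have 5: "(\<Sum>j\<in>UNIV. \<Sum>k\<in>UNIV. if j = k then 2 * (x $ j * pd j p x) else 0) = 2 * E x"
    by (simp add: E_def sum_distrib_left)
  have 6: "(\<Sum>j\<in>UNIV. \<Sum>k\<in>UNIV. 2 * (x $ j * x $ k * pd k (pd j p) x)) =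
      2 * (real l * (real l - 1) * p x)"
    by (simp only: sum_distrib_left[symmetric] EE)
  have "(\<Sum>j\<in>UNIV. \<Sum>k\<in>UNIV. rot_deriv j k (rot_deriv j k p) x) =
      - 2 * (real l * (real l - 1) * p x) - 2 * real CARD('m) * E x + 2 * E x"
    by (simp only: L sum.distrib sum_subtractf 1 2 3 4 5 6)
  then show ?thesis
    by (simp add: E algebra_simps)
qed

section \<open>Uncorrelated Gaussian combinations are independent\<close>

lemma (in prob_space) expectation_indicator_comp:
  assumes [measurable]: "X \<in> borel_measurable M" "A \<in> sets borel"
  shows "expectation (\<lambda>\<omega>. indicat_real A (X \<omega>)) = prob (X -` A \<inter> space M)"
proof -
  have "expectation (\<lambda>\<omega>. indicat_real A (X \<omega>)) = expectation (indicator (X -` A \<inter> space M))"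
    by (rule Bochner_Integration.integral_cong) (auto split: split_indicator)
  then show ?thesis by simp
qed

text \<open>The shift by \<open>2\<close> turns the signed weight into a density, to which the uniqueness theorem for
  characteristic functions applies.\<close>

lemma (in prob_space) weighted_law_eq_of_char:
  fixes X w :: "'a \<Rightarrow> real"
  assumes [measurable]: "random_variable borel X" "random_variable borel w"
    and w: "\<And>\<omega>. \<bar>w \<omega>\<bar> \<le> 1"
    and char: "\<And>p. (CLINT \<omega>|M. complex_of_real (w \<omega>) * iexp (p * X \<omega>)) =
      expectation w * (CLINT \<omega>|M. iexp (p * X \<omega>))"
    and A [measurable]: "A \<in> sets borel"
  shows "expectation (\<lambda>\<omega>. w \<omega> * indicator A (X \<omega>)) = expectation w * prob (X -` A \<inter> space M)"
proof -
  define v where "v \<omega> = 2 + w \<omega>" for \<omega>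
  define c where "c = expectation v"
  define N where "N = density M (\<lambda>\<omega>. ennreal (v \<omega> / c))"
  have v: "1 \<le> v \<omega>" for \<omega> using w[of \<omega>] by (simp add: v_def abs_le_iff)
  have v_meas [measurable]: "v \<in> borel_measurable M" unfolding v_def[abs_def] by measurable
  have int_w: "integrable M w"
    by (rule integrable_const_bound[of _ 1]) (auto simp: w)
  then have int_v: "integrable M v" by (simp add: v_def[abs_def])
  have cw: "c = 2 + expectation w"
    using int_w by (simp add: c_def v_def[abs_def] prob_space)
  have "1 \<le> c" unfolding c_def by (rule integral_ge_const[OF int_v]) (simp add: v)
  then have c: "0 < c" by simp
  have vc: "0 \<le> v \<omega> / c" for \<omega> using v[of \<omega>] c by simp
  have int_iexp: "integrable M (\<lambda>\<omega>. iexp (p * X \<omega>))" for p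
    by (rule integrable_iexp) simp_all
  have char_v: "(CLINT \<omega>|M. complex_of_real (v \<omega>) * iexp (p * X \<omega>)) = c * (CLINT \<omega>|M. iexp (p * X \<omega>))" for p
  proof -
    have "integrable M (\<lambda>\<omega>. complex_of_real (w \<omega>) * iexp (p * X \<omega>))"
      by (rule integrable_const_bound[of _ 1]) (auto simp: norm_mult w)
    then show ?thesis
      using int_iexp[of p] char[of p] by (simp add: v_def cw distrib_right)
  qed
  have "prob_space N"
  proof
    have "emeasure N (space N) = (\<integral>\<^sup>+\<omega>. ennreal (v \<omega> / c) \<partial>M)"
      unfolding N_def by (simp add: emeasure_density cong: nn_integral_cong)
    also have "\<dots> = ennreal (expectation (\<lambda>\<omega>. v \<omega> / c))"
      using int_v vc by (intro nn_integral_eq_integral) auto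
    finally show "emeasure N (space N) = 1"
      using c by (simp add: c_def)
  qed
  then interpret N: prob_space N .
  have XN [measurable]: "X \<in> borel_measurable N"
    by (simp add: N_def)
  have "distr N borel X = distr M borel X"
  proof (rule Levy_uniqueness)
    show "real_distribution (distr N borel X)"
      by (rule N.real_distribution_distr) simp
    show "real_distribution (distr M borel X)"
      by (rule real_distribution_distr) simp
    show "Characteristic_Functions.char (distr N borel X) = Characteristic_Functions.char (distr M borel X)"
    proof
      fix t
      have "Characteristic_Functions.char (distr N borel X) t = (CLINT \<omega>|N. iexp (t * X \<omega>))"
        unfolding char_def by (simp add: integral_distr)
      also have "\<dots> = (CLINT \<omega>|M. (v \<omega> / c) *\<^sub>R iexp (t * X \<omega>))"
        unfolding N_def using vc by (intro integral_density) auto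
      also have "\<dots> = (CLINT \<omega>|M. complex_of_real (v \<omega>) * iexp (t * X \<omega>)) / c"
        by (subst integral_divide_zero[symmetric]) (simp add: scaleR_conv_of_real)
      also have "\<dots> = (CLINT \<omega>|M. iexp (t * X \<omega>))"
        unfolding char_v using c by simp
      also have "\<dots> = Characteristic_Functions.char (distr M borel X) t"
        unfolding char_def by (simp add: integral_distr)
      finally show "Characteristic_Functions.char (distr N borel X) t =
        Characteristic_Functions.char (distr M borel X) t" .
    qed
  qed
  then have "(LINT x|distr N borel X. indicator A x) = (LINT x|distr M borel X. indicator A x :: real)"
    by simp
  also have "(LINT x|distr M borel X. indicator A x :: real) = prob (X -` A \<inter> space M)"
    by (simp add: measure_distr)
  also have "(LINT x|distr N borel X. indicator A x :: real) = (LINT \<omega>|N. indicator A (X \<omega>))"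
    by (rule integral_distr) auto
  also have "\<dots> = (LINT \<omega>|M. (v \<omega> / c) *\<^sub>R indicator A (X \<omega>))"
    unfolding N_def using vc by (intro integral_density) auto
  also have "\<dots> = expectation (\<lambda>\<omega>. v \<omega> * indicator A (X \<omega>)) / c"
    by (subst integral_divide_zero[symmetric]) simp
  finally have "expectation (\<lambda>\<omega>. v \<omega> * indicator A (X \<omega>)) = c * prob (X -` A \<inter> space M)"
    using c by (simp add: field_simps)
  moreover have "expectation (\<lambda>\<omega>. v \<omega> * indicator A (X \<omega>)) =
      2 * prob (X -` A \<inter> space M) + expectation (\<lambda>\<omega>. w \<omega> * indicator A (X \<omega>))"
  proof -
    have "integrable M (\<lambda>\<omega>. w \<omega> * indicator A (X \<omega>))" "integrable M (\<lambda>\<omega>. indicat_real A (X \<omega>))"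
      by (rule integrable_const_bound[of _ 1]; auto simp: w split: split_indicator)+
    then show ?thesis
      by (simp add: v_def distrib_right expectation_indicator_comp)
  qed
  ultimately show ?thesis by (simp add: cw distrib_right)
qed

text \<open>Uniqueness of one-dimensional characteristic functions is applied twice, through
  \<open>weighted_law_eq_of_char\<close>: once for the law of X weighted by a function of V, and
  once for the law of V weighted by an indicator of X.\<close>

lemma (in prob_space) Kac_independence:
  fixes X V :: "'a \<Rightarrow> real"
  assumes [measurable]: "random_variable borel X" "random_variable borel V"
    and char: "\<And>p q. (CLINT \<omega>|M. iexp (p * X \<omega> + q * V \<omega>)) =
      (CLINT \<omega>|M. iexp (p * X \<omega>)) * (CLINT \<omega>|M. iexp (q * V \<omega>))"
  shows "indep_var borel X borel V"
proof -
  have int_iexp: "integrable M (\<lambda>\<omega>. iexp (g \<omega>))" if [measurable]: "g \<in> borel_measurable M" for g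
    by (rule integrable_iexp) simp_all
  have int_bdd: "integrable M (\<lambda>\<omega>. complex_of_real (g \<omega>))"
    if [measurable]: "g \<in> borel_measurable M" and "\<And>\<omega>. \<bar>g \<omega>\<bar> \<le> 1" for g
    by (rule integrable_const_bound[of _ 1]) (auto simp: that)
  have char2: "(CLINT \<omega>|M. iexp (q * V \<omega>) * iexp (p * X \<omega>)) =
      (CLINT \<omega>|M. iexp (p * X \<omega>)) * (CLINT \<omega>|M. iexp (q * V \<omega>))" for p q
    unfolding char[symmetric]
    by (rule Bochner_Integration.integral_cong) (auto simp: exp_add[symmetric] algebra_simps)
  have int2: "integrable M (\<lambda>\<omega>. iexp (q * V \<omega>) * iexp (p * X \<omega>))" for p q
    using int_iexp[of "\<lambda>\<omega>. q * V \<omega> + p * X \<omega>"] by (simp add: exp_add[symmetric] algebra_simps)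
  have cos_eq: "complex_of_real (cos y) = (1/2) * iexp y + (1/2) * iexp (- y)" for y
    by (simp add: cos_of_real[symmetric] cos_exp_eq add_divide_distrib)
  have sin_eq: "complex_of_real (sin y) = (1 / (2 * \<i>)) * iexp y + (- 1 / (2 * \<i>)) * iexp (- y)" for y
    by (simp add: sin_of_real[symmetric] sin_exp_eq right_diff_distrib diff_divide_distrib)
  \<comment> \<open>First round: V enters through the bounded weights cos (q V) and sin (q V). They
    are combinations of iexp (q V) and iexp (- q V) and inherit the factorization.\<close>
  have trig: "expectation (\<lambda>\<omega>. g (q * V \<omega>) * indicator A (X \<omega>)) =
      expectation (\<lambda>\<omega>. g (q * V \<omega>)) * prob (X -` A \<inter> space M)"
    if A [measurable]: "A \<in> sets borel" and [measurable]: "g \<in> borel_measurable borel"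
      and g: "\<And>y. \<bar>g y\<bar> \<le> 1" "\<And>y. complex_of_real (g y) = a * iexp y + b * iexp (- y)"
    for A g a b q
  proof (rule weighted_law_eq_of_char)
    fix p
    have "(CLINT \<omega>|M. complex_of_real (g (q * V \<omega>)) * iexp (p * X \<omega>)) =
        (CLINT \<omega>|M. a * (iexp (q * V \<omega>) * iexp (p * X \<omega>)) + b * (iexp ((- q) * V \<omega>) * iexp (p * X \<omega>)))"
      by (rule Bochner_Integration.integral_cong) (auto simp: g(2) algebra_simps)
    also have "\<dots> = (CLINT \<omega>|M. a * (iexp (q * V \<omega>) * iexp (p * X \<omega>))) +
        (CLINT \<omega>|M. b * (iexp ((- q) * V \<omega>) * iexp (p * X \<omega>)))"
      by (intro Bochner_Integration.integral_add integrable_mult_right int2)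
    also have "\<dots> = (a * (CLINT \<omega>|M. iexp (q * V \<omega>)) + b * (CLINT \<omega>|M. iexp ((- q) * V \<omega>))) *
        (CLINT \<omega>|M. iexp (p * X \<omega>))"
      unfolding integral_mult_right_zero char2 by (simp add: algebra_simps)
    also have "a * (CLINT \<omega>|M. iexp (q * V \<omega>)) + b * (CLINT \<omega>|M. iexp ((- q) * V \<omega>)) =
        (CLINT \<omega>|M. a * iexp (q * V \<omega>) + b * iexp ((- q) * V \<omega>))"
      unfolding integral_mult_right_zero[symmetric]
      by (intro Bochner_Integration.integral_add[symmetric] integrable_mult_right int_iexp) measurable
    also have "\<dots> = (CLINT \<omega>|M. complex_of_real (g (q * V \<omega>)))"
      by (rule Bochner_Integration.integral_cong) (auto simp: g(2))
    finally show "(CLINT \<omega>|M. complex_of_real (g (q * V \<omega>)) * iexp (p * X \<omega>)) =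
        complex_of_real (expectation (\<lambda>\<omega>. g (q * V \<omega>))) * (CLINT \<omega>|M. iexp (p * X \<omega>))"
      by simp
  qed (simp_all add: A g(1))
  have prod: "prob (X -` A \<inter> space M \<inter> (V -` B \<inter> space M)) =
      prob (X -` A \<inter> space M) * prob (V -` B \<inter> space M)"
    if A [measurable]: "A \<in> sets borel" and B [measurable]: "B \<in> sets borel" for A B
  proof -
    let ?IA = "\<lambda>\<omega>. indicat_real A (X \<omega>)"
    \<comment> \<open>Second round, with the roles exchanged: the indicator of A at X is the weight,
      and the first round supplies the factorization for the real and imaginary parts of iexp (q
      V).\<close>
    have "expectation (\<lambda>\<omega>. ?IA \<omega> * indicator B (V \<omega>)) = expectation ?IA * prob (V -` B \<inter> space M)"
    proof (rule weighted_law_eq_of_char)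
      fix q
      have cis: "iexp y = complex_of_real (cos y) + \<i> * complex_of_real (sin y)" for y
        by (simp add: cis_conv_exp[symmetric] complex_eq_iff mult.commute)
      have weight: "complex_of_real s * iexp y = complex_of_real (cos y * s) + \<i> * complex_of_real (sin y * s)" for s y
        by (simp only: cis) (simp add: algebra_simps)
      have c: "expectation (\<lambda>\<omega>. cos (q * V \<omega>) * ?IA \<omega>) = expectation (\<lambda>\<omega>. cos (q * V \<omega>)) * expectation ?IA"
        unfolding expectation_indicator_comp[OF assms(1) A] by (rule trig[OF A _ _ cos_eq]) auto
      have s: "expectation (\<lambda>\<omega>. sin (q * V \<omega>) * ?IA \<omega>) = expectation (\<lambda>\<omega>. sin (q * V \<omega>)) * expectation ?IA"
        unfolding expectation_indicator_comp[OF assms(1) A] by (rule trig[OF A _ _ sin_eq]) auto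
      have E: "(CLINT \<omega>|M. iexp (q * V \<omega>)) = (CLINT \<omega>|M. complex_of_real (cos (q * V \<omega>))) +
          \<i> * (CLINT \<omega>|M. complex_of_real (sin (q * V \<omega>)))"
        unfolding cis integral_mult_right_zero[symmetric]
        by (intro Bochner_Integration.integral_add integrable_mult_right int_bdd) auto
      have "(CLINT \<omega>|M. complex_of_real (?IA \<omega>) * iexp (q * V \<omega>)) =
          (CLINT \<omega>|M. complex_of_real (cos (q * V \<omega>) * ?IA \<omega>)) +
          \<i> * (CLINT \<omega>|M. complex_of_real (sin (q * V \<omega>) * ?IA \<omega>))"
        unfolding weight integral_mult_right_zero[symmetric]
        by (intro Bochner_Integration.integral_add integrable_mult_right int_bdd)
          (auto split: split_indicator)
      then show "(CLINT \<omega>|M. complex_of_real (?IA \<omega>) * iexp (q * V \<omega>)) =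
          complex_of_real (expectation ?IA) * (CLINT \<omega>|M. iexp (q * V \<omega>))"
        unfolding E integral_complex_of_real c s by (simp add: algebra_simps)
    qed (auto simp: B split: split_indicator)
    moreover have "expectation (\<lambda>\<omega>. ?IA \<omega> * indicator B (V \<omega>)) =
        expectation (indicator (X -` A \<inter> space M \<inter> (V -` B \<inter> space M)))"
      by (rule Bochner_Integration.integral_cong) (auto split: split_indicator)
    ultimately show ?thesis
      by (simp add: expectation_indicator_comp)
  qed
  have "distr M borel X \<Otimes>\<^sub>M distr M borel V = distr M (borel \<Otimes>\<^sub>M borel) (\<lambda>x. (X x, V x))"
  proof (rule pair_measure_eqI)
    interpret DX: prob_space "distr M borel X" by (rule prob_space_distr) simp
    interpret DV: prob_space "distr M borel V" by (rule prob_space_distr) simp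
    show "sigma_finite_measure (distr M borel X)" "sigma_finite_measure (distr M borel V)"
      by unfold_locales
    show "sets (distr M borel X \<Otimes>\<^sub>M distr M borel V) = sets (distr M (borel \<Otimes>\<^sub>M borel) (\<lambda>x. (X x, V x)))"
      by (simp cong: sets_pair_measure_cong)
    fix A B assume "A \<in> sets (distr M borel X)" "B \<in> sets (distr M borel V)"
    then have AB [measurable]: "A \<in> sets borel" "B \<in> sets borel" by auto
    have "(\<lambda>x. (X x, V x)) -` (A \<times> B) \<inter> space M = X -` A \<inter> space M \<inter> (V -` B \<inter> space M)"
      by auto
    then show "emeasure (distr M borel X) A * emeasure (distr M borel V) B =
        emeasure (distr M (borel \<Otimes>\<^sub>M borel) (\<lambda>x. (X x, V x))) (A \<times> B)"
      using prod[OF AB] by (simp add: emeasure_distr emeasure_eq_measure ennreal_mult)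
  qed
  then show ?thesis
    by (subst indep_var_distribution_eq) simp
qed

section \<open>Standard normal estimates and Gaussian linear combinations\<close>

lemma std_normal_abs_le:
  assumes "0 \<le> r"
  shows "measure std_normal_distribution {x. \<bar>x\<bar> \<le> r} \<le> r"
proof -
  interpret real_distribution std_normal_distribution by (rule real_dist_normal_dist)
  have d: "std_normal_density x \<le> 1 / 2" for x
  proof -
    have "std_normal_density x \<le> 1 / sqrt (2 * pi)"
      by (simp add: std_normal_density_def divide_simps)
    also have "sqrt 4 \<le> sqrt (2 * pi)"
      using pi_ge_two by (subst real_sqrt_le_iff) simp
    then have "1 / sqrt (2 * pi) \<le> 1 / 2"
      by (simp add: divide_simps)
    finally show ?thesis .
  qed
  have eq: "{x. \<bar>x\<bar> \<le> r} = {-r..r}" by auto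
  have "emeasure std_normal_distribution {-r..r} =
      (\<integral>\<^sup>+x. ennreal (std_normal_density x) * indicator {-r..r} x \<partial>lborel)"
    by (rule emeasure_density) auto
  also have "\<dots> \<le> (\<integral>\<^sup>+x. ennreal (1/2) * indicator {-r..r} x \<partial>lborel)"
    by (intro nn_integral_mono mult_right_mono ennreal_leI d) auto
  also have "\<dots> = ennreal (1/2) * ennreal (2 * r)"
    using assms by (subst nn_integral_cmult_indicator) auto
  also have "\<dots> = ennreal r"
    using assms by (subst ennreal_mult[symmetric]) auto
  finally show ?thesis
    using assms by (simp add: eq emeasure_eq_measure)
qed

text \<open>The density decreases with the distance from 0, so on [-2, 2] it is at least its value
  at 2. One constant then serves both factors in \<open>prob_opposite_signs\<close>.\<close>

lemma std_normal_interval_ge: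
  assumes "- 2 \<le> a" "a \<le> b" "b \<le> 2"
  shows "std_normal_density 2 * (b - a) \<le> measure std_normal_distribution {a<..<b}"
proof -
  interpret real_distribution std_normal_distribution by (rule real_dist_normal_dist)
  have d: "std_normal_density 2 \<le> std_normal_density x" if "x \<in> {a<..<b}" for x
  proof -
    have "x\<^sup>2 \<le> 2\<^sup>2"
      using that assms by (subst abs_le_square_iff[symmetric]) auto
    then show ?thesis
      by (simp add: std_normal_density_def divide_right_mono)
  qed
  have "ennreal (std_normal_density 2 * (b - a)) =
      (\<integral>\<^sup>+x. ennreal (std_normal_density 2) * indicator {a<..<b} x \<partial>lborel)"
    using assms by (subst nn_integral_cmult_indicator) (auto simp: ennreal_mult)
  also have "\<dots> \<le> (\<integral>\<^sup>+x. ennreal (std_normal_density x) * indicator {a<..<b} x \<partial>lborel)"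
    using d by (intro nn_integral_mono) (auto split: split_indicator intro!: ennreal_leI)
  also have "\<dots> = emeasure std_normal_distribution {a<..<b}"
    by (rule emeasure_density[symmetric]) auto
  finally show ?thesis
    by (simp add: emeasure_eq_measure)
qed

locale gaussian_family = prob_space M for M :: "'w measure" +
  fixes I :: "'i set" and \<eta> :: "'i \<Rightarrow> 'w \<Rightarrow> real"
  assumes finite_I: "finite I"
    and indep: "indep_vars (\<lambda>_. borel) \<eta> I"
    and law: "\<And>i. i \<in> I \<Longrightarrow> distr M borel (\<eta> i) = std_normal_distribution"
begin

lemma \<eta>_measurable [measurable]: "i \<in> I \<Longrightarrow> \<eta> i \<in> borel_measurable M"
  using indep by (auto simp: indep_vars_def)

definition comb :: "('i \<Rightarrow> real) \<Rightarrow> 'w \<Rightarrow> real"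
  where "comb a \<omega> = (\<Sum>i\<in>I. a i * \<eta> i \<omega>)"

definition sqnorm :: "('i \<Rightarrow> real) \<Rightarrow> real"
  where "sqnorm a = (\<Sum>i\<in>I. (a i)\<^sup>2)"

lemma sqnorm_nonneg [simp]: "0 \<le> sqnorm a"
  by (simp add: sqnorm_def sum_nonneg)

lemma comb_measurable [measurable]: "comb a \<in> borel_measurable M"
  unfolding comb_def by measurable

lemma char_comb:
  "Characteristic_Functions.char (distr M borel (comb a)) t = exp (- (sqnorm a * t\<^sup>2) / 2)"
proof -
  have [measurable]: "\<And>i. i \<in> I \<Longrightarrow> (\<lambda>\<omega>. a i * \<eta> i \<omega>) \<in> borel_measurable M"
    by measurable
  have ind: "indep_vars (\<lambda>_. borel) (\<lambda>i \<omega>. a i * \<eta> i \<omega>) I"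
    by (rule indep_vars_compose2[OF indep]) simp
  have "Characteristic_Functions.char (distr M borel (comb a)) t =
      (\<Prod>i\<in>I. Characteristic_Functions.char (distr M borel (\<lambda>\<omega>. a i * \<eta> i \<omega>)) t)"
    unfolding comb_def[abs_def] by (rule char_distr_sum[OF ind])
  also have "\<dots> = (\<Prod>i\<in>I. complex_of_real (exp (- ((a i)\<^sup>2 * t\<^sup>2) / 2)))"
  proof (rule prod.cong[OF refl])
    fix i assume i: "i \<in> I"
    have "Characteristic_Functions.char (distr M borel (\<lambda>\<omega>. a i * \<eta> i \<omega>)) t =
        (CLINT \<omega>|M. iexp (t * (a i * \<eta> i \<omega>)))"
      unfolding char_def using i by (simp add: integral_distr)
    also have "\<dots> = Characteristic_Functions.char (distr M borel (\<eta> i)) (t * a i)"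
      unfolding char_def using i by (simp add: integral_distr mult_ac)
    also have "\<dots> = complex_of_real (exp (- ((t * a i)\<^sup>2) / 2))"
      by (simp add: law[OF i] char_std_normal_distribution)
    finally show "Characteristic_Functions.char (distr M borel (\<lambda>\<omega>. a i * \<eta> i \<omega>)) t =
        complex_of_real (exp (- ((a i)\<^sup>2 * t\<^sup>2) / 2))"
      by (simp add: power_mult_distrib mult_ac)
  qed
  also have "\<dots> = complex_of_real (exp (\<Sum>i\<in>I. - ((a i)\<^sup>2 * t\<^sup>2) / 2))"
    by (simp add: exp_sum finite_I)
  also have "(\<Sum>i\<in>I. - ((a i)\<^sup>2 * t\<^sup>2) / 2) = - (sqnorm a * t\<^sup>2) / 2"
    by (simp add: sqnorm_def sum_negf sum_divide_distrib sum_distrib_right)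
  finally show ?thesis by simp
qed

text \<open>An image of the standard normal law, and not a density, so that the degenerate case
  \<open>sqnorm a = 0\<close> is included.\<close>

lemma distr_comb:
  "distr M borel (comb a) = distr std_normal_distribution borel (\<lambda>x. sqrt (sqnorm a) * x)"
proof (rule Levy_uniqueness)
  interpret N: real_distribution std_normal_distribution by (rule real_dist_normal_dist)
  show "real_distribution (distr M borel (comb a))"
    by (rule real_distribution_distr) simp
  show "real_distribution (distr std_normal_distribution borel (\<lambda>x. sqrt (sqnorm a) * x))"
    by (rule N.real_distribution_distr) simp
  show "Characteristic_Functions.char (distr M borel (comb a)) =
    Characteristic_Functions.char (distr std_normal_distribution borel (\<lambda>x. sqrt (sqnorm a) * x))"
  proof
    fix t
    have "Characteristic_Functions.char (distr std_normal_distribution borel (\<lambda>x. sqrt (sqnorm a) * x)) t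
        = Characteristic_Functions.char std_normal_distribution (t * sqrt (sqnorm a))"
      unfolding char_def by (simp add: integral_distr mult_ac)
    also have "\<dots> = exp (- (sqnorm a * t\<^sup>2) / 2)"
      by (simp add: char_std_normal_distribution power_mult_distrib mult_ac)
    finally show "Characteristic_Functions.char (distr M borel (comb a)) t =
      Characteristic_Functions.char (distr std_normal_distribution borel (\<lambda>x. sqrt (sqnorm a) * x)) t"
      by (simp add: char_comb)
  qed
qed

lemma expectation_iexp_comb: "(CLINT \<omega>|M. iexp (t * comb a \<omega>)) = exp (- (sqnorm a * t\<^sup>2) / 2)"
  using char_comb[of a t] by (simp add: char_def integral_distr)

text \<open>The hypothesis says that the covariance is 0. The variance of p X + q V then has no
  cross term, and the Gaussian characteristic function factors.\<close>

lemma uncorrelated_imp_indep: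
  assumes "(\<Sum>i\<in>I. a i * b i) = 0"
  shows "indep_var borel (comb a) borel (comb b)"
proof (rule Kac_independence)
  fix p q
  have eq: "p * comb a \<omega> + q * comb b \<omega> = 1 * comb (\<lambda>i. p * a i + q * b i) \<omega>" for \<omega>
    by (simp add: comb_def sum_distrib_left sum.distrib[symmetric] algebra_simps)
  have "sqnorm (\<lambda>i. p * a i + q * b i) = p\<^sup>2 * sqnorm a + q\<^sup>2 * sqnorm b + 2 * p * q * (\<Sum>i\<in>I. a i * b i)"
    unfolding sqnorm_def sum_distrib_left sum.distrib[symmetric]
    by (rule sum.cong) (auto simp: power2_eq_square algebra_simps)
  then have sq: "sqnorm (\<lambda>i. p * a i + q * b i) = p\<^sup>2 * sqnorm a + q\<^sup>2 * sqnorm b"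
    by (simp add: assms)
  show "(CLINT \<omega>|M. iexp (p * comb a \<omega> + q * comb b \<omega>)) =
      (CLINT \<omega>|M. iexp (p * comb a \<omega>)) * (CLINT \<omega>|M. iexp (q * comb b \<omega>))"
    unfolding eq expectation_iexp_comb sq
    by (simp add: exp_add[symmetric] diff_divide_distrib mult.commute flip: of_real_mult)
qed simp_all

lemma prob_abs_comb_le:
  assumes "0 < sqnorm a" "0 \<le> r"
  shows "prob {\<omega>\<in>space M. \<bar>comb a \<omega>\<bar> \<le> r} \<le> r / sqrt (sqnorm a)"
proof -
  have "prob {\<omega>\<in>space M. \<bar>comb a \<omega>\<bar> \<le> r} = measure (distr M borel (comb a)) {x. \<bar>x\<bar> \<le> r}"
    by (subst measure_distr) (auto intro!: arg_cong[where f = prob])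
  also have "\<dots> = measure std_normal_distribution {x. \<bar>x\<bar> \<le> r / sqrt (sqnorm a)}"
    unfolding distr_comb using assms
    by (subst measure_distr) (auto intro!: arg_cong[where f = "measure _"] simp: abs_mult field_simps)
  also have "\<dots> \<le> r / sqrt (sqnorm a)"
    by (rule std_normal_abs_le) (use assms in simp)
  finally show ?thesis .
qed

lemma comb_moments:
  shows integrable_comb: "integrable M (comb a)"
    and integrable_comb_squared: "integrable M (\<lambda>\<omega>. (comb a \<omega>)\<^sup>2)"
    and expectation_comb_squared: "expectation (\<lambda>\<omega>. (comb a \<omega>)\<^sup>2) = sqnorm a"
    and expectation_abs_comb_le: "expectation (\<lambda>\<omega>. \<bar>comb a \<omega>\<bar>) \<le> sqrt (sqnorm a)"
proof -
  let ?s = "sqrt (sqnorm a)"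
  interpret N: real_distribution std_normal_distribution by (rule real_dist_normal_dist)
  have E: "integrable M (\<lambda>\<omega>. g (comb a \<omega>)) \<longleftrightarrow> integrable std_normal_distribution (\<lambda>x. g (?s * x))"
    "expectation (\<lambda>\<omega>. g (comb a \<omega>)) = (LINT x|std_normal_distribution. g (?s * x))"
    if [measurable]: "g \<in> borel_measurable borel" for g :: "real \<Rightarrow> real"
    using integrable_distr_eq[of "comb a" M borel g] integral_distr[of "comb a" M borel g]
      integrable_distr_eq[of "\<lambda>x. ?s * x" std_normal_distribution borel g]
      integral_distr[of "\<lambda>x. ?s * x" std_normal_distribution borel g]
    by (simp_all add: distr_comb)
  have i1: "integrable std_normal_distribution (\<lambda>x. x)"
    using integrable_std_normal_distribution_moment[of 1] by simp
  have i2: "integrable std_normal_distribution (\<lambda>x. x\<^sup>2)"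
    by (rule integrable_std_normal_distribution_moment)
  have e2: "(LINT x|std_normal_distribution. x\<^sup>2) = 1"
    using std_normal_distribution_even_moments(1)[of 1] by simp
  have m: "(\<lambda>x. x) \<in> borel_measurable borel" "(\<lambda>x::real. x\<^sup>2) \<in> borel_measurable borel"
      "(abs :: real \<Rightarrow> real) \<in> borel_measurable borel"
    by measurable
  have "integrable std_normal_distribution (\<lambda>x. ?s * x)"
    using i1 by (rule integrable_mult_right)
  then show "integrable M (comb a)"
    by (simp only: E(1)[OF m(1)])
  have "integrable std_normal_distribution (\<lambda>x. ?s\<^sup>2 * x\<^sup>2)"
    using i2 by (rule integrable_mult_right)
  then show "integrable M (\<lambda>\<omega>. (comb a \<omega>)\<^sup>2)"
    by (simp only: E(1)[OF m(2)] power_mult_distrib)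
  have "(LINT x|std_normal_distribution. ?s\<^sup>2 * x\<^sup>2) = sqnorm a"
    by (subst integral_mult_right_zero) (simp add: e2)
  then show "expectation (\<lambda>\<omega>. (comb a \<omega>)\<^sup>2) = sqnorm a"
    by (simp only: E(2)[OF m(2)] power_mult_distrib)
  \<comment> \<open>AM-GM in place of Cauchy-Schwarz: (1 + x^2) / 2 has expectation 1.\<close>
  have "(LINT x|std_normal_distribution. \<bar>x\<bar>) \<le> (LINT x|std_normal_distribution. (1 + x\<^sup>2) / 2)"
  proof (rule integral_mono)
    show "\<bar>x\<bar> \<le> (1 + x\<^sup>2) / 2" for x :: real
      using sum_squares_bound[of 1 "\<bar>x\<bar>"] by simp
  qed (use i1 i2 in auto)
  also have "\<dots> = 1"
  proof -
    have "N.prob UNIV = 1" using N.prob_space by simp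
    then show ?thesis using i2 e2 by simp
  qed
  finally have "(LINT x|std_normal_distribution. \<bar>x\<bar>) \<le> 1" .
  then have "?s * (LINT x|std_normal_distribution. \<bar>x\<bar>) \<le> ?s"
    by (intro mult_left_le) auto
  moreover have "(LINT x|std_normal_distribution. \<bar>?s * x\<bar>) = ?s * (LINT x|std_normal_distribution. \<bar>x\<bar>)"
    by (subst integral_mult_right_zero[symmetric]) (simp add: abs_mult)
  ultimately show "expectation (\<lambda>\<omega>. \<bar>comb a \<omega>\<bar>) \<le> ?s"
    by (simp only: E(2)[OF m(3)])
qed

text \<open>By independence the bound for a fixed threshold may be integrated over the law of
  \<open>comb b\<close>. The threshold is affine in its absolute value, so only the first absolute
  moment enters.\<close>

lemma prob_abs_comb_le_abs_comb:
  assumes ab: "(\<Sum>i\<in>I. a i * b i) = 0" and a: "0 < sqnorm a"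
    and r: "0 \<le> q" "0 \<le> e"
  shows "prob {\<omega>\<in>space M. \<bar>comb a \<omega>\<bar> \<le> q * \<bar>comb b \<omega>\<bar> + e} \<le>
    (q * sqrt (sqnorm b) + e) / sqrt (sqnorm a)"
proof -
  let ?X = "distr M borel (comb a)" and ?V = "distr M borel (comb b)"
  interpret X: prob_space ?X by (rule prob_space_distr) simp
  interpret V: prob_space ?V by (rule prob_space_distr) simp
  interpret XV: pair_prob_space ?X ?V ..
  let ?S = "{(x, v). \<bar>x\<bar> \<le> q * \<bar>v\<bar> + e} :: (real \<times> real) set"
  have S [measurable]: "?S \<in> sets (borel \<Otimes>\<^sub>M borel)"
  proof -
    have "{x \<in> space (borel \<Otimes>\<^sub>M borel). \<bar>fst x\<bar> \<le> q * \<bar>snd x :: real\<bar> + e} \<in> sets (borel \<Otimes>\<^sub>M borel)"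
      by measurable
    then show ?thesis by (simp add: space_pair_measure case_prod_unfold)
  qed
  have joint: "?X \<Otimes>\<^sub>M ?V = distr M (borel \<Otimes>\<^sub>M borel) (\<lambda>\<omega>. (comb a \<omega>, comb b \<omega>))"
    using uncorrelated_imp_indep[OF ab] by (subst (asm) indep_var_distribution_eq) simp
  have "emeasure M {\<omega>\<in>space M. \<bar>comb a \<omega>\<bar> \<le> q * \<bar>comb b \<omega>\<bar> + e} = emeasure (?X \<Otimes>\<^sub>M ?V) ?S"
    unfolding joint by (subst emeasure_distr) (auto intro!: arg_cong[where f = "emeasure M"])
  also have "\<dots> = (\<integral>\<^sup>+v. emeasure ?X ((\<lambda>x. (x, v)) -` ?S) \<partial>?V)"
    by (rule XV.emeasure_pair_measure_alt2) (simp cong: sets_pair_measure_cong)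
  also have "\<dots> \<le> (\<integral>\<^sup>+v. ennreal ((q * \<bar>v\<bar> + e) / sqrt (sqnorm a)) \<partial>?V)"
  proof (rule nn_integral_mono)
    fix v
    have "emeasure ?X ((\<lambda>x. (x, v)) -` ?S) = emeasure M {\<omega>\<in>space M. \<bar>comb a \<omega>\<bar> \<le> q * \<bar>v\<bar> + e}"
      by (subst emeasure_distr) (auto intro!: arg_cong[where f = "emeasure M"])
    also have "\<dots> \<le> ennreal ((q * \<bar>v\<bar> + e) / sqrt (sqnorm a))"
      unfolding emeasure_eq_measure using r by (intro ennreal_leI prob_abs_comb_le a) simp
    finally show "emeasure ?X ((\<lambda>x. (x, v)) -` ?S) \<le> ennreal ((q * \<bar>v\<bar> + e) / sqrt (sqnorm a))" .
  qed
  also have "\<dots> = (\<integral>\<^sup>+\<omega>. ennreal ((q * \<bar>comb b \<omega>\<bar> + e) / sqrt (sqnorm a)) \<partial>M)"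
    by (rule nn_integral_distr) auto
  also have "\<dots> = ennreal (expectation (\<lambda>\<omega>. (q * \<bar>comb b \<omega>\<bar> + e) / sqrt (sqnorm a)))"
    using integrable_comb[of b] r by (intro nn_integral_eq_integral) auto
  also have "expectation (\<lambda>\<omega>. (q * \<bar>comb b \<omega>\<bar> + e) / sqrt (sqnorm a)) =
      (q * expectation (\<lambda>\<omega>. \<bar>comb b \<omega>\<bar>) + e) / sqrt (sqnorm a)"
    using integrable_comb[of b] by (simp add: prob_space)
  also have "ennreal \<dots> \<le> ennreal ((q * sqrt (sqnorm b) + e) / sqrt (sqnorm a))"
    using r expectation_abs_comb_le[of b]
    by (intro ennreal_leI divide_right_mono add_right_mono mult_left_mono) auto
  finally show ?thesis
    using r unfolding emeasure_eq_measure by (subst (asm) ennreal_le_iff) auto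
qed

text \<open>With \<open>S = X + X'\<close> and \<open>T = X - X'\<close>, the event \<open>X X' < 0\<close> is \<open>\<bar>S\<bar> < \<bar>T\<bar>\<close>, and \<open>S\<close>, \<open>T\<close> are
  uncorrelated as \<open>X\<close> and \<open>X'\<close> have the same variance.\<close>

lemma prob_opposite_signs:
  assumes ab: "sqnorm a = \<kappa>" "sqnorm b = \<kappa>" and \<kappa>: "0 < \<kappa>"
  shows "(std_normal_density 2)\<^sup>2 * sqnorm (\<lambda>i. a i - b i) / (2 * \<kappa>) \<le>
    prob {\<omega>\<in>space M. comb a \<omega> * comb b \<omega> < 0}"
proof -
  let ?s = "\<lambda>i. a i + b i" and ?t = "\<lambda>i. a i - b i"
  define u where "u = sqrt (sqnorm ?t)"
  have par: "sqnorm ?s + sqnorm ?t = 4 * \<kappa>"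
  proof -
    have "sqnorm ?s + sqnorm ?t = 2 * sqnorm a + 2 * sqnorm b"
      unfolding sqnorm_def sum_distrib_left sum.distrib[symmetric]
      by (rule sum.cong) (auto simp: power2_eq_square algebra_simps)
    then show ?thesis by (simp add: ab)
  qed
  have u: "0 \<le> u" "u \<le> 2 * sqrt \<kappa>"
  proof -
    have "sqrt (sqnorm ?t) \<le> sqrt (4 * \<kappa>)"
      using par sqnorm_nonneg[of ?s] by (intro real_sqrt_le_mono) linarith
    then show "0 \<le> u" "u \<le> 2 * sqrt \<kappa>" by (simp_all add: u_def real_sqrt_mult)
  qed
  show ?thesis
  proof (cases "u = 0")
    case True
    then show ?thesis by (simp add: u_def)
  next
    case False
    then have u0: "0 < u" using u by simp
    have "(\<Sum>i\<in>I. ?s i * ?t i) = sqnorm a - sqnorm b"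
      unfolding sqnorm_def sum_subtractf[symmetric]
      by (rule sum.cong) (auto simp: power2_eq_square algebra_simps)
    then have "indep_var borel (comb ?s) borel (comb ?t)"
      by (intro uncorrelated_imp_indep) (simp add: ab)
    \<comment> \<open>With u the standard deviation of T, the event |S| < u \<le> |T| splits into
      independent events. T exceeds one standard deviation with probability bounded below; S has
      deviation at most 2 sqrt \<kappa>, so |S| < u has probability at least of order u / sqrt
      \<kappa>.\<close>
    from indep_varD[OF this, of "{-u<..<u}" "{x. u \<le> \<bar>x\<bar>}"]
    have "prob ((\<lambda>\<omega>. (comb ?s \<omega>, comb ?t \<omega>)) -` ({-u<..<u} \<times> {x. u \<le> \<bar>x\<bar>}) \<inter> space M) =
        prob (comb ?s -` {-u<..<u} \<inter> space M) * prob (comb ?t -` {x. u \<le> \<bar>x\<bar>} \<inter> space M)"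
      by simp
    moreover have "prob ((\<lambda>\<omega>. (comb ?s \<omega>, comb ?t \<omega>)) -` ({-u<..<u} \<times> {x. u \<le> \<bar>x\<bar>}) \<inter> space M)
        \<le> prob {\<omega>\<in>space M. comb a \<omega> * comb b \<omega> < 0}"
    proof (rule finite_measure_mono)
      show "(\<lambda>\<omega>. (comb ?s \<omega>, comb ?t \<omega>)) -` ({-u<..<u} \<times> {x. u \<le> \<bar>x\<bar>}) \<inter> space M
        \<subseteq> {\<omega>\<in>space M. comb a \<omega> * comb b \<omega> < 0}"
      proof clarsimp
        fix \<omega> assume *: "- u < comb ?s \<omega>" "comb ?s \<omega> < u" "u \<le> \<bar>comb ?t \<omega>\<bar>"
        have st: "comb ?s \<omega> = comb a \<omega> + comb b \<omega>" "comb ?t \<omega> = comb a \<omega> - comb b \<omega>"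
          by (simp_all add: comb_def sum.distrib[symmetric] sum_subtractf[symmetric] algebra_simps)
        have "\<bar>comb ?s \<omega>\<bar> < \<bar>comb ?t \<omega>\<bar>" using * by linarith
        then have "(comb ?s \<omega>)\<^sup>2 < (comb ?t \<omega>)\<^sup>2"
          by (simp add: abs_le_square_iff[symmetric] not_le[symmetric])
        then show "comb a \<omega> * comb b \<omega> < 0"
          by (simp add: st power2_eq_square algebra_simps)
      qed
      show "{\<omega>\<in>space M. comb a \<omega> * comb b \<omega> < 0} \<in> events"
        by measurable
    qed
    moreover have "std_normal_density 2 * (u / sqrt \<kappa>) \<le> prob (comb ?s -` {-u<..<u} \<inter> space M)"
    proof -
      interpret N: real_distribution std_normal_distribution by (rule real_dist_normal_dist)
      have "std_normal_density 2 * (u / (2 * sqrt \<kappa>) - (- (u / (2 * sqrt \<kappa>)))) \<le>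
          measure std_normal_distribution {- (u / (2 * sqrt \<kappa>))<..<u / (2 * sqrt \<kappa>)}"
      proof (rule std_normal_interval_ge)
        have "u / (2 * sqrt \<kappa>) \<le> 1" using u \<kappa> by simp
        then show "- 2 \<le> - (u / (2 * sqrt \<kappa>))" "u / (2 * sqrt \<kappa>) \<le> 2" by linarith+
        have "0 \<le> u / (2 * sqrt \<kappa>)" using u \<kappa> by simp
        then show "- (u / (2 * sqrt \<kappa>)) \<le> u / (2 * sqrt \<kappa>)" by linarith
      qed
      also have "\<dots> \<le> measure std_normal_distribution ((\<lambda>x. sqrt (sqnorm ?s) * x) -` {-u<..<u})"
      proof (rule N.finite_measure_mono)
        have le: "sqrt (sqnorm ?s) \<le> 2 * sqrt \<kappa>"
        proof -
          have "sqrt (sqnorm ?s) \<le> sqrt (4 * \<kappa>)"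
            using par sqnorm_nonneg[of ?t] by (intro real_sqrt_le_mono) linarith
          then show ?thesis by (simp add: real_sqrt_mult)
        qed
        show "{- (u / (2 * sqrt \<kappa>))<..<u / (2 * sqrt \<kappa>)} \<subseteq> (\<lambda>x. sqrt (sqnorm ?s) * x) -` {-u<..<u}"
        proof
          fix x assume "x \<in> {- (u / (2 * sqrt \<kappa>))<..<u / (2 * sqrt \<kappa>)}"
          then have "\<bar>x\<bar> < u / (2 * sqrt \<kappa>)" by auto
          then have "2 * sqrt \<kappa> * \<bar>x\<bar> < u" using \<kappa> by (simp add: field_simps)
          moreover have "sqrt (sqnorm ?s) * \<bar>x\<bar> \<le> 2 * sqrt \<kappa> * \<bar>x\<bar>"
            by (rule mult_right_mono[OF le]) simp
          ultimately have "\<bar>sqrt (sqnorm ?s) * x\<bar> < u"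
            by (simp add: abs_mult)
          then show "x \<in> (\<lambda>x. sqrt (sqnorm ?s) * x) -` {-u<..<u}" by auto
        qed
      qed (use measurable_sets[of "\<lambda>x. sqrt (sqnorm ?s) * x" borel borel "{-u<..<u}"] in simp)
      also have "\<dots> = measure (distr M borel (comb ?s)) {-u<..<u}"
        unfolding distr_comb by (subst measure_distr) auto
      also have "\<dots> = prob (comb ?s -` {-u<..<u} \<inter> space M)"
        by (subst measure_distr) auto
      finally show ?thesis by simp
    qed
    moreover have "std_normal_density 2 \<le> prob (comb ?t -` {x. u \<le> \<bar>x\<bar>} \<inter> space M)"
    proof -
      interpret N: real_distribution std_normal_distribution by (rule real_dist_normal_dist)
      have "std_normal_density 2 * (2 - 1) \<le> measure std_normal_distribution {1<..<2}"
        by (rule std_normal_interval_ge) auto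
      also have "\<dots> \<le> measure std_normal_distribution ((\<lambda>x. sqrt (sqnorm ?t) * x) -` {x. u \<le> \<bar>x\<bar>})"
        using u0 measurable_sets[of "\<lambda>x. sqrt (sqnorm ?t) * x" borel borel "{x. u \<le> \<bar>x\<bar>}"]
        by (intro N.finite_measure_mono) (auto simp: u_def[symmetric] abs_mult)
      also have "\<dots> = measure (distr M borel (comb ?t)) {x. u \<le> \<bar>x\<bar>}"
        unfolding distr_comb by (subst measure_distr) auto
      also have "\<dots> = prob (comb ?t -` {x. u \<le> \<bar>x\<bar>} \<inter> space M)"
        by (subst measure_distr) auto
      finally show ?thesis by simp
    qed
    ultimately have "std_normal_density 2 * (u / sqrt \<kappa>) * std_normal_density 2 \<le>
        prob {\<omega>\<in>space M. comb a \<omega> * comb b \<omega> < 0}"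
      by (smt (verit) mult_mono measure_nonneg normal_density_nonneg)
    \<comment> \<open>For v = u / sqrt \<kappa> \<le> 2 the bound v is weakened to v^2 / 2, because
      a sum of squared increments can be integrated over the sphere.\<close>
    moreover have "(std_normal_density 2)\<^sup>2 * (u\<^sup>2 / (2 * \<kappa>)) \<le> (std_normal_density 2)\<^sup>2 * (u / sqrt \<kappa>)"
    proof (rule mult_left_mono)
      define v where "v = u / sqrt \<kappa>"
      have v: "0 \<le> v" "v \<le> 2" using u \<kappa> by (simp_all add: v_def divide_simps)
      have "v * v \<le> v * 2" using v by (intro mult_left_mono) auto
      moreover have "u\<^sup>2 / (2 * \<kappa>) = v * v / 2"
        using \<kappa> by (simp add: v_def power2_eq_square)
      ultimately show "u\<^sup>2 / (2 * \<kappa>) \<le> u / sqrt \<kappa>"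
        unfolding v_def[symmetric] by simp
    qed simp
    ultimately show ?thesis
      by (simp add: u_def power2_eq_square mult_ac)
  qed
qed

end

section \<open>Coordinate rotations preserve Lebesgue measure\<close>

text \<open>By Fubini the coordinate along \<open>a\<close> is integrated innermost. There the shear
  is a translation, since the \<open>b\<close> coordinate is constant during that
  integration.\<close>

lemma nn_integral_lborel_shear:
  fixes a b :: "'a::euclidean_space"
  assumes ab: "a \<in> Basis" "b \<in> Basis" "a \<noteq> b" and F [measurable]: "F \<in> borel_measurable borel"
  shows "(\<integral>\<^sup>+x. F (x + (c * (x \<bullet> b)) *\<^sub>R a) \<partial>lborel) = (\<integral>\<^sup>+x. F x \<partial>lborel)"
proof -
  interpret product_sigma_finite "\<lambda>_::'a. lborel :: real measure" ..
  let ?B = "Basis - {a}" and ?f = "\<lambda>h::'a \<Rightarrow> real. \<Sum>i\<in>Basis. h i *\<^sub>R i"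
  have B: "Basis = insert a ?B" using ab by auto
  have meas: "?f \<in> measurable (Pi\<^sub>M Basis (\<lambda>_. lborel)) borel"
    by measurable
  have f: "?f (x(a := y)) = (\<Sum>i\<in>?B. x i *\<^sub>R i) + y *\<^sub>R a" for x y
  proof -
    have "?f (x(a := y)) = (x(a := y)) a *\<^sub>R a + (\<Sum>i\<in>?B. (x(a := y)) i *\<^sub>R i)"
      using ab by (intro sum.remove) auto
    also have "(\<Sum>i\<in>?B. (x(a := y)) i *\<^sub>R i) = (\<Sum>i\<in>?B. x i *\<^sub>R i)"
      by (rule sum.cong) auto
    finally show ?thesis by (simp add: add.commute)
  qed
  have fb: "?f h \<bullet> b = h b" for h
    using ab by (simp add: inner_sum_left inner_Basis if_distrib cong: if_cong)
  have iter: "(\<integral>\<^sup>+x. G x \<partial>lborel) = (\<integral>\<^sup>+x. \<integral>\<^sup>+y. G ((\<Sum>i\<in>?B. x i *\<^sub>R i) + y *\<^sub>R a) \<partial>lborel \<partial>Pi\<^sub>M ?B (\<lambda>_. lborel))"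
    if [measurable]: "G \<in> borel_measurable borel" for G :: "'a \<Rightarrow> ennreal"
  proof -
    have "(\<integral>\<^sup>+x. G x \<partial>lborel) = (\<integral>\<^sup>+h. G (?f h) \<partial>Pi\<^sub>M Basis (\<lambda>_. lborel))"
      by (subst lborel_eq) (rule nn_integral_distr[OF meas], simp)
    also have "\<dots> = (\<integral>\<^sup>+x. \<integral>\<^sup>+y. G (?f (x(a := y))) \<partial>lborel \<partial>Pi\<^sub>M ?B (\<lambda>_. lborel))"
      using product_nn_integral_insert[of ?B a "\<lambda>h. G (?f h)"] measurable_compose[OF meas that] B
      by simp
    finally show ?thesis by (simp only: f)
  qed
  have "(\<integral>\<^sup>+x. F (x + (c * (x \<bullet> b)) *\<^sub>R a) \<partial>lborel) =
      (\<integral>\<^sup>+x. \<integral>\<^sup>+y. F ((\<Sum>i\<in>?B. x i *\<^sub>R i) + (c * x b + y) *\<^sub>R a) \<partial>lborel \<partial>Pi\<^sub>M ?B (\<lambda>_. lborel))"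
  proof (subst iter)
    have "((\<Sum>i\<in>?B. x i *\<^sub>R i) + y *\<^sub>R a) \<bullet> b = x b" for x y
      using fb[of "x(a := y)"] ab unfolding f by simp
    then have "(\<Sum>i\<in>?B. x i *\<^sub>R i) + y *\<^sub>R a + (c * (((\<Sum>i\<in>?B. x i *\<^sub>R i) + y *\<^sub>R a) \<bullet> b)) *\<^sub>R a =
        (\<Sum>i\<in>?B. x i *\<^sub>R i) + (c * x b + y) *\<^sub>R a" for x y
      by (simp add: algebra_simps)
    then show "(\<integral>\<^sup>+x. \<integral>\<^sup>+y. F ((\<Sum>i\<in>?B. x i *\<^sub>R i) + y *\<^sub>R a +
        (c * (((\<Sum>i\<in>?B. x i *\<^sub>R i) + y *\<^sub>R a) \<bullet> b)) *\<^sub>R a) \<partial>lborel \<partial>Pi\<^sub>M ?B (\<lambda>_. lborel)) =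
      (\<integral>\<^sup>+x. \<integral>\<^sup>+y. F ((\<Sum>i\<in>?B. x i *\<^sub>R i) + (c * x b + y) *\<^sub>R a) \<partial>lborel \<partial>Pi\<^sub>M ?B (\<lambda>_. lborel))"
      by (simp only:)
  qed measurable
  also have "\<dots> = (\<integral>\<^sup>+x. \<integral>\<^sup>+y. F ((\<Sum>i\<in>?B. x i *\<^sub>R i) + y *\<^sub>R a) \<partial>lborel \<partial>Pi\<^sub>M ?B (\<lambda>_. lborel))"
  proof (rule nn_integral_cong)
    fix x
    have "(\<integral>\<^sup>+y. F ((\<Sum>i\<in>?B. x i *\<^sub>R i) + y *\<^sub>R a) \<partial>lborel) =
        (\<integral>\<^sup>+y. F ((\<Sum>i\<in>?B. x i *\<^sub>R i) + y *\<^sub>R a) \<partial>distr lborel borel ((+) (c * x b)))"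
      by (simp add: lborel_distr_plus)
    also have "\<dots> = (\<integral>\<^sup>+y. F ((\<Sum>i\<in>?B. x i *\<^sub>R i) + (c * x b + y) *\<^sub>R a) \<partial>lborel)"
      by (rule nn_integral_distr) measurable
    finally show "(\<integral>\<^sup>+y. F ((\<Sum>i\<in>?B. x i *\<^sub>R i) + (c * x b + y) *\<^sub>R a) \<partial>lborel) =
      (\<integral>\<^sup>+y. F ((\<Sum>i\<in>?B. x i *\<^sub>R i) + y *\<^sub>R a) \<partial>lborel)" ..
  qed
  also have "\<dots> = (\<integral>\<^sup>+x. F x \<partial>lborel)"
    by (rule iter[symmetric]) measurable
  finally show ?thesis .
qed

section \<open>Coordinate rotations as products of shears\<close>

definition rot :: "'m \<Rightarrow> 'm \<Rightarrow> real \<Rightarrow> real ^ 'm \<Rightarrow> real ^ 'm"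
  where "rot j k t x = (\<chi> i. if i = j then cos t * x $ j - sin t * x $ k
    else if i = k then sin t * x $ j + cos t * x $ k else x $ i)"

lemma rot_nth:
  "rot j k t x $ i = (if i = j then cos t * x $ j - sin t * x $ k
    else if i = k then sin t * x $ j + cos t * x $ k else x $ i)"
  by (simp add: rot_def)

lemma rot_add: "j \<noteq> k \<Longrightarrow> rot j k s (rot j k t x) = rot j k (s + t) x"
  by (auto simp: vec_eq_iff rot_nth cos_add sin_add algebra_simps)

lemma rot_0 [simp]: "j \<noteq> k \<Longrightarrow> rot j k 0 x = x"
  by (auto simp: vec_eq_iff rot_nth)

lemma rot_linear: "linear (rot j k t)"
  by (rule linearI) (auto simp: vec_eq_iff rot_nth algebra_simps)

lemma rot_measurable [measurable]: "rot j k t \<in> borel_measurable borel" for j k :: "'m::finite"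
  by (intro borel_measurable_continuous_onI linear_continuous_on linear_conv_bounded_linear[THEN iffD1] rot_linear)

lemma sum_split2:
  fixes j k :: "'m::finite"
  assumes "j \<noteq> k"
  shows "(\<Sum>i\<in>UNIV. f i) = f j + (f k + (\<Sum>i\<in>UNIV - {j, k}. f i))"
proof -
  have "(\<Sum>i\<in>UNIV. f i) = f j + (\<Sum>i\<in>UNIV - {j}. f i)"
    by (rule sum.remove) auto
  also have "(\<Sum>i\<in>UNIV - {j}. f i) = f k + (\<Sum>i\<in>UNIV - {j} - {k}. f i)"
    using assms by (intro sum.remove) auto
  also have "UNIV - {j} - {k} = UNIV - {j, k}" by auto
  finally show ?thesis .
qed

lemma norm_rot [simp]:
  fixes x :: "real ^ 'm::finite"
  assumes jk: "j \<noteq> k"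
  shows "norm (rot j k t x) = norm x"
proof -
  have "(\<Sum>i\<in>UNIV. (rot j k t x $ i)\<^sup>2) = (\<Sum>i\<in>UNIV. (x $ i)\<^sup>2)"
  proof -
    have "(\<Sum>i\<in>UNIV - {j, k}. (rot j k t x $ i)\<^sup>2) = (\<Sum>i\<in>UNIV - {j, k}. (x $ i)\<^sup>2)"
      by (rule sum.cong) (auto simp: rot_nth)
    moreover have "(cos t * x $ j - sin t * x $ k)\<^sup>2 + (sin t * x $ j + cos t * x $ k)\<^sup>2 =
        (x $ j)\<^sup>2 + (x $ k)\<^sup>2"
    proof -
      have "(c * a - s * b)\<^sup>2 + (s * a + c * b)\<^sup>2 = (c\<^sup>2 + s\<^sup>2) * (a\<^sup>2 + b\<^sup>2)" for a b c s :: real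
        by (simp add: power2_eq_square algebra_simps)
      from this[of "cos t" "x $ j" "sin t" "x $ k"] show ?thesis by simp
    qed
    ultimately show ?thesis
      using jk by (simp add: sum_split2[OF jk] rot_nth add.assoc[symmetric])
  qed
  then show ?thesis
    by (simp add: norm_vec_def L2_set_def)
qed

text \<open>A plane rotation by t is a product of three shears, with factors - tan (t / 2), sin t, -
  tan (t / 2), provided that cos (t / 2) is not 0.\<close>

lemma nn_integral_lborel_rot:
  fixes F :: "real ^ 'm::finite \<Rightarrow> ennreal"
  assumes jk: "j \<noteq> k" and F [measurable]: "F \<in> borel_measurable borel"
  shows "(\<integral>\<^sup>+x. F (rot j k t x) \<partial>lborel) = (\<integral>\<^sup>+x. F x \<partial>lborel)"
proof -
  have small: "(\<integral>\<^sup>+x. F (rot j k t x) \<partial>lborel) = (\<integral>\<^sup>+x. F x \<partial>lborel)"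
    if t: "cos (t / 2) \<noteq> 0" and F [measurable]: "F \<in> borel_measurable borel"
    for t and F :: "real ^ 'm::finite \<Rightarrow> ennreal"
  proof -
    define S1 where "S1 = (\<lambda>x::real^'m. x + ((- tan (t / 2)) * (x \<bullet> axis k 1)) *\<^sub>R axis j 1)"
    define S2 where "S2 = (\<lambda>x::real^'m. x + (sin t * (x \<bullet> axis j 1)) *\<^sub>R axis k 1)"
    have ax: "axis j (1::real) \<in> Basis" "axis k (1::real) \<in> Basis" "axis j (1::real) \<noteq> axis k 1"
      using jk by (auto simp: Basis_vec_def axis_eq_axis)
    have [measurable]: "S1 \<in> borel_measurable borel" "S2 \<in> borel_measurable borel"
      unfolding S1_def S2_def by measurable
    have sc: "sin t = 2 * sin (t/2) * cos (t/2)" "cos t = (cos (t/2))\<^sup>2 - (sin (t/2))\<^sup>2"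
      using sin_double[of "t/2"] cos_double[of "t/2"] by simp_all
    have one: "(cos (t/2))\<^sup>2 = 1 - (sin (t/2))\<^sup>2"
      using cos_squared_eq by blast
    have c1: "1 - tan (t/2) * sin t = cos t"
      using t one by (simp add: sc tan_def power2_eq_square)
    have c2: "tan (t/2) + tan (t/2) * cos t = sin t"
    proof -
      have "tan (t/2) + tan (t/2) * cos t = tan (t/2) * (1 + cos t)"
        by (simp add: algebra_simps)
      also have "1 + cos t = 2 * (cos (t/2))\<^sup>2"
        using one by (simp add: sc)
      finally show ?thesis using t by (simp add: sc tan_def power2_eq_square)
    qed
    have rot_eq: "S1 (S2 (S1 x)) = rot j k t x" for x
    proof -
      define \<tau> where "\<tau> = tan (t/2)"
      have e1: "1 = cos t + \<tau> * sin t" and e2: "sin t = \<tau> + \<tau> * cos t"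
        using c1 c2 by (simp_all add: \<tau>_def algebra_simps)
      have k: "x $ k + sin t * (x $ j - \<tau> * x $ k) = sin t * x $ j + cos t * x $ k"
      proof -
        have "x $ k + sin t * (x $ j - \<tau> * x $ k) = sin t * x $ j + (1 - \<tau> * sin t) * x $ k"
          by (simp add: algebra_simps)
        then show ?thesis using e1 by simp
      qed
      have j: "x $ j - \<tau> * x $ k - \<tau> * (sin t * x $ j + cos t * x $ k) = cos t * x $ j - sin t * x $ k"
      proof -
        have "x $ j - \<tau> * x $ k - \<tau> * (sin t * x $ j + cos t * x $ k) =
            (1 - \<tau> * sin t) * x $ j - (\<tau> + \<tau> * cos t) * x $ k"
          by (simp add: algebra_simps)
        then show ?thesis using e1 e2 by simp
      qed
      show ?thesis
        unfolding vec_eq_iff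
      proof
        fix i
        have "S1 x $ i = (if i = j then x $ j - \<tau> * x $ k else x $ i)" for x i
          by (simp add: S1_def \<tau>_def inner_axis) (simp add: axis_def)
        moreover have "S2 x $ i = (if i = k then x $ k + sin t * x $ j else x $ i)" for x i
          by (simp add: S2_def inner_axis) (simp add: axis_def)
        ultimately show "S1 (S2 (S1 x)) $ i = rot j k t x $ i"
          using jk j k by (auto simp: rot_nth)
      qed
    qed
    have "(\<integral>\<^sup>+x. F (rot j k t x) \<partial>lborel) = (\<integral>\<^sup>+x. F (S1 (S2 (S1 x))) \<partial>lborel)"
      by (simp only: rot_eq)
    also have "\<dots> = (\<integral>\<^sup>+x. F (S1 (S2 x)) \<partial>lborel)"
      unfolding S1_def[of] using nn_integral_lborel_shear[OF ax, of "\<lambda>x. F (S1 (S2 x))" "- tan (t/2)"]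
      by (simp add: S1_def)
    also have "\<dots> = (\<integral>\<^sup>+x. F (S1 x) \<partial>lborel)"
      using nn_integral_lborel_shear[OF ax(2,1) ax(3)[symmetric], of "\<lambda>x. F (S1 x)" "sin t"]
      by (simp add: S2_def)
    also have "\<dots> = (\<integral>\<^sup>+x. F x \<partial>lborel)"
      using nn_integral_lborel_shear[OF ax, of F "- tan (t/2)"] by (simp add: S1_def)
    finally show ?thesis .
  qed
  show ?thesis
  proof (cases "cos (t / 2) = 0")
    case False
    then show ?thesis by (rule small) measurable
  next
    \<comment> \<open>The tangent has no useful value here, but cos (t / 4) is nonzero, so the
      rotation by t / 2 can be decomposed and applied twice.\<close>
    case True
    then have nz: "cos (t / 2 / 2) \<noteq> 0"
      using cos_double_cos[of "t / 2 / 2"] sin_squared_eq[of "t/2/2"] by (auto simp: cos_double)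
    have "(\<integral>\<^sup>+x. F (rot j k t x) \<partial>lborel) = (\<integral>\<^sup>+x. F (rot j k (t/2) (rot j k (t/2) x)) \<partial>lborel)"
      using rot_add[OF jk, of "t/2" "t/2"] by simp
    also have "\<dots> = (\<integral>\<^sup>+x. F (rot j k (t/2) x) \<partial>lborel)"
      by (rule small[OF nz]) measurable
    also have "\<dots> = (\<integral>\<^sup>+x. F x \<partial>lborel)"
      by (rule small[OF nz]) measurable
    finally show ?thesis .
  qed
qed

section \<open>Integration over the sphere\<close>

lemma sgn_measurable [measurable]: "(sgn :: 'a::euclidean_space \<Rightarrow> 'a) \<in> borel_measurable borel"
  unfolding sgn_div_norm[abs_def] by measurable

lemma sets_sphere_measure [simp, measurable_cong]: "sets sphere_measure = sets borel"
  by (simp add: sphere_measure_def)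

lemma space_sphere_measure [simp]: "space sphere_measure = UNIV"
  by (simp add: sphere_measure_def space_scale_measure)

lemma nn_integral_sphere_measure:
  fixes g :: "real ^ 'm::finite \<Rightarrow> ennreal"
  assumes [measurable]: "g \<in> borel_measurable borel"
  shows "(\<integral>\<^sup>+x. g x \<partial>sphere_measure) =
    of_nat CARD('m) * (\<integral>\<^sup>+x. g (sgn x) * indicator (ball 0 1) x \<partial>lborel)"
proof -
  have "(\<integral>\<^sup>+x. g x \<partial>sphere_measure) =
      of_nat CARD('m) * (\<integral>\<^sup>+x. g x \<partial>distr (restrict_space lborel (ball 0 1)) borel sgn)"
    unfolding sphere_measure_def by (rule nn_integral_scale_measure) simp
  also have "(\<integral>\<^sup>+x. g x \<partial>distr (restrict_space lborel (ball 0 1)) borel sgn) =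
      (\<integral>\<^sup>+x. g (sgn x) \<partial>restrict_space lborel (ball 0 1))"
    by (rule nn_integral_distr) (auto intro: measurable_restrict_space1)
  also have "\<dots> = (\<integral>\<^sup>+x. g (sgn x) * indicator (ball 0 1) x \<partial>lborel)"
    by (rule nn_integral_restrict_space) auto
  finally show ?thesis .
qed

lemma emeasure_sphere_measure:
  fixes A :: "(real ^ 'm::finite) set"
  assumes [measurable]: "A \<in> sets borel"
  shows "emeasure sphere_measure A = of_nat CARD('m) * emeasure lborel {x \<in> ball 0 1. sgn x \<in> A}"
proof -
  have m: "{x \<in> ball 0 1. sgn x \<in> A} \<in> sets borel"
  proof -
    have "ball 0 1 \<inter> (sgn -` A \<inter> space borel) \<in> sets borel"
      by (intro sets.Int measurable_sets[OF sgn_measurable] assms) auto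
    then show ?thesis by (simp add: vimage_def Int_def)
  qed
  have "emeasure sphere_measure A = (\<integral>\<^sup>+x. indicator A x \<partial>sphere_measure)"
    by simp
  also have "\<dots> = of_nat CARD('m) * (\<integral>\<^sup>+x. indicator A (sgn x) * indicator (ball 0 1) x \<partial>lborel)"
    by (rule nn_integral_sphere_measure) simp
  also have "(\<integral>\<^sup>+x. indicator A (sgn x) * indicator (ball 0 1) x \<partial>lborel) =
      (\<integral>\<^sup>+x. indicator {x \<in> ball 0 1. sgn x \<in> A} x \<partial>lborel)"
    by (rule nn_integral_cong) (auto split: split_indicator)
  also have "\<dots> = emeasure lborel {x \<in> ball 0 1. sgn x \<in> A}"
    using m by (intro nn_integral_indicator) simp
  finally show ?thesis .
qed

lemma finite_measure_sphere_measure: "finite_measure (sphere_measure :: (real ^ 'm::finite) measure)"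
proof
  have "emeasure (sphere_measure :: (real ^ 'm) measure) UNIV =
      of_nat CARD('m) * emeasure lborel (ball 0 1 :: (real ^ 'm) set)"
    by (subst emeasure_sphere_measure) (auto simp: ball_def)
  also have "\<dots> < \<infinity>"
    using emeasure_lborel_ball_finite[of "0 :: real ^ 'm" 1] by (auto simp: ennreal_mult_less_top of_nat_less_top)
  finally show "emeasure (sphere_measure :: (real ^ 'm) measure) (space sphere_measure) \<noteq> \<infinity>"
    by simp
qed

interpretation sphere_measure: finite_measure "sphere_measure :: (real ^ 'm::finite) measure"
  by (rule finite_measure_sphere_measure)

lemma AE_sphere_measure: "AE x in (sphere_measure :: (real ^ 'm::finite) measure). x \<in> sphere 0 1"
proof -
  have [measurable]: "- sphere 0 1 \<in> sets (borel :: (real^'m) measure)"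
    by (intro borel_open open_Compl closed_sphere)
  have "{x \<in> ball 0 1. sgn x \<in> - sphere 0 1} \<subseteq> {0 :: real ^ 'm}"
    by (auto simp: norm_sgn)
  then have "emeasure lborel {x \<in> ball 0 1. sgn x \<in> - sphere (0 :: real ^ 'm) 1} \<le> emeasure lborel {0 :: real ^ 'm}"
    by (intro emeasure_mono) auto
  then have "emeasure (sphere_measure :: (real ^ 'm) measure) (- sphere 0 1) = 0"
    by (subst emeasure_sphere_measure) auto
  then show ?thesis
    by (intro AE_I[where N = "- sphere 0 1"]) auto
qed

lemma measure_sphere_measure_pos: "0 < measure (sphere_measure :: (real ^ 'm::finite) measure) UNIV"
proof -
  have "emeasure (sphere_measure :: (real ^ 'm) measure) UNIV =
      of_nat CARD('m) * emeasure lborel (ball 0 1 :: (real ^ 'm) set)"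
    by (subst emeasure_sphere_measure) (auto simp: ball_def)
  moreover have "emeasure lborel (ball 0 1 :: (real ^ 'm) set) \<noteq> 0"
    using unit_ball_vol_pos[of "real DIM(real ^ 'm)"] by (simp add: emeasure_ball ennreal_eq_0_iff not_le)
  ultimately have "emeasure (sphere_measure :: (real ^ 'm) measure) UNIV \<noteq> 0"
    by simp
  then show ?thesis
    by (simp add: sphere_measure.emeasure_eq_measure zero_less_measure_iff)
qed

lemma integrable_sphere_measure:
  fixes g :: "real ^ 'm::finite \<Rightarrow> real"
  assumes "continuous_on UNIV g"
  shows "integrable sphere_measure g"
proof -
  have "compact (g ` sphere 0 1)"
    by (intro compact_continuous_image continuous_on_subset[OF assms]) auto
  then obtain B where B: "\<And>x. x \<in> sphere 0 1 \<Longrightarrow> \<bar>g x\<bar> \<le> B"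
    by (meson bounded_real compact_imp_bounded imageI)
  have "g \<in> borel_measurable borel"
    by (rule borel_measurable_continuous_onI[OF assms])
  then have "g \<in> borel_measurable sphere_measure"
    by simp
  moreover have "AE x in sphere_measure. norm (g x) \<le> B"
    using AE_sphere_measure by eventually_elim (use B in auto)
  ultimately show ?thesis
    by (intro sphere_measure.integrable_const_bound)
qed

text \<open>Rotations commute with the radial projection \<open>sgn\<close> and preserve the unit
  ball, so the surface measure inherits their invariance from Lebesgue measure.\<close>

lemma sphere_measure_rot_distr:
  fixes j k :: "'m::finite"
  assumes jk: "j \<noteq> k"
  shows "distr sphere_measure borel (rot j k t) = sphere_measure"
proof (rule measure_eqI)
  fix A assume "A \<in> sets (distr sphere_measure borel (rot j k t))"
  then have A [measurable]: "A \<in> sets borel" by simp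
  have sgn_rot: "sgn (rot j k t x) = rot j k t (sgn x)" for x
    using jk linear_cmul[OF rot_linear[of j k t]] by (simp add: sgn_div_norm)
  have [measurable]: "ball 0 1 \<in> sets (borel :: (real ^ 'm) measure)"
    by (intro borel_open) auto
  have m: "(\<lambda>x. indicator A (sgn x) * indicator (ball 0 1) x :: ennreal) \<in> borel_measurable borel"
    by measurable
  have m': "rot j k t -` A \<in> sets borel"
    using measurable_sets[OF rot_measurable[of j k t] A] by simp
  have "emeasure (distr sphere_measure borel (rot j k t)) A = emeasure sphere_measure (rot j k t -` A)"
    by (subst emeasure_distr) auto
  also have "\<dots> = (\<integral>\<^sup>+x. indicator (rot j k t -` A) x \<partial>sphere_measure)"
    using m' by simp
  also have "\<dots> = of_nat CARD('m) * (\<integral>\<^sup>+x. indicator (rot j k t -` A) (sgn x) * indicator (ball 0 1) x \<partial>lborel)"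
    using m' by (intro nn_integral_sphere_measure) simp
  also have "(\<integral>\<^sup>+x. indicator (rot j k t -` A) (sgn x) * indicator (ball 0 1) x \<partial>lborel) =
      (\<integral>\<^sup>+x. indicator A (sgn (rot j k t x)) * indicator (ball 0 1) (rot j k t x) \<partial>lborel)"
    by (rule nn_integral_cong) (use jk in \<open>simp add: sgn_rot indicator_def\<close>)
  also have "\<dots> = (\<integral>\<^sup>+x. indicator A (sgn x) * indicator (ball 0 1) x \<partial>lborel)"
    by (rule nn_integral_lborel_rot[OF jk m])
  also have "of_nat CARD('m) * \<dots> = emeasure sphere_measure A"
    by (subst nn_integral_sphere_measure[symmetric]) auto
  finally show "emeasure (distr sphere_measure borel (rot j k t)) A = emeasure sphere_measure A" .
qed simp

lemma integral_sphere_rot: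
  fixes g :: "real ^ 'm::finite \<Rightarrow> real"
  assumes "j \<noteq> k" "g \<in> borel_measurable borel"
  shows "(LINT x|sphere_measure. g (rot j k t x)) = (LINT x|sphere_measure. g x)"
  using integral_distr[of "rot j k t" sphere_measure borel g] assms
  by (simp add: sphere_measure_rot_distr)

text \<open>A chord is no longer than its arc: 2 - 2 cos u \<le> u^2. The general case reduces to t
  = 0, as \<open>rot j k t\<close> is an isometry.\<close>

lemma dist_rot_le:
  fixes x :: "real ^ 'm::finite"
  assumes jk: "j \<noteq> k"
  shows "dist (rot j k s x) (rot j k t x) \<le> \<bar>s - t\<bar> * norm x"
proof -
  have cos: "2 - 2 * cos u \<le> u\<^sup>2" for u :: real
  proof -
    have "\<bar>sin (u/2)\<bar> \<le> \<bar>u/2\<bar>" by (rule abs_sin_x_le_abs_x)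
    then have "(sin (u/2))\<^sup>2 \<le> (u/2)\<^sup>2" by (simp only: abs_le_square_iff)
    moreover have "cos u = 1 - 2 * (sin (u/2))\<^sup>2"
      using cos_double_sin[of "u/2"] by simp
    ultimately show ?thesis by (simp add: power2_eq_square)
  qed
  have two: "(\<Sum>i\<in>UNIV. (rot j k u x $ i - x $ i)\<^sup>2) \<le> u\<^sup>2 * (\<Sum>i\<in>UNIV. (x $ i)\<^sup>2)" for u
  proof -
    have "(\<Sum>i\<in>UNIV. (rot j k u x $ i - x $ i)\<^sup>2) =
        (cos u * x $ j - sin u * x $ k - x $ j)\<^sup>2 + (sin u * x $ j + cos u * x $ k - x $ k)\<^sup>2"
      using jk by (simp add: sum_split2[OF jk] rot_nth)
    also have "\<dots> = ((cos u)\<^sup>2 + (sin u)\<^sup>2 + 1 - 2 * cos u) * ((x $ j)\<^sup>2 + (x $ k)\<^sup>2)"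
    proof -
      have "(c * a - s * b - a)\<^sup>2 + (s * a + c * b - b)\<^sup>2 = (c\<^sup>2 + s\<^sup>2 + 1 - 2 * c) * (a\<^sup>2 + b\<^sup>2)"
        for a b c s :: real
        by (simp add: power2_eq_square algebra_simps)
      then show ?thesis .
    qed
    also have "\<dots> = (2 - 2 * cos u) * ((x $ j)\<^sup>2 + (x $ k)\<^sup>2)"
      by simp
    also have "\<dots> \<le> u\<^sup>2 * ((x $ j)\<^sup>2 + (x $ k)\<^sup>2)"
      by (intro mult_right_mono cos) auto
    also have "\<dots> \<le> u\<^sup>2 * (\<Sum>i\<in>UNIV. (x $ i)\<^sup>2)"
      by (intro mult_left_mono) (auto simp: sum_split2[OF jk] sum_nonneg)
    finally show ?thesis .
  qed
  have "norm (rot j k u x - x) \<le> \<bar>u\<bar> * norm x" for u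
  proof -
    have "(norm (rot j k u x - x))\<^sup>2 \<le> (\<bar>u\<bar> * norm x)\<^sup>2"
      using two[of u] by (simp add: norm_vec_def L2_set_def sum_nonneg power_mult_distrib)
    then show ?thesis
      by (rule power2_le_imp_le) simp
  qed
  from this[of "s - t"] have "norm (rot j k (s - t) x - x) \<le> \<bar>s - t\<bar> * norm x" .
  moreover have "rot j k s x - rot j k t x = rot j k t (rot j k (s - t) x - x)"
    using rot_add[OF jk, of t "s - t" x] linear_diff[OF rot_linear[of j k t]] by simp
  ultimately show ?thesis
    using jk by (simp add: dist_norm)
qed

lemma continuous_on_real_polynomial_function:
  "real_polynomial_function p \<Longrightarrow> continuous_on S p" for p :: "real ^ 'm::finite \<Rightarrow> real"
  using continuous_real_polymonial_function continuous_at_imp_continuous_on by blast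

lemma real_polynomial_function_measurable:
  "real_polynomial_function p \<Longrightarrow> p \<in> borel_measurable borel" for p :: "real ^ 'm::finite \<Rightarrow> real"
  by (rule borel_measurable_continuous_onI) (rule continuous_on_real_polynomial_function)

lemma integrable_sphere_polynomial [intro, simp]:
  "real_polynomial_function p \<Longrightarrow> integrable sphere_measure p" for p :: "real ^ 'm::finite \<Rightarrow> real"
  by (rule integrable_sphere_measure) (rule continuous_on_real_polynomial_function)

lemma bounded_on_sphere_polynomial:
  fixes p :: "real ^ 'm::finite \<Rightarrow> real"
  assumes "real_polynomial_function p"
  obtains B where "0 \<le> B" "\<And>x. norm x = 1 \<Longrightarrow> \<bar>p x\<bar> \<le> B"
proof -
  have "compact (p ` sphere 0 1)"
    by (intro compact_continuous_image continuous_on_real_polynomial_function assms) auto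
  then obtain B where "\<And>x. x \<in> sphere 0 1 \<Longrightarrow> \<bar>p x\<bar> \<le> B"
    by (meson bounded_real compact_imp_bounded imageI)
  then show ?thesis
    by (intro that[of "max B 0"]) (auto intro: max.coboundedI1)
qed

section \<open>Differentiation along rotations and integration by parts on the sphere\<close>

lemma has_real_derivative_rot:
  fixes p :: "real ^ 'm::finite \<Rightarrow> real"
  assumes p: "real_polynomial_function p" and jk: "j \<noteq> k"
  shows "((\<lambda>t. p (rot j k t x)) has_real_derivative rot_deriv j k p (rot j k t x)) (at t)"
proof -
  define v where "v = (\<chi> i. if i = j then - (rot j k t x $ k) else if i = k then rot j k t x $ j else 0)"
  have "((\<lambda>t. rot j k t x) has_vector_derivative v) (at t)"
    unfolding has_vector_derivative_def has_derivative_componentwise_within[where 'b = "real^'m"]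
  proof
    fix b :: "real ^ 'm" assume "b \<in> Basis"
    then obtain i where b: "b = axis i 1" by (auto simp: Basis_vec_def)
    show "((\<lambda>t. rot j k t x \<bullet> b) has_derivative (\<lambda>s. s *\<^sub>R v \<bullet> b)) (at t)"
      using jk unfolding b
      by (auto simp: inner_axis rot_nth v_def intro!: derivative_eq_intros) (auto simp: algebra_simps)
  qed
  from real_polynomial_function_along_curve[OF p this] show ?thesis
    using jk by (simp add: sum_split2[OF jk] v_def rot_deriv_def)
qed

lemma real_polynomial_function_rot_deriv_iter [intro, simp]:
  "real_polynomial_function p \<Longrightarrow> real_polynomial_function ((rot_deriv j k ^^ n) p)"
  for p :: "real ^ 'm::finite \<Rightarrow> real"
  by (induction n) auto

text \<open>The remainder is evaluated on the same rotation orbit, hence again on the unit sphere if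
  x is there; this makes it uniformly bounded.\<close>

lemma rot_taylor:
  fixes p :: "real ^ 'm::finite \<Rightarrow> real"
  assumes p: "real_polynomial_function p" and jk: "j \<noteq> k"
  shows "\<exists>s. p (rot j k h x) = p x + h * rot_deriv j k p x
    + h\<^sup>2 / 2 * rot_deriv j k (rot_deriv j k p) (rot j k s x)"
proof -
  let ?diff = "\<lambda>m t. (rot_deriv j k ^^ m) p (rot j k t x)"
  have "\<forall>m t. DERIV (?diff m) t :> ?diff (Suc m) t"
    using has_real_derivative_rot[OF real_polynomial_function_rot_deriv_iter[OF p] jk] by simp
  from Maclaurin_all_le[where n = 2 and x = h and diff = ?diff, OF refl this] jk
  show ?thesis
    by (auto simp: numeral_2_eq_2 fact_numeral algebra_simps)
qed

text \<open>Differentiation under the integral: the second-order remainder is bounded uniformly on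
  the sphere, so the difference quotient errs by at most a multiple of |h|.\<close>

lemma has_real_derivative_integral_rot:
  fixes p g :: "real ^ 'm::finite \<Rightarrow> real"
  assumes p: "real_polynomial_function p" and g: "real_polynomial_function g" and jk: "j \<noteq> k"
  shows "((\<lambda>t. LINT x|sphere_measure. p (rot j k t x) * g x) has_real_derivative
    (LINT x|sphere_measure. rot_deriv j k p (rot j k t x) * g x)) (at t)"
proof -
  let ?L = "rot_deriv j k"
  define \<phi> where "\<phi> = (\<lambda>p t. LINT x|sphere_measure. p (rot j k t x) * g x)"
  have int: "integrable sphere_measure (\<lambda>x. p (rot j k t x) * g x)"
    if "real_polynomial_function p" for p t
    by (intro integrable_sphere_measure continuous_intros continuous_on_real_polynomial_function g
        continuous_on_compose2[OF continuous_on_real_polynomial_function[OF that]]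
        linear_continuous_on linear_conv_bounded_linear[THEN iffD1] rot_linear) auto
  obtain B1 where B1: "0 \<le> B1" "\<And>x. norm x = 1 \<Longrightarrow> \<bar>?L (?L p) x\<bar> \<le> B1"
    using bounded_on_sphere_polynomial[of "?L (?L p)"] p by auto
  obtain B2 where B2: "0 \<le> B2" "\<And>x. norm x = 1 \<Longrightarrow> \<bar>g x\<bar> \<le> B2"
    using bounded_on_sphere_polynomial[OF g] by auto
  define V where "V = measure (sphere_measure :: (real^'m) measure) UNIV"
  have bound: "\<bar>\<phi> p (t + h) - \<phi> p t - h * \<phi> (?L p) t\<bar> \<le> h\<^sup>2 / 2 * B1 * B2 * V" for h
  proof -
    let ?r = "\<lambda>x. (p (rot j k (t + h) x) - p (rot j k t x) - h * ?L p (rot j k t x)) * g x"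
    have "\<phi> p (t + h) - \<phi> p t - h * \<phi> (?L p) t = (LINT x|sphere_measure. ?r x)"
      unfolding \<phi>_def using int[OF p, of "t + h"] int[OF p, of t] int[of "?L p" t] p
      by (simp add: left_diff_distrib mult.assoc)
    also have "\<bar>\<dots>\<bar> \<le> (LINT x|sphere_measure. \<bar>?r x\<bar>)"
      by (rule integral_abs_bound)
    also have "\<dots> \<le> (LINT x|(sphere_measure :: (real^'m) measure). h\<^sup>2 / 2 * B1 * B2)"
    proof (rule integral_mono_AE)
      show "integrable sphere_measure (\<lambda>x. \<bar>?r x\<bar>)"
        using int[OF p, of "t + h"] int[OF p, of t] int[of "?L p" t] p
        by (auto simp: left_diff_distrib mult.assoc)
      show "AE x in sphere_measure. \<bar>?r x\<bar> \<le> h\<^sup>2 / 2 * B1 * B2"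
        using AE_sphere_measure
      proof eventually_elim
        case (elim x)
        then have x: "norm x = 1" by simp
        obtain s where s: "p (rot j k h (rot j k t x)) = p (rot j k t x) + h * ?L p (rot j k t x)
            + h\<^sup>2 / 2 * ?L (?L p) (rot j k s (rot j k t x))"
          using rot_taylor[OF p jk] by blast
        have "p (rot j k (t + h) x) - p (rot j k t x) - h * ?L p (rot j k t x) =
            h\<^sup>2 / 2 * ?L (?L p) (rot j k s (rot j k t x))"
          using s rot_add[OF jk, of h t x] by (simp add: add.commute)
        moreover have "\<bar>h\<^sup>2 / 2 * ?L (?L p) (rot j k s (rot j k t x))\<bar> \<le> h\<^sup>2 / 2 * B1"
          unfolding abs_mult using x jk by (intro mult_mono B1) auto
        ultimately have "\<bar>p (rot j k (t + h) x) - p (rot j k t x) - h * ?L p (rot j k t x)\<bar> \<le> h\<^sup>2 / 2 * B1"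
          by (simp only:)
        from mult_mono[OF this B2(2)[OF x]] B1(1) show ?case
          by (simp add: abs_mult)
      qed
    qed simp
    finally show ?thesis by (simp add: V_def mult_ac)
  qed
  have "(\<lambda>h. (\<phi> p (t + h) - \<phi> p t) / h - \<phi> (?L p) t) \<midarrow>0\<rightarrow> 0"
  proof (rule Lim_null_comparison)
    show "\<forall>\<^sub>F h in at 0. norm ((\<phi> p (t + h) - \<phi> p t) / h - \<phi> (?L p) t) \<le> \<bar>h\<bar> * (B1 * B2 * V / 2)"
      unfolding eventually_at
    proof (intro exI conjI ballI impI)
      fix h :: real assume "h \<noteq> 0 \<and> dist h 0 < 1"
      then have h: "h \<noteq> 0" by simp
      have "(\<phi> p (t + h) - \<phi> p t) / h - \<phi> (?L p) t = (\<phi> p (t + h) - \<phi> p t - h * \<phi> (?L p) t) / h"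
        using h by (simp add: field_simps)
      also have "\<bar>\<dots>\<bar> \<le> (h\<^sup>2 / 2 * B1 * B2 * V) / \<bar>h\<bar>"
        unfolding abs_divide by (intro divide_right_mono bound) simp
      also have "\<dots> = \<bar>h\<bar> * (B1 * B2 * V / 2)"
      proof -
        have "(a * a / 2 * B1 * B2 * V) / a = a * (B1 * B2 * V / 2)" if "a > 0" for a
          using that by simp
        from this[of "\<bar>h\<bar>"] h show ?thesis by (simp add: power2_eq_square)
      qed
      finally show "norm ((\<phi> p (t + h) - \<phi> p t) / h - \<phi> (?L p) t) \<le> \<bar>h\<bar> * (B1 * B2 * V / 2)"
        by simp
    qed simp
    show "(\<lambda>h. \<bar>h\<bar> * (B1 * B2 * V / 2)) \<midarrow>0\<rightarrow> 0"
      by (auto intro!: tendsto_eq_intros)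
  qed
  then have "(\<lambda>h. (\<phi> p (t + h) - \<phi> p t) / h) \<midarrow>0\<rightarrow> \<phi> (?L p) t"
    by (simp add: LIM_zero_iff)
  then show ?thesis
    by (simp add: DERIV_def \<phi>_def)
qed

text \<open>By invariance the integral of \<open>p\<close> composed with \<open>rot j k t\<close> is
  constant in t; its derivative at 0 is the integral in question.\<close>

lemma integral_sphere_rot_deriv:
  fixes p :: "real ^ 'm::finite \<Rightarrow> real"
  assumes p: "real_polynomial_function p" and jk: "j \<noteq> k"
  shows "(LINT x|sphere_measure. rot_deriv j k p x) = 0"
proof -
  have "((\<lambda>t. LINT x|sphere_measure. p (rot j k t x) * 1) has_real_derivative
      (LINT x|sphere_measure. rot_deriv j k p (rot j k 0 x) * 1)) (at 0)"
    by (rule has_real_derivative_integral_rot) (use p jk in auto)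
  moreover have "(LINT x|sphere_measure. p (rot j k t x)) = (LINT x|sphere_measure. p x)" for t
    using p jk by (intro integral_sphere_rot real_polynomial_function_measurable)
  ultimately show ?thesis
    using jk DERIV_unique[OF _ DERIV_const[of "LINT x|sphere_measure. p x"]] by simp
qed

lemma rot_deriv_skew:
  fixes p q :: "real ^ 'm::finite \<Rightarrow> real"
  assumes "real_polynomial_function p" "real_polynomial_function q" "j \<noteq> k"
  shows "(LINT x|sphere_measure. rot_deriv j k p x * q x) = - (LINT x|sphere_measure. p x * rot_deriv j k q x)"
proof -
  have "(LINT x|sphere_measure. rot_deriv j k p x * q x) + (LINT x|sphere_measure. p x * rot_deriv j k q x) =
      (LINT x|sphere_measure. rot_deriv j k (\<lambda>x. p x * q x) x)"
    using assms by (simp add: rot_deriv_mult polynomial_intros)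
  then show ?thesis
    using integral_sphere_rot_deriv[of "\<lambda>x. p x * q x"] assms by (simp add: polynomial_intros)
qed

section \<open>Functions annihilated by all infinitesimal rotations\<close>

lemma rot_deriv_same [simp]: "rot_deriv j j p = (\<lambda>x. 0)"
  by (simp add: rot_deriv_def)

text \<open>For s on the unit sphere this is the derivative of q at s along the tangential part of v
  (see \<open>tangent_deriv_eq\<close>). Writing it through the operators \<open>rot_deriv\<close>
  expresses it in quantities whose variance is known.\<close>

definition tangent_deriv :: "(real ^ 'm::finite \<Rightarrow> real) \<Rightarrow> real ^ 'm \<Rightarrow> real ^ 'm \<Rightarrow> real"
  where "tangent_deriv q s v = (\<Sum>j\<in>UNIV. \<Sum>k\<in>UNIV. v $ k * s $ j * rot_deriv j k q s)"

lemma tangent_deriv_eq: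
  fixes q :: "real ^ 'm::finite \<Rightarrow> real"
  assumes "norm s = 1"
  shows "tangent_deriv q s v = (\<Sum>k\<in>UNIV. v $ k * pd k q s) - (v \<bullet> s) * (\<Sum>j\<in>UNIV. s $ j * pd j q s)"
proof -
  have "(\<Sum>j\<in>UNIV. (s $ j)\<^sup>2) = (norm s)\<^sup>2"
    by (simp add: norm_vec_def L2_set_def sum_nonneg)
  then have s1: "(\<Sum>j\<in>UNIV. (s $ j)\<^sup>2) = 1"
    using assms by simp
  have "tangent_deriv q s v =
      (\<Sum>j\<in>UNIV. \<Sum>k\<in>UNIV. (s $ j)\<^sup>2 * (v $ k * pd k q s) - (v $ k * s $ k) * (s $ j * pd j q s))"
    unfolding tangent_deriv_def
    by (intro sum.cong refl) (simp add: rot_deriv_def power2_eq_square algebra_simps)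
  also have "\<dots> = (\<Sum>j\<in>UNIV. \<Sum>k\<in>UNIV. (s $ j)\<^sup>2 * (v $ k * pd k q s))
      - (\<Sum>j\<in>UNIV. \<Sum>k\<in>UNIV. (v $ k * s $ k) * (s $ j * pd j q s))"
    by (simp only: sum_subtractf)
  also have "(\<Sum>j\<in>UNIV. \<Sum>k\<in>UNIV. (s $ j)\<^sup>2 * (v $ k * pd k q s)) = (\<Sum>k\<in>UNIV. v $ k * pd k q s)"
    by (simp add: sum_product[symmetric] s1)
  also have "(\<Sum>j\<in>UNIV. \<Sum>k\<in>UNIV. (v $ k * s $ k) * (s $ j * pd j q s)) =
      (\<Sum>k\<in>UNIV. v $ k * s $ k) * (\<Sum>j\<in>UNIV. s $ j * pd j q s)"
    by (subst sum.swap) (simp only: sum_product)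
  finally show ?thesis
    by (simp add: inner_vec_def)
qed

text \<open>The radially constant extension of q lives on the punctured space, which is open and, in
  dimension at least 2, connected. Its derivative there is a tangential derivative of q, hence
  0.\<close>

lemma constant_on_sphere_of_rot_deriv_eq_0:
  fixes q :: "real ^ 'm::finite \<Rightarrow> real"
  assumes q: "real_polynomial_function q" and m: "2 \<le> CARD('m)"
    and L: "\<And>j k x. norm x = 1 \<Longrightarrow> rot_deriv j k q x = 0"
  obtains c where "\<And>x. norm x = 1 \<Longrightarrow> q x = c"
proof -
  let ?S = "- {0 :: real ^ 'm}"
  have "((\<lambda>x. q (sgn x)) has_derivative (\<lambda>v. 0)) (at x)" if x: "x \<in> ?S" for x
  proof -
    have "(\<lambda>x. (1 / norm x) *\<^sub>R x) differentiable (at x)"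
      using x by (intro differentiable_scaleR differentiable_divide differentiable_norm_at) auto
    then obtain f' where "((\<lambda>x. (1 / norm x) *\<^sub>R x) has_derivative f') (at x)"
      by (auto simp: differentiable_def)
    then have f': "(sgn has_derivative f') (at x)"
      by (simp add: sgn_div_norm[abs_def] divide_inverse)
    \<comment> \<open>Differentiating |sgn x|^2 = 1 shows that the derivative of \<open>sgn\<close>
      takes values tangent to the sphere.\<close>
    have "((\<lambda>x. sgn x \<bullet> sgn x) has_derivative (\<lambda>v. sgn x \<bullet> f' v + f' v \<bullet> sgn x)) (at x)"
      by (rule has_derivative_inner[OF f' f'])
    moreover have "((\<lambda>x. sgn x \<bullet> sgn x) has_derivative (\<lambda>v. 0)) (at x)"
    proof (rule has_derivative_transform_within_open[of "\<lambda>x. 1" _ _ _ ?S])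
      show "1 = sgn y \<bullet> sgn y" if "y \<in> ?S" for y :: "real ^ 'm"
        using that by (simp add: power2_norm_eq_inner[symmetric] norm_sgn)
    qed (use x in auto)
    ultimately have "(\<lambda>v. sgn x \<bullet> f' v + f' v \<bullet> sgn x) = (\<lambda>v. 0)"
      by (rule has_derivative_unique)
    then have orth: "f' v \<bullet> sgn x = 0" for v
      by (auto simp: fun_eq_iff inner_commute)
    have s: "norm (sgn x) = 1" using x by (simp add: norm_sgn)
    have "((\<lambda>x. q (sgn x)) has_derivative (\<lambda>v. \<Sum>i\<in>UNIV. f' v $ i * pd i q (sgn x))) (at x)"
      by (rule has_derivative_compose[OF f' real_polynomial_function_has_derivative_pd[OF q]])
    moreover have "(\<Sum>i\<in>UNIV. f' v $ i * pd i q (sgn x)) = 0" for v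
      using tangent_deriv_eq[OF s, of q "f' v"] by (simp add: orth L[OF s] tangent_deriv_def)
    ultimately show ?thesis by simp
  qed
  moreover have "connected ?S"
    using m by (intro connected_punctured_universe) simp
  ultimately have eq: "q (sgn x) = q (sgn y)" if "x \<noteq> 0" "y \<noteq> 0" for x y :: "real ^ 'm"
    using has_derivative_zero_unique_connected[of ?S "\<lambda>x. q (sgn x)" x y] that by auto
  define c where "c = q (sgn (axis undefined 1))"
  have "q (sgn x) = c" if "x \<noteq> 0" for x
    unfolding c_def by (rule eq[OF that]) (simp add: axis_eq_0_iff)
  then have "q x = c" if "norm x = 1" for x
    using that by (metis norm_zero sgn_div_norm inverse_1 scaleR_one zero_neq_one)
  then show ?thesis by (rule that)
qed

section \<open>Norms of harmonic polynomials under infinitesimal rotations\<close>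

definition sqint :: "(real ^ 'm \<Rightarrow> real) \<Rightarrow> real"
  where "sqint p = (LINT x|sphere_measure. (p x)\<^sup>2)"

lemma sqint_nonneg [simp]: "0 \<le> sqint p"
  by (simp add: sqint_def)

lemma sqint_rot:
  fixes p :: "real ^ 'm::finite \<Rightarrow> real"
  assumes "real_polynomial_function p" "j \<noteq> k"
  shows "(LINT x|sphere_measure. (p (rot j k t x))\<^sup>2) = sqint p"
  unfolding sqint_def using assms
  by (intro integral_sphere_rot[where g = "\<lambda>x. (p x)\<^sup>2"] borel_measurable_power
      real_polynomial_function_measurable)

text \<open>Twice the Laplace eigenvalue l (l + n - 1), with m = n + 1; the factor 2 comes from
  summing over ordered pairs.\<close>

abbreviation casimir :: "nat \<Rightarrow> nat \<Rightarrow> real"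
  where "casimir m l \<equiv> 2 * (real l * (real l + real m - 2))"

lemma sum_sqint_rot_deriv:
  fixes p :: "real ^ 'm::finite \<Rightarrow> real"
  assumes h: "harmonic l p"
  shows "(\<Sum>j\<in>UNIV. \<Sum>k\<in>UNIV. sqint (rot_deriv j k p)) = casimir CARD('m) l * sqint p"
proof -
  note p = harmonic_polynomial[OF h]
  have "sqint (rot_deriv j k p) = (LINT x|sphere_measure. - (p x * rot_deriv j k (rot_deriv j k p) x))" for j k
  proof (cases "j = k")
    case False
    then show ?thesis
      using rot_deriv_skew[OF p real_polynomial_function_rot_deriv[OF p] False, of j k]
      by (simp add: sqint_def power2_eq_square)
  qed (simp add: sqint_def)
  then have "(\<Sum>j\<in>UNIV. \<Sum>k\<in>UNIV. sqint (rot_deriv j k p)) =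
      (LINT x|sphere_measure. (\<Sum>j\<in>UNIV. \<Sum>k\<in>UNIV. - (p x * rot_deriv j k (rot_deriv j k p) x)))"
    using p by (simp add: polynomial_intros)
  also have "(\<lambda>x. \<Sum>j\<in>UNIV. \<Sum>k\<in>UNIV. - (p x * rot_deriv j k (rot_deriv j k p) x)) =
      (\<lambda>x. casimir CARD('m) l * (p x)\<^sup>2)"
    using sum_rot_deriv_squared[OF h]
    by (auto simp: sum_negf sum_distrib_left[symmetric] power2_eq_square)
  finally show ?thesis
    by (simp add: sqint_def)
qed

lemma sqint_rot_deriv_le:
  fixes p :: "real ^ 'm::finite \<Rightarrow> real"
  assumes h: "harmonic l p"
  shows "sqint (rot_deriv j k p) \<le> casimir CARD('m) l * sqint p"
proof -
  have "sqint (rot_deriv j k p) \<le> (\<Sum>k\<in>UNIV. sqint (rot_deriv j k p))"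
    by (rule member_le_sum) auto
  also have "\<dots> \<le> (\<Sum>j\<in>UNIV. \<Sum>k\<in>UNIV. sqint (rot_deriv j k p))"
    by (rule member_le_sum[of j UNIV "\<lambda>j. \<Sum>k\<in>UNIV. sqint (rot_deriv j k p)"]) (auto intro: sum_nonneg)
  finally show ?thesis
    by (simp add: sum_sqint_rot_deriv[OF h])
qed

lemma casimir_nonneg: "2 \<le> m \<Longrightarrow> 0 \<le> casimir m l"
  by simp

lemma polynomial_rot_integrable:
  fixes p g :: "real ^ 'm::finite \<Rightarrow> real"
  assumes "real_polynomial_function p" "real_polynomial_function g"
  shows "integrable sphere_measure (\<lambda>x. p (rot j k s x) * g (rot j' k' t x))"
  by (intro integrable_sphere_measure continuous_intros
      continuous_on_compose2[OF continuous_on_real_polynomial_function[OF assms(1)]]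
      continuous_on_compose2[OF continuous_on_real_polynomial_function[OF assms(2)]]
      linear_continuous_on linear_conv_bounded_linear[THEN iffD1] rot_linear) auto

text \<open>By invariance the right-hand side is 2 (g 0 - g t), where g t is the inner product of
  \<open>p\<close> rotated by t with \<open>p\<close>. In the fourth-order expansion of g the odd
  derivatives at 0 vanish by skewness and the second is - \<open>sqint (rot_deriv j k p)\<close>;
  bounding the fourth yields the coefficient 2 / 4! = 1 / 12.\<close>

lemma rot_difference_lower_bound:
  fixes p :: "real ^ 'm::finite \<Rightarrow> real"
  assumes h: "harmonic l p" and jk: "j \<noteq> k" and m: "2 \<le> CARD('m)"
  shows "t\<^sup>2 * sqint (rot_deriv j k p) - t ^ 4 * (casimir CARD('m) l)\<^sup>2 * sqint p / 12 \<le>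
    (LINT x|sphere_measure. (p (rot j k t x) - p x)\<^sup>2)"
proof -
  let ?L = "rot_deriv j k" and ?\<mu> = "casimir CARD('m) l"
  note p = harmonic_polynomial[OF h]
  have \<mu>: "0 \<le> ?\<mu>" using m by (rule casimir_nonneg)
  have hL: "harmonic l ((?L ^^ n) p)" for n
    by (induction n) (auto intro: h harmonic_rot_deriv)
  have N: "sqint ((?L ^^ n) p) \<le> ?\<mu> ^ n * sqint p" for n
  proof (induction n)
    case (Suc n)
    have "sqint ((?L ^^ Suc n) p) \<le> ?\<mu> * sqint ((?L ^^ n) p)"
      using sqint_rot_deriv_le[OF hL[of n]] by simp
    also have "\<dots> \<le> ?\<mu> * (?\<mu> ^ n * sqint p)"
      using Suc \<mu> by (intro mult_left_mono)
    finally show ?case by (simp only: power_Suc mult.assoc)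
  qed simp
  have poly: "real_polynomial_function ((?L ^^ n) p)" for n
    using p by simp
  define \<phi> where "\<phi> = (\<lambda>n t. LINT x|sphere_measure. (?L ^^ n) p (rot j k t x) * p x)"
  have D: "\<forall>n t. DERIV (\<phi> n) t :> \<phi> (Suc n) t"
    using has_real_derivative_integral_rot[OF poly p jk] by (simp add: \<phi>_def)
  have \<phi>0: "\<phi> n 0 = (LINT x|sphere_measure. (?L ^^ n) p x * p x)" for n
    using jk by (simp add: \<phi>_def)
  have skew: "(LINT x|sphere_measure. ?L f x * g x) = - (LINT x|sphere_measure. f x * ?L g x)"
    if "real_polynomial_function f" "real_polynomial_function g" for f g
    using rot_deriv_skew[OF that jk] .
  have self: "(LINT x|sphere_measure. ?L f x * f x) = 0" if "real_polynomial_function f" for f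
    using skew[OF that that] by (simp add: mult.commute)
  have v0: "\<phi> 0 0 = sqint p"
    by (simp add: \<phi>0 sqint_def power2_eq_square)
  have v1: "\<phi> 1 0 = 0"
    using self[OF p] by (simp add: \<phi>0)
  have v2: "\<phi> 2 0 = - sqint (?L p)"
    using skew[of "?L p" p] p by (simp add: \<phi>0 numeral_2_eq_2 sqint_def power2_eq_square)
  have v3: "\<phi> 3 0 = 0"
    using skew[of "?L (?L p)" p] self[of "?L p"] p by (simp add: \<phi>0 numeral_3_eq_3)
  \<comment> \<open>AM-GM weighted by the square of the eigenvalue makes the two halves equal, and
    rotation invariance removes the angle s. Eigenvalue 0 is treated separately, where the
    infinitesimal rotation of \<open>p\<close> has norm 0.\<close>
  have v4: "\<phi> 4 s \<le> ?\<mu>\<^sup>2 * sqint p" if \<mu>0: "0 < ?\<mu>" for s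
  proof -
    let ?u = "\<lambda>x. (?L ^^ 4) p (rot j k s x)"
    have i1: "integrable sphere_measure (\<lambda>x. ?u x * p x)"
      using polynomial_rot_integrable[OF poly[of 4] p, of j k s j k 0] jk by simp
    have i2: "integrable sphere_measure (\<lambda>x. (?u x)\<^sup>2)"
      using polynomial_rot_integrable[OF poly[of 4] poly[of 4], of j k s j k s] by (simp add: power2_eq_square)
    have i3: "integrable sphere_measure (\<lambda>x. (p x)\<^sup>2)"
      using p by (intro integrable_sphere_polynomial) auto
    have "\<phi> 4 s \<le> (LINT x|sphere_measure. (?u x)\<^sup>2 / (2 * ?\<mu>\<^sup>2) + ?\<mu>\<^sup>2 / 2 * (p x)\<^sup>2)"
      unfolding \<phi>_def
    proof (rule integral_mono[OF i1])
      show "integrable sphere_measure (\<lambda>x. (?u x)\<^sup>2 / (2 * ?\<mu>\<^sup>2) + ?\<mu>\<^sup>2 / 2 * (p x)\<^sup>2)"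
        using i2 i3 by auto
      have amgm: "a * b \<le> a\<^sup>2 / (2 * c) + c / 2 * b\<^sup>2" if "0 < c" for a b c :: real
      proof -
        have "0 \<le> (a - c * b)\<^sup>2 / (2 * c)" using that by simp
        also have "\<dots> = a\<^sup>2 / (2 * c) + c / 2 * b\<^sup>2 - a * b"
          using that by (simp add: power2_eq_square field_simps)
        finally show ?thesis by simp
      qed
      show "?u x * p x \<le> (?u x)\<^sup>2 / (2 * ?\<mu>\<^sup>2) + ?\<mu>\<^sup>2 / 2 * (p x)\<^sup>2" for x
        using \<mu>0 by (intro amgm zero_less_power)
    qed
    also have "\<dots> = sqint ((?L ^^ 4) p) / (2 * ?\<mu>\<^sup>2) + ?\<mu>\<^sup>2 / 2 * sqint p"
    proof -
      have "(LINT x|sphere_measure. (?u x)\<^sup>2) = sqint ((?L ^^ 4) p)"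
        by (rule sqint_rot[OF poly jk])
      then show ?thesis
        using i2 i3 by (simp add: sqint_def)
    qed
    also have "sqint ((?L ^^ 4) p) / (2 * ?\<mu>\<^sup>2) \<le> ?\<mu> ^ 4 * sqint p / (2 * ?\<mu>\<^sup>2)"
      by (intro divide_right_mono N) simp
    also have "?\<mu> ^ 4 * sqint p / (2 * ?\<mu>\<^sup>2) = ?\<mu>\<^sup>2 / 2 * sqint p"
    proof -
      have "c ^ 4 * b / (2 * c\<^sup>2) = c\<^sup>2 / 2 * b" if "c > 0" for b c :: real
        using that by (simp add: power2_eq_square power4_eq_xxxx field_simps)
      from this[OF \<mu>0] show ?thesis .
    qed
    finally show ?thesis by (simp add: mult_ac)
  qed
  show ?thesis
  proof (cases "?\<mu> = 0")
    case True
    then have "sqint (?L p) \<le> 0"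
      using sqint_rot_deriv_le[OF h, of j k] unfolding True by simp
    then have "t\<^sup>2 * sqint (?L p) \<le> 0"
      by (simp add: mult_nonneg_nonpos)
    moreover have "0 \<le> (LINT x|sphere_measure. (p (rot j k t x) - p x)\<^sup>2)"
      by simp
    moreover have "t ^ 4 * ?\<mu>\<^sup>2 * sqint p / 12 = 0"
      unfolding True by simp
    ultimately show ?thesis by linarith
  next
    case False
    then have \<mu>0: "0 < ?\<mu>" using \<mu> by linarith
    obtain s where s: "\<phi> 0 t = (\<Sum>m<4. (\<phi> m 0 / fact m) * t ^ m) + (\<phi> 4 s / fact 4) * t ^ 4"
      using Maclaurin_all_le[where n = 4 and x = t and diff = \<phi>, OF refl D] by blast
    have "\<phi> 0 t = sqint p - t\<^sup>2 / 2 * sqint (?L p) + \<phi> 4 s / 24 * t ^ 4"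
      using s v0 v1 v2 v3 by (simp add: lessThan_Suc eval_nat_numeral fact_numeral)
    also have "\<phi> 4 s / 24 * t ^ 4 \<le> ?\<mu>\<^sup>2 * sqint p / 24 * t ^ 4"
      using v4[OF \<mu>0, of s] by (intro mult_right_mono divide_right_mono) auto
    finally have \<phi>t: "\<phi> 0 t \<le> sqint p - t\<^sup>2 / 2 * sqint (?L p) + ?\<mu>\<^sup>2 * sqint p / 24 * t ^ 4"
      by simp
    have i1: "integrable sphere_measure (\<lambda>x. p (rot j k t x) * p x)"
      using polynomial_rot_integrable[OF p p, of j k t j k 0] jk by simp
    have i2: "integrable sphere_measure (\<lambda>x. (p (rot j k t x))\<^sup>2)"
      using polynomial_rot_integrable[OF p p, of j k t j k t] by (simp add: power2_eq_square)
    have i3: "integrable sphere_measure (\<lambda>x. (p x)\<^sup>2)"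
      using p by (intro integrable_sphere_polynomial) auto
    have "(LINT x|sphere_measure. (p (rot j k t x) - p x)\<^sup>2) =
        (LINT x|sphere_measure. (p (rot j k t x))\<^sup>2 + (p x)\<^sup>2 - 2 * (p (rot j k t x) * p x))"
      by (simp add: power2_eq_square algebra_simps)
    also have "\<dots> = 2 * sqint p - 2 * \<phi> 0 t"
      using i1 i2 i3 sqint_rot[OF p jk, of t] by (simp add: \<phi>_def sqint_def)
    finally show ?thesis
      using \<phi>t by (simp add: algebra_simps)
  qed
qed

section \<open>A raising operator on harmonic polynomials\<close>

lemma homogeneous_eq_0_of_sphere:
  fixes p :: "real ^ 'm::finite \<Rightarrow> real"
  assumes h: "harmonic l p" and z: "\<And>x. norm x = 1 \<Longrightarrow> p x = 0"
  shows "p = (\<lambda>x. 0)"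
proof
  fix x
  show "p x = 0"
  proof (cases "x = 0")
    case False
    have "p x = p (norm x *\<^sub>R sgn x)" using False by (simp add: sgn_div_norm)
    also have "\<dots> = norm x ^ l * p (sgn x)" by (rule harmonic_scale[OF h])
    also have "p (sgn x) = 0" using False by (intro z) (simp add: norm_sgn)
    finally show ?thesis by simp
  next
    case True
    \<comment> \<open>For l = 0 the factor 0 ^ l is 1, and the value at a unit vector
      decides.\<close>
    have "p 0 = 0 ^ l * p (axis undefined 1)"
      using harmonic_scale[OF h, of 0 "axis undefined 1"] by simp
    also have "p (axis undefined 1) = 0" by (rule z) simp
    finally show ?thesis using True by simp
  qed
qed

text \<open>If \<open>p\<close> is nonzero at a unit vector x0, then by homogeneity it is nonzero
  near x0 / 2. A whole ball there projects radially into the nonzero set, which therefore has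
  positive surface measure.\<close>

lemma sqint_eq_0_imp:
  fixes p :: "real ^ 'm::finite \<Rightarrow> real"
  assumes h: "harmonic l p" and z: "sqint p = 0"
  shows "p = (\<lambda>x. 0)"
proof (rule homogeneous_eq_0_of_sphere[OF h], rule ccontr)
  fix x0 :: "real ^ 'm" assume x0: "norm x0 = 1" "p x0 \<noteq> 0"
  note p = harmonic_polynomial[OF h]
  let ?U = "{x. p x \<noteq> 0} \<inter> (ball 0 1 - {0})"
  have "open (p -` (- {0}))"
    using continuous_on_real_polynomial_function[OF p, of UNIV] by (intro open_vimage) auto
  then have U: "open ?U"
    by (intro open_Int open_Diff) (auto simp: vimage_def)
  have "(1/2) *\<^sub>R x0 \<in> ?U"
    using x0 harmonic_scale[OF h, of "1/2" x0] by auto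
  then obtain e where e: "e > 0" "ball ((1/2) *\<^sub>R x0) e \<subseteq> ?U"
    using U by (meson open_contains_ball)
  have int: "integrable sphere_measure (\<lambda>x. (p x)\<^sup>2)"
    using p by (intro integrable_sphere_polynomial) auto
  have "AE x in sphere_measure. (p x)\<^sup>2 = 0"
    using z int by (subst integral_nonneg_eq_0_iff_AE[symmetric]) (auto simp: sqint_def)
  then have "emeasure sphere_measure {x. p x \<noteq> 0} = 0"
    using real_polynomial_function_measurable[OF p] by (subst (asm) AE_iff_measurable[OF _ refl]) auto
  moreover have pm: "{x. p x \<noteq> 0} \<in> sets borel"
    using real_polynomial_function_measurable[OF p] by measurable
  ultimately have "emeasure lborel {x \<in> ball 0 1. sgn x \<in> {x. p x \<noteq> 0}} = 0"
    by (subst (asm) emeasure_sphere_measure) auto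
  moreover have "?U \<subseteq> {x \<in> ball 0 1. sgn x \<in> {x. p x \<noteq> 0}}"
  proof
    fix x assume x: "x \<in> ?U"
    have "p x = norm x ^ l * p (sgn x)"
      using x harmonic_scale[OF h, of "norm x" "sgn x"] by (simp add: sgn_div_norm)
    then show "x \<in> {x \<in> ball 0 1. sgn x \<in> {x. p x \<noteq> 0}}"
      using x by auto
  qed
  moreover have "{x \<in> ball 0 1. sgn x \<in> {x. p x \<noteq> 0}} \<in> sets lborel"
  proof -
    have "ball 0 1 \<inter> (sgn -` {x. p x \<noteq> 0} \<inter> space borel) \<in> sets borel"
      by (intro sets.Int measurable_sets[OF sgn_measurable] pm) auto
    then show ?thesis by (simp add: vimage_def Int_def)
  qed
  ultimately have "emeasure lborel (ball ((1/2) *\<^sub>R x0) e) = 0"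
    using e(2) emeasure_mono[of "ball ((1/2) *\<^sub>R x0) e" "{x \<in> ball 0 1. sgn x \<in> {x. p x \<noteq> 0}}" lborel]
    by (metis (no_types, lifting) dual_order.trans le_zero_eq)
  then show False
    using e(1) unit_ball_vol_pos[of "real DIM(real ^ 'm)"] zero_less_power[OF e(1), of "CARD('m)"]
    by (simp add: emeasure_ball ennreal_eq_0_iff not_le[symmetric] mult_le_0_iff)
qed

text \<open>The denominator vanishes only for \<open>l = 0\<close>, \<open>m = 2\<close>, where \<open>\<partial>\<^sub>e p = 0\<close>, so that the value of the quotient does
  not matter.\<close>

definition raise_degree :: "'m \<Rightarrow> nat \<Rightarrow> (real ^ 'm \<Rightarrow> real) \<Rightarrow> real ^ 'm \<Rightarrow> real"
  where "raise_degree e l p =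
    (\<lambda>x. x $ e * p x - (\<Sum>i\<in>UNIV. x $ i * x $ i) * (pd e p x / (2 * real l + real CARD('m) - 2)))"

lemma harmonic_0_constant:
  fixes p :: "real ^ 'm::finite \<Rightarrow> real"
  assumes "harmonic 0 p"
  shows "p = (\<lambda>x. p 0)"
proof
  fix x
  show "p x = p 0"
    using harmonic_scale[OF assms, of 0 x] by simp
qed

lemma laplacian_sqnorm_mult:
  fixes q :: "real ^ 'm::finite \<Rightarrow> real"
  assumes q: "real_polynomial_function q"
  shows "(\<Sum>i\<in>UNIV. pd i (pd i (\<lambda>x. (\<Sum>i\<in>UNIV. x $ i * x $ i) * q x)) x) =
    2 * real CARD('m) * q x + 4 * (\<Sum>i\<in>UNIV. x $ i * pd i q x)
    + (\<Sum>i\<in>UNIV. x $ i * x $ i) * (\<Sum>i\<in>UNIV. pd i (pd i q) x)"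
proof -
  let ?r = "\<lambda>x :: real ^ 'm. \<Sum>i\<in>UNIV. x $ i * x $ i"
  have r: "real_polynomial_function ?r"
    by (intro polynomial_intros finite) 
  have pr: "pd i ?r = (\<lambda>x. 2 * x $ i)" for i
    by (simp add: pd_simps if_distrib[of "\<lambda>a. a * _"] if_distrib[of "\<lambda>a. _ * a"] sum.distrib cong: if_cong)
  have "pd i (pd i (\<lambda>x. ?r x * q x)) x = 2 * q x + 4 * (x $ i * pd i q x) + ?r x * pd i (pd i q) x" for i
    using q r by (simp add: pd_mult pd_add pr pd_cmult polynomial_intros pd_nth algebra_simps)
  then show ?thesis
    by (simp add: sum.distrib sum_distrib_left)
qed

lemma pd_pd_diff:
  fixes f g :: "real ^ 'm::finite \<Rightarrow> real"
  assumes "real_polynomial_function f" "real_polynomial_function g"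
  shows "pd i (pd i (\<lambda>x. f x - g x)) x = pd i (pd i f) x - pd i (pd i g) x"
  using assms by (simp add: pd_diff)

text \<open>This is the harmonic projection of x_e p. The Laplacian of x_e p is 2 d_e p, that of
  |x|^2 d_e p is 2 (2 l + m - 2) d_e p, and the quotient in \<open>raise_degree\<close> makes the
  two cancel.\<close>

lemma harmonic_raise_degree:
  fixes p :: "real ^ 'm::finite \<Rightarrow> real"
  assumes h: "harmonic l p" and m: "2 \<le> CARD('m)"
  shows "harmonic (Suc l) (raise_degree e l p)"
  unfolding harmonic_homogeneous_polynomial_def laplacian_eq_pd
proof (intro conjI allI)
  note p = harmonicD[OF h]
  let ?c = "2 * real l + real CARD('m) - 2"
  let ?r = "\<lambda>x :: real ^ 'm. \<Sum>i\<in>UNIV. x $ i * x $ i"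
  let ?q = "\<lambda>x. pd e p x / ?c"
  have q: "real_polynomial_function ?q"
    using p(1) by (intro real_polynomial_function_divide) simp
  have r: "real_polynomial_function ?r"
    by (intro polynomial_intros finite)
  show "real_polynomial_function (raise_degree e l p)"
    unfolding raise_degree_def using p(1) q r by (intro polynomial_intros) simp_all
  show "raise_degree e l p (c *\<^sub>R x) = c ^ Suc l * raise_degree e l p x" for c x
  proof -
    have "raise_degree e l p (c *\<^sub>R x) =
        c * x $ e * p (c *\<^sub>R x) - c * ?r x * (c * pd e p (c *\<^sub>R x)) / ?c"
      by (simp add: raise_degree_def sum_distrib_left mult_ac)
    then show ?thesis
      by (simp only: homogeneous_pd[OF p(1,2)] p(2)) (simp add: raise_degree_def algebra_simps)
  qed
  show "(\<Sum>i\<in>UNIV. pd i (pd i (raise_degree e l p)) x) = 0" for x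
  proof -
    have q': "?q = (\<lambda>x. (1 / ?c) * pd e p x)" by auto
    have pdq: "pd i ?q x = pd i (pd e p) x / ?c" for i x
      unfolding q' using p(1) by (subst pd_cmult) auto
    then have pdq': "pd i ?q = (\<lambda>x. pd i (pd e p) x / ?c)" for i by auto
    have pdpdq: "pd i (pd i ?q) x = pd i (pd i (pd e p)) x / ?c" for i
    proof -
      have "pd i (\<lambda>x. pd i (pd e p) x / ?c) x = pd i (\<lambda>x. (1 / ?c) * pd i (pd e p) x) x" by simp
      also have "\<dots> = pd i (pd i (pd e p)) x / ?c" using p(1) by (subst pd_cmult) auto
      finally show ?thesis by (simp only: pdq')
    qed
    have "pd i (pd i (raise_degree e l p)) x =
        pd i (pd i (\<lambda>x. x $ e * p x)) x - pd i (pd i (\<lambda>x. ?r x * ?q x)) x" for i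
      unfolding raise_degree_def
      by (rule pd_pd_diff) (use p(1) q r in \<open>auto intro!: polynomial_intros\<close>)
    then have "(\<Sum>i\<in>UNIV. pd i (pd i (raise_degree e l p)) x) =
        (\<Sum>i\<in>UNIV. pd i (pd i (\<lambda>x. x $ e * p x)) x) - (\<Sum>i\<in>UNIV. pd i (pd i (\<lambda>x. ?r x * ?q x)) x)"
      by (simp add: sum_subtractf)
    also have "(\<Sum>i\<in>UNIV. pd i (pd i (\<lambda>x. x $ e * p x)) x) = 2 * pd e p x"
      using p(1) by (simp add: pd_pd_mult_nth sum.distrib sum_distrib_left[symmetric] p(3))
    also have "(\<Sum>i\<in>UNIV. pd i (pd i (\<lambda>x. ?r x * ?q x)) x) =
        2 * real CARD('m) * (pd e p x / ?c) + 4 * ((real l - 1) * pd e p x / ?c)"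
      unfolding laplacian_sqnorm_mult[OF q] pdq pdpdq
      by (simp add: sum_divide_distrib[symmetric] times_divide_eq_right[symmetric]
          euler_identity_pd[OF h] laplacian_pd_harmonic[OF h] del: times_divide_eq_right)
         (simp add: sum_divide_distrib[symmetric] euler_identity_pd[OF h])
    also have "2 * pd e p x - (2 * real CARD('m) * (pd e p x / ?c) + 4 * ((real l - 1) * pd e p x / ?c)) = 0"
    proof (cases "?c = 0")
      case True
      then have "l = 0" using m by auto
      then have "p = (\<lambda>x. p 0)" using harmonic_0_constant h by blast
      then have "pd e p = (\<lambda>x. 0)" by (metis pd_const)
      then show ?thesis by simp
    next
      case False
      have "2 * D - (A * (D / c) + 4 * (B * D / c)) = (2 * c * D - A * D - 4 * (B * D)) / c"
        if "c \<noteq> 0" for A B c D :: real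
        using that by (simp add: field_simps)
      from this[OF False]
      have "2 * pd e p x - (2 * real CARD('m) * (pd e p x / ?c) + 4 * ((real l - 1) * pd e p x / ?c)) =
          (2 * ?c * pd e p x - 2 * real CARD('m) * pd e p x - 4 * ((real l - 1) * pd e p x)) / ?c" .
      also have "\<dots> = 0" by (simp add: algebra_simps)
      finally show ?thesis .
    qed
    finally show ?thesis .
  qed
qed

text \<open>If \<open>c x\<^sub>e p = \<partial>\<^sub>e p\<close> on the sphere with \<open>c = 2 l + m - 2\<close>, then multiplying by \<open>x\<^sub>e p\<close> and integrating
  by parts gives \<open>\<integral>p\<^sup>2 = (4 - 2 l - m) \<integral>x\<^sub>e\<^sup>2 p\<^sup>2\<close>.\<close>

lemma raise_degree_inj:
  fixes p :: "real ^ 'm::finite \<Rightarrow> real"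
  assumes h: "harmonic l p" and m: "2 \<le> CARD('m)" and z: "raise_degree e l p = (\<lambda>x. 0)"
  shows "p = (\<lambda>x. 0)"
proof (cases "l = 0")
  \<comment> \<open>For l = 0 the coefficient 4 - 2 l - m is positive when m is 2 or 3, so the sign
    argument fails; but \<open>p\<close> is then constant and raising it gives x_e times that
    constant.\<close>
  case True
  then have c: "p = (\<lambda>x. p 0)" using harmonic_0_constant h by blast
  then have pd: "pd e p = (\<lambda>x. 0)" by (metis pd_const)
  have "raise_degree e l p (axis e 1) = 0" using z by simp
  then have "p (axis e 1) = 0" by (simp add: raise_degree_def pd)
  then show ?thesis using c by metis
next
  case False
  note p = harmonicD[OF h]
  let ?c = "2 * real l + real CARD('m) - 2"
  have c: "?c > 0" using m False by linarith
  let ?L = "\<lambda>j. rot_deriv j e"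
  define I where "I = (LINT x|sphere_measure. x $ e * x $ e * (p x * p x))"
  have sph: "(\<Sum>j\<in>UNIV. x $ j * x $ j) = 1" if "norm x = 1" for x :: "real ^ 'm"
    using that by (simp add: norm_eq_1 inner_vec_def)
  have 1: "(real l + real CARD('m) - 2) * (x $ e * x $ e * (p x * p x)) =
      (\<Sum>j\<in>UNIV. x $ e * x $ j * (?L j p x * p x))" if x: "norm x = 1" for x
  proof -
    have "raise_degree e l p x = 0" using z by simp
    then have e: "pd e p x = ?c * (x $ e * p x)"
      using c by (simp add: raise_degree_def sph[OF x] field_simps)
    have "(\<Sum>j\<in>UNIV. x $ j * ?L j p x) =
        (\<Sum>j\<in>UNIV. (x $ j * x $ j) * pd e p x - x $ e * (x $ j * pd j p x))"
      by (rule sum.cong) (auto simp: rot_deriv_def algebra_simps)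
    also have "\<dots> = pd e p x - x $ e * (real l * p x)"
      by (simp only: sum_subtractf sum_distrib_right[symmetric] sum_distrib_left[symmetric] sph[OF x]
          euler_identity[OF p(1,2)])
    also have "\<dots> = (real l + real CARD('m) - 2) * (x $ e * p x)"
      unfolding e by (simp add: algebra_simps)
    finally have "(real l + real CARD('m) - 2) * (x $ e * p x) * (x $ e * p x) =
        (\<Sum>j\<in>UNIV. x $ j * ?L j p x) * (x $ e * p x)" by simp
    then show ?thesis
      by (simp add: sum_distrib_right sum_distrib_left mult_ac)
  qed
  have 2: "2 * (LINT x|sphere_measure. x $ e * x $ j * (?L j p x * p x)) =
      (if j = e then 0 else - (LINT x|sphere_measure. (x $ j * x $ j - x $ e * x $ e) * (p x * p x)))" for j
  proof (cases "j = e")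
    case je: False
    have L1: "?L j (\<lambda>x. x $ e * x $ j) = (\<lambda>x. x $ j * x $ j - x $ e * x $ e)"
      using je by (auto simp: rot_deriv_def pd_simps algebra_simps)
    have L2: "?L j (\<lambda>x. p x * p x) = (\<lambda>x. 2 * (?L j p x * p x))"
      using p(1) by (simp add: rot_deriv_mult mult.commute)
    have "(LINT x|sphere_measure. (x $ j * x $ j - x $ e * x $ e) * (p x * p x)) =
        - (LINT x|sphere_measure. x $ e * x $ j * (2 * (?L j p x * p x)))"
      using rot_deriv_skew[of "\<lambda>x. x $ e * x $ j" "\<lambda>x. p x * p x" j e] je p(1)
      unfolding L1 L2 by (simp add: polynomial_intros)
    also have "(LINT x|sphere_measure. x $ e * x $ j * (2 * (?L j p x * p x))) =
        2 * (LINT x|sphere_measure. x $ e * x $ j * (?L j p x * p x))"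
      by (subst integral_mult_right_zero[symmetric]) (simp add: mult_ac)
    finally show ?thesis using je by simp
  qed simp
  have poly: "real_polynomial_function (\<lambda>x. x $ i * x $ j * (p x * p x))"
      "real_polynomial_function (\<lambda>x. x $ i * x $ j * (?L j' p x * p x))" for i j j'
    using p(1) by (intro polynomial_intros real_polynomial_function_rot_deriv; simp)+
  have i1: "integrable sphere_measure (\<lambda>x. x $ i * x $ j * (p x * p x))" for i j
    using poly(1) by (rule integrable_sphere_polynomial)
  have i2: "integrable sphere_measure (\<lambda>x. x $ i * x $ j * (?L j' p x * p x))" for i j j'
    using poly(2) by (rule integrable_sphere_polynomial)
  have "2 * ((real l + real CARD('m) - 2) * I) =
      2 * (LINT x|sphere_measure. (real l + real CARD('m) - 2) * (x $ e * x $ e * (p x * p x)))"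
    by (simp add: I_def)
  also have "\<dots> = 2 * (LINT x|sphere_measure. (\<Sum>j\<in>UNIV. x $ e * x $ j * (?L j p x * p x)))"
  proof -
    have "(LINT x|sphere_measure. (real l + real CARD('m) - 2) * (x $ e * x $ e * (p x * p x))) =
       (LINT x|sphere_measure. (\<Sum>j\<in>UNIV. x $ e * x $ j * (?L j p x * p x)))"
    proof (rule integral_cong_AE)
      show "AE x in sphere_measure. (real l + real CARD('m) - 2) * (x $ e * x $ e * (p x * p x)) =
          (\<Sum>j\<in>UNIV. x $ e * x $ j * (?L j p x * p x))"
        using AE_sphere_measure by eventually_elim (rule 1, simp)
      show "(\<lambda>x. (real l + real CARD('m) - 2) * (x $ e * x $ e * (p x * p x))) \<in> borel_measurable sphere_measure"
        using borel_measurable_integrable[OF i1[of e e]] by (rule borel_measurable_times[OF borel_measurable_const])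
      show "(\<lambda>x. \<Sum>j\<in>UNIV. x $ e * x $ j * (?L j p x * p x)) \<in> borel_measurable sphere_measure"
        by (intro borel_measurable_sum borel_measurable_integrable i2)
    qed
    then show ?thesis by (rule arg_cong)
  qed
  also have "\<dots> = (\<Sum>j\<in>UNIV. 2 * (LINT x|sphere_measure. x $ e * x $ j * (?L j p x * p x)))"
    by (subst Bochner_Integration.integral_sum) (auto simp: i2 sum_distrib_left)
  also have "\<dots> = (\<Sum>j\<in>UNIV. - (LINT x|sphere_measure. (x $ j * x $ j - x $ e * x $ e) * (p x * p x)))"
    by (rule sum.cong) (auto simp: 2)
  also have "\<dots> = (\<Sum>j\<in>UNIV. - ((LINT x|sphere_measure. x $ j * x $ j * (p x * p x)) - I))"
    by (simp add: left_diff_distrib i1 I_def)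
  also have "\<dots> = - (\<Sum>j\<in>UNIV. LINT x|sphere_measure. x $ j * x $ j * (p x * p x)) + real CARD('m) * I"
    by (simp add: sum_negf sum_subtractf)
  also have "(\<Sum>j\<in>UNIV. LINT x|sphere_measure. x $ j * x $ j * (p x * p x)) =
      (LINT x|sphere_measure. (\<Sum>j\<in>UNIV. x $ j * x $ j * (p x * p x)))"
    by (subst Bochner_Integration.integral_sum) (auto simp: i1)
  also have "\<dots> = sqint p"
    unfolding sqint_def
  proof (rule integral_cong_AE)
    show "AE x in sphere_measure. (\<Sum>j\<in>UNIV. x $ j * x $ j * (p x * p x)) = (p x)\<^sup>2"
      using AE_sphere_measure
    proof eventually_elim
      case (elim x)
      then show ?case
        using sph[of x] by (simp add: sum_distrib_right[symmetric] power2_eq_square)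
    qed
    show "(\<lambda>x. \<Sum>j\<in>UNIV. x $ j * x $ j * (p x * p x)) \<in> borel_measurable sphere_measure"
      by (intro borel_measurable_sum borel_measurable_integrable i1)
    show "(\<lambda>x. (p x)\<^sup>2) \<in> borel_measurable sphere_measure"
      using real_polynomial_function_measurable[OF p(1)] by simp
  qed
  finally have eq: "sqint p = (4 - 2 * real l - real CARD('m)) * I"
    by (simp add: algebra_simps)
  have "0 \<le> I"
    unfolding I_def by (intro Bochner_Integration.integral_nonneg mult_nonneg_nonneg[OF zero_le_square zero_le_square])
  moreover have "4 - 2 * real l - real CARD('m) \<le> 0" using m False by linarith
  ultimately have "sqint p \<le> 0"
    unfolding eq by (rule mult_nonpos_nonneg[rotated])
  then have "sqint p = 0"
    using sqint_nonneg[of p] by linarith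
  then show ?thesis by (rule sqint_eq_0_imp[OF h])
qed

lemma raise_degree_sum:
  fixes P :: "'a \<Rightarrow> real ^ 'm::finite \<Rightarrow> real"
  assumes "finite A" "\<And>i. i \<in> A \<Longrightarrow> real_polynomial_function (P i)"
  shows "raise_degree e l (\<lambda>x. \<Sum>i\<in>A. c i * P i x) = (\<lambda>x. \<Sum>i\<in>A. c i * raise_degree e l (P i) x)"
proof
  fix x
  have "pd e (\<lambda>x. \<Sum>i\<in>A. c i * P i x) x = (\<Sum>i\<in>A. c i * pd e (P i) x)"
    using assms by (subst pd_sum) (auto simp: pd_cmult intro!: polynomial_intros)
  then show "raise_degree e l (\<lambda>x. \<Sum>i\<in>A. c i * P i x) x = (\<Sum>i\<in>A. c i * raise_degree e l (P i) x)"
    unfolding raise_degree_def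
    by (simp add: right_diff_distrib sum_subtractf sum_distrib_left sum_divide_distrib mult_ac)
qed

lemma harmonic_sum:
  fixes P :: "'a \<Rightarrow> real ^ 'm::finite \<Rightarrow> real"
  assumes "finite A" "\<And>i. i \<in> A \<Longrightarrow> harmonic l (P i)"
  shows "harmonic l (\<lambda>x. \<Sum>i\<in>A. c i * P i x)"
  using assms by (induction A rule: finite_induct) (simp_all add: harmonic_zero harmonic_add harmonic_cmult)

text \<open>Injectivity of raising carries the constant 1 up to every degree. This makes all
  dimensions, and hence the variance \<kappa>, positive.\<close>

lemma ex_nonzero_harmonic:
  assumes m: "2 \<le> CARD('m::finite)"
  shows "\<exists>p :: real ^ 'm \<Rightarrow> real. harmonic l p \<and> p \<noteq> (\<lambda>x. 0)"
proof (induction l)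
  case 0
  have "harmonic 0 (\<lambda>x :: real ^ 'm. 1)"
    by (auto simp: harmonic_homogeneous_polynomial_def laplacian_eq_pd)
  then show ?case by (intro exI[of _ "\<lambda>x. 1"]) (auto simp: fun_eq_iff)
next
  case (Suc l)
  then obtain p :: "real ^ 'm \<Rightarrow> real" where p: "harmonic l p" "p \<noteq> (\<lambda>x. 0)" by blast
  then show ?case
    using harmonic_raise_degree[OF p(1) m, of undefined] raise_degree_inj[OF p(1) m, of undefined] by blast
qed

section \<open>Orthonormal bases of spherical harmonics\<close>

lemma sum_fun_apply: "(\<Sum>a\<in>A. f a) x = (\<Sum>a\<in>A. f a x)"
  for f :: "'b \<Rightarrow> 'c \<Rightarrow> 'd::comm_monoid_add"
  by (induction A rule: infinite_finite_induct) (auto simp: zero_fun_def plus_fun_def)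

lemma in_span_image_imp:
  fixes Y :: "'i \<Rightarrow> 'v::real_vector"
  assumes "v \<in> span (Y ` I)" "finite I"
  shows "\<exists>c. v = (\<Sum>i\<in>I. c i *\<^sub>R Y i)"
proof -
  let ?S = "{v. \<exists>c. v = (\<Sum>i\<in>I. c i *\<^sub>R Y i)}"
  have "subspace ?S"
  proof (rule subspaceI)
    show "0 \<in> ?S"
      by (auto intro!: exI[of _ "\<lambda>_. 0"])
    show "v + w \<in> ?S" if "v \<in> ?S" "w \<in> ?S" for v w
    proof -
      from that obtain a b where "v = (\<Sum>i\<in>I. a i *\<^sub>R Y i)" "w = (\<Sum>i\<in>I. b i *\<^sub>R Y i)" by auto
      then show ?thesis
        by (auto intro!: exI[of _ "\<lambda>i. a i + b i"] simp: scaleR_add_left sum.distrib)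
    qed
    show "r *\<^sub>R v \<in> ?S" if "v \<in> ?S" for r v
    proof -
      from that obtain a where "v = (\<Sum>i\<in>I. a i *\<^sub>R Y i)" by auto
      then show ?thesis
        by (auto intro!: exI[of _ "\<lambda>i. r * a i"] simp: scaleR_sum_right)
    qed
  qed
  moreover have "Y ` I \<subseteq> ?S"
  proof
    fix v assume "v \<in> Y ` I"
    then obtain i where i: "i \<in> I" "v = Y i" by auto
    have "v = (\<Sum>k\<in>I. (if k = i then 1 else 0) *\<^sub>R Y k)"
      using i assms(2) by (simp add: if_distrib[of "\<lambda>a. a *\<^sub>R _"] cong: if_cong)
    then show "v \<in> ?S" by (auto intro!: exI[of _ "\<lambda>k. if k = i then 1 else 0"])
  qed
  ultimately have "span (Y ` I) \<subseteq> ?S"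
    by (rule span_minimal[rotated])
  then show ?thesis using assms by auto
qed

lemma independent_image:
  fixes Y :: "'i \<Rightarrow> 'v::real_vector"
  assumes I: "finite I" and z: "\<And>c i. (\<Sum>i\<in>I. c i *\<^sub>R Y i) = 0 \<Longrightarrow> i \<in> I \<Longrightarrow> c i = 0"
  shows "inj_on Y I" and "independent (Y ` I)"
proof -
  show inj: "inj_on Y I"
  proof (rule inj_onI, rule ccontr)
    fix i j assume ij: "i \<in> I" "j \<in> I" "Y i = Y j" "i \<noteq> j"
    have "(\<Sum>k\<in>I. ((if k = i then 1 else 0) - (if k = j then 1 else 0)) *\<^sub>R Y k) = Y i - Y j"
      using ij I by (simp add: scaleR_diff_left sum_subtractf if_distrib[of "\<lambda>a. a *\<^sub>R _"] cong: if_cong)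
    then have "(if i = i then 1 else 0) - (if i = j then 1 else 0) = (0 :: real)"
      using ij by (intro z[where i = i]) auto
    then show False using ij by simp
  qed
  show "independent (Y ` I)"
  proof (rule independent_if_scalars_zero)
    fix f v assume s: "(\<Sum>v\<in>Y ` I. f v *\<^sub>R v) = 0" and "v \<in> Y ` I"
    then obtain i where i: "i \<in> I" "v = Y i" by auto
    have "(\<Sum>i\<in>I. f (Y i) *\<^sub>R Y i) = 0"
      using s by (simp add: sum.reindex[OF inj])
    then show "f v = 0" using z[where c = "\<lambda>i. f (Y i)"] i by blast
  qed (use I in simp)
qed

text \<open>An orthonormal basis of one degree made of polynomials on the whole space, so that
  differential operators apply to its members; functions extended by zero off the sphere would not
  allow this.\<close>

locale harmonic_frame =
  fixes l d :: nat and P :: "nat \<Rightarrow> real ^ 'm::finite \<Rightarrow> real"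
  assumes card: "2 \<le> CARD('m)"
    and harm: "\<And>i. i \<in> {1..d} \<Longrightarrow> harmonic l (P i)"
    and orth: "\<And>i j. i \<in> {1..d} \<Longrightarrow> j \<in> {1..d} \<Longrightarrow>
      (LINT x|sphere_measure. P i x * P j x) = (if i = j then 1 else 0)"
    and spanning: "\<And>p. harmonic l p \<Longrightarrow> \<exists>c. \<forall>x. p x = (\<Sum>i\<in>{1..d}. c i * P i x)"
begin

lemma poly: "i \<in> {1..d} \<Longrightarrow> real_polynomial_function (P i)"
  by (rule harmonic_polynomial[OF harm])

lemma integrable_product: "i \<in> {1..d} \<Longrightarrow> j \<in> {1..d} \<Longrightarrow> integrable sphere_measure (\<lambda>x. P i x * P j x)"
  by (intro integrable_sphere_polynomial polynomial_intros poly)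

lemma combination_coefficient:
  assumes j: "j \<in> {1..d}"
  shows "(LINT x|sphere_measure. (\<Sum>i\<in>{1..d}. c i * P i x) * P j x) = c j"
proof -
  have "(LINT x|sphere_measure. (\<Sum>i\<in>{1..d}. c i * P i x) * P j x) =
      (LINT x|sphere_measure. (\<Sum>i\<in>{1..d}. c i * (P i x * P j x)))"
    by (simp add: sum_distrib_right mult.assoc)
  also have "\<dots> = (\<Sum>i\<in>{1..d}. c i * (LINT x|sphere_measure. P i x * P j x))"
    using j integrable_product by (subst Bochner_Integration.integral_sum) auto
  also have "\<dots> = (\<Sum>i\<in>{1..d}. if i = j then c i else 0)"
    using j orth by (intro sum.cong) auto
  also have "\<dots> = c j" using j by simp
  finally show ?thesis .
qed

lemma expansion:
  assumes "harmonic l p"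
  shows "p x = (\<Sum>j\<in>{1..d}. (LINT x|sphere_measure. p x * P j x) * P j x)"
proof -
  obtain c where c: "\<And>x. p x = (\<Sum>i\<in>{1..d}. c i * P i x)" using spanning[OF assms] by blast
  then have "(LINT x|sphere_measure. p x * P j x) = c j" if "j \<in> {1..d}" for j
    using combination_coefficient[OF that, of c] by simp
  then show ?thesis unfolding c by (intro sum.cong) auto
qed

text \<open>The diagonal of the reproducing kernel of H_l.\<close>

definition kernel :: "real ^ 'm \<Rightarrow> real"
  where "kernel x = (\<Sum>i\<in>{1..d}. (P i x)\<^sup>2)"

lemma kernel_polynomial: "real_polynomial_function kernel"
  unfolding kernel_def[abs_def] power2_eq_square by (intro polynomial_intros poly) auto

text \<open>In an orthonormal frame the operator \<open>rot_deriv j k\<close> has a skew-symmetric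
  matrix, whose quadratic form vanishes at the vector of values P_i x.\<close>

lemma kernel_skew: "(\<Sum>i\<in>{1..d}. P i x * rot_deriv j k (P i) x) = 0"
proof (cases "j = k")
  case False
  define A where "A i i' = (LINT x|sphere_measure. rot_deriv j k (P i) x * P i' x)" for i i'
  have skew: "A i i' = - A i' i" if "i \<in> {1..d}" "i' \<in> {1..d}" for i i'
    using rot_deriv_skew[OF poly[OF that(1)] poly[OF that(2)] False]
    by (simp add: A_def mult.commute)
  have "(\<Sum>i\<in>{1..d}. P i x * rot_deriv j k (P i) x) =
      (\<Sum>i\<in>{1..d}. P i x * (\<Sum>i'\<in>{1..d}. A i i' * P i' x))"
    unfolding A_def by (intro sum.cong arg_cong2[where f = "(*)"] expansion harmonic_rot_deriv harm refl)
  also have "\<dots> = (\<Sum>i\<in>{1..d}. \<Sum>i'\<in>{1..d}. A i i' * (P i x * P i' x))"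
    by (simp add: sum_distrib_left mult_ac)
  finally have eq: "(\<Sum>i\<in>{1..d}. P i x * rot_deriv j k (P i) x) =
      (\<Sum>i\<in>{1..d}. \<Sum>i'\<in>{1..d}. A i i' * (P i x * P i' x))" .
  also have "\<dots> = (\<Sum>i\<in>{1..d}. \<Sum>i'\<in>{1..d}. A i' i * (P i' x * P i x))"
    by (rule sum.swap)
  also have "\<dots> = - (\<Sum>i\<in>{1..d}. \<Sum>i'\<in>{1..d}. A i i' * (P i x * P i' x))"
    unfolding sum_negf[symmetric]
  proof (intro sum.cong refl)
    fix i i' assume "i \<in> {1..d}" "i' \<in> {1..d}"
    then show "A i' i * (P i' x * P i x) = - (A i i' * (P i x * P i' x))"
      using skew[of i i'] by simp
  qed
  finally show ?thesis unfolding eq by linarith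
qed simp

lemma rot_deriv_kernel: "rot_deriv j k kernel x = 0"
proof -
  have "kernel = (\<lambda>x. \<Sum>i\<in>{1..d}. P i x * P i x)"
    by (simp add: kernel_def fun_eq_iff power2_eq_square)
  then have "rot_deriv j k kernel = rot_deriv j k (\<lambda>x. \<Sum>i\<in>{1..d}. P i x * P i x)"
    by (rule arg_cong)
  also have "\<dots> = (\<lambda>x. \<Sum>i\<in>{1..d}. rot_deriv j k (\<lambda>x. P i x * P i x) x)"
    by (rule rot_deriv_sum) (auto intro!: polynomial_intros poly)
  finally have "rot_deriv j k kernel x = (\<Sum>i\<in>{1..d}. rot_deriv j k (\<lambda>x. P i x * P i x) x)"
    by (rule fun_cong)
  also have "\<dots> = (\<Sum>i\<in>{1..d}. 2 * (P i x * rot_deriv j k (P i) x))"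
    using poly by (intro sum.cong) (auto simp: rot_deriv_mult)
  also have "\<dots> = 0"
    by (simp only: sum_distrib_left[symmetric] kernel_skew)
  finally show ?thesis .
qed

text \<open>The kernel is annihilated by all infinitesimal rotations, so it is constant on the
  sphere; integrating it counts the d normalized frame members.\<close>

lemma kernel_constant: "\<And>x. norm x = 1 \<Longrightarrow> kernel x = real d / measure (sphere_measure :: (real ^ 'm) measure) UNIV"
proof -
  let ?V = "measure (sphere_measure :: (real ^ 'm) measure) UNIV"
  obtain c where c: "\<And>x. norm x = 1 \<Longrightarrow> kernel x = c"
    using constant_on_sphere_of_rot_deriv_eq_0[OF kernel_polynomial card rot_deriv_kernel] by blast
  have "(LINT x|sphere_measure. kernel x) = (LINT x|(sphere_measure :: (real ^ 'm) measure). c)"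
  proof (rule integral_cong_AE)
    show "AE x in sphere_measure. kernel x = c"
      using AE_sphere_measure by eventually_elim (rule c, simp)
  qed (use real_polynomial_function_measurable[OF kernel_polynomial] in auto)
  also have "\<dots> = c * ?V" by simp
  also have "(LINT x|sphere_measure. kernel x) = (\<Sum>i\<in>{1..d}. LINT x|sphere_measure. P i x * P i x)"
    unfolding kernel_def power2_eq_square
    using integrable_product by (subst Bochner_Integration.integral_sum) auto
  also have "\<dots> = real d" using orth by simp
  finally have "c = real d / ?V"
    using measure_sphere_measure_pos[where 'm = 'm] by (simp add: field_simps)
  then show "\<And>x. norm x = 1 \<Longrightarrow> kernel x = real d / ?V" using c by simp
qed

text \<open>Applying \<open>rot_deriv j k\<close> once more to the identity
  \<open>kernel_skew\<close> trades the squares for - P_i times the second infinitesimal rotation of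
  P_i, and the Casimir identity sums these.\<close>

lemma sum_rot_deriv_kernel:
  "(\<Sum>j\<in>UNIV. \<Sum>k\<in>UNIV. \<Sum>i\<in>{1..d}. (rot_deriv j k (P i) x)\<^sup>2) = casimir CARD('m) l * kernel x"
proof -
  have *: "(\<Sum>i\<in>{1..d}. (rot_deriv j k (P i) x)\<^sup>2) =
      - (\<Sum>i\<in>{1..d}. P i x * rot_deriv j k (rot_deriv j k (P i)) x)" for j k
  proof -
    have "(\<lambda>x. \<Sum>i\<in>{1..d}. P i x * rot_deriv j k (P i) x) = (\<lambda>x. 0)"
      by (rule ext) (rule kernel_skew)
    then have "0 = rot_deriv j k (\<lambda>x. \<Sum>i\<in>{1..d}. P i x * rot_deriv j k (P i) x) x"
      by (simp add: rot_deriv_def)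
    also have "\<dots> = (\<Sum>i\<in>{1..d}. rot_deriv j k (\<lambda>x. P i x * rot_deriv j k (P i) x) x)"
      using poly by (subst rot_deriv_sum) (auto intro!: polynomial_intros)
    also have "\<dots> = (\<Sum>i\<in>{1..d}. (rot_deriv j k (P i) x)\<^sup>2 + P i x * rot_deriv j k (rot_deriv j k (P i)) x)"
      using poly by (intro sum.cong) (auto simp: rot_deriv_mult power2_eq_square)
    finally show ?thesis by (simp add: sum.distrib)
  qed
  have "(\<Sum>j\<in>UNIV. \<Sum>k\<in>UNIV. \<Sum>i\<in>{1..d}. (rot_deriv j k (P i) x)\<^sup>2) =
      - (\<Sum>j\<in>UNIV. \<Sum>k\<in>UNIV. \<Sum>i\<in>{1..d}. P i x * rot_deriv j k (rot_deriv j k (P i)) x)"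
    unfolding * by (simp only: sum_negf)
  also have "(\<Sum>j\<in>UNIV. \<Sum>k\<in>UNIV. \<Sum>i\<in>{1..d}. P i x * rot_deriv j k (rot_deriv j k (P i)) x) =
      (\<Sum>j\<in>UNIV. \<Sum>i\<in>{1..d}. \<Sum>k\<in>UNIV. P i x * rot_deriv j k (rot_deriv j k (P i)) x)"
    by (rule sum.cong[OF refl], rule sum.swap)
  also have "\<dots> = (\<Sum>i\<in>{1..d}. \<Sum>j\<in>UNIV. \<Sum>k\<in>UNIV. P i x * rot_deriv j k (rot_deriv j k (P i)) x)"
    by (rule sum.swap)
  also have "\<dots> = (\<Sum>i\<in>{1..d}. P i x * (\<Sum>j\<in>UNIV. \<Sum>k\<in>UNIV. rot_deriv j k (rot_deriv j k (P i)) x))"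
    by (simp only: sum_distrib_left)
  also have "\<dots> = (\<Sum>i\<in>{1..d}. - casimir CARD('m) l * (P i x)\<^sup>2)"
  proof (rule sum.cong[OF refl])
    fix i assume "i \<in> {1..d}"
    then show "P i x * (\<Sum>j\<in>UNIV. \<Sum>k\<in>UNIV. rot_deriv j k (rot_deriv j k (P i)) x) =
        - casimir CARD('m) l * (P i x)\<^sup>2"
      using sum_rot_deriv_squared[OF harm, of i x] by (simp add: power2_eq_square)
  qed
  also have "\<dots> = - casimir CARD('m) l * kernel x"
    unfolding kernel_def by (simp only: sum_distrib_left)
  finally show ?thesis by simp
qed

lemma sqint_P: "i \<in> {1..d} \<Longrightarrow> sqint (P i) = 1"
  using orth[of i i] by (simp add: sqint_def power2_eq_square)

lemma sum_sqint_frame: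
  "(\<Sum>i\<in>{1..d}. \<Sum>j\<in>UNIV. \<Sum>k\<in>UNIV. sqint (rot_deriv j k (P i))) = casimir CARD('m) l * real d"
proof -
  have "(\<Sum>i\<in>{1..d}. \<Sum>j\<in>UNIV. \<Sum>k\<in>UNIV. sqint (rot_deriv j k (P i))) = (\<Sum>i\<in>{1..d}. casimir CARD('m) l)"
    by (rule sum.cong[OF refl]) (simp only: sum_sqint_rot_deriv[OF harm] sqint_P mult_1_right)
  then show ?thesis by (simp add: mult.commute)
qed

lemma dim_pos: "0 < d"
proof (rule ccontr)
  assume "\<not> 0 < d"
  obtain p :: "real ^ 'm \<Rightarrow> real" where "harmonic l p" "p \<noteq> (\<lambda>x. 0)"
    using ex_nonzero_harmonic[OF card] by blast
  then show False
    using \<open>\<not> 0 < d\<close> expansion[of p] by (auto simp: fun_eq_iff)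
qed

end

text \<open>Raising twice embeds H_l into H_(l+2). Two steps are taken because the degrees in
  \<open>degree_range\<close> all have the same parity.\<close>

lemma frame_dim_mono:
  fixes P P' :: "nat \<Rightarrow> real ^ 'm::finite \<Rightarrow> real"
  assumes "harmonic_frame l d P" and "harmonic_frame (l + 2) d' P'"
  shows "d \<le> d'"
proof -
  interpret P: harmonic_frame l d P by fact
  interpret P': harmonic_frame "l + 2" d' P' by fact
  define e where "e = (undefined :: 'm)"
  let ?T = "\<lambda>p. raise_degree e (Suc l) (raise_degree e l p)"
  define R where "R i = ?T (P i)" for i
  have harm_T: "harmonic (l + 2) (?T p)" if "harmonic l p" for p
    using harmonic_raise_degree[OF harmonic_raise_degree[OF that P.card] P.card] by simp
  have inj_T: "p = (\<lambda>x. 0)" if "harmonic l p" "?T p = (\<lambda>x. 0)" for p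
    using raise_degree_inj[OF harmonic_raise_degree[OF that(1) P.card] P.card that(2)]
    by (rule raise_degree_inj[OF that(1) P.card])
  have zero: "c i = 0" if z: "(\<Sum>i\<in>{1..d}. c i *\<^sub>R R i) = 0" and i: "i \<in> {1..d}" for c i
  proof -
    let ?p = "\<lambda>x. \<Sum>i\<in>{1..d}. c i * P i x"
    have hp: "harmonic l ?p"
      by (rule harmonic_sum) (auto intro: P.harm)
    have "?T ?p = (\<lambda>x. \<Sum>i\<in>{1..d}. c i * R i x)"
      unfolding R_def
      by (subst raise_degree_sum, simp, rule P.poly, simp, subst raise_degree_sum)
        (auto intro!: harmonic_polynomial[OF harmonic_raise_degree[OF P.harm P.card]])
    also have "\<dots> = (\<lambda>x. 0)"
      using z by (auto simp: fun_eq_iff sum_fun_apply scaleR_fun_def)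
    finally have "?p = (\<lambda>x. 0)" by (rule inj_T[OF hp])
    then have p0: "\<And>x. ?p x = 0" by (rule fun_cong)
    show "c i = 0"
      using P.combination_coefficient[OF i, of c] unfolding p0 by simp
  qed
  have inj: "inj_on R {1..d}"
    by (rule independent_image(1)) (auto intro: zero)
  have ind: "independent (R ` {1..d})"
    by (rule independent_image(2)) (auto intro: zero)
  have "R ` {1..d} \<subseteq> span (P' ` {1..d'})"
  proof
    fix r assume "r \<in> R ` {1..d}"
    then obtain i where i: "i \<in> {1..d}" "r = R i" by auto
    then have "harmonic (l + 2) r" using harm_T P.harm by (simp add: R_def)
    then obtain c where c: "\<And>x. r x = (\<Sum>i\<in>{1..d'}. c i * P' i x)"
      using P'.spanning by blast
    have "r = (\<Sum>i\<in>{1..d'}. c i *\<^sub>R P' i)"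
      by (auto simp: fun_eq_iff c sum_fun_apply scaleR_fun_def)
    also have "\<dots> \<in> span (P' ` {1..d'})"
      by (intro span_sum span_scale span_base) auto
    finally show "r \<in> span (P' ` {1..d'})" .
  qed
  then have "card (R ` {1..d}) \<le> card (P' ` {1..d'})"
    using independent_span_bound[OF _ ind] by simp
  also have "\<dots> \<le> d'" using card_image_le[of "{1..d'}" P'] by simp
  also have "card (R ` {1..d}) = d" using card_image[OF inj] by simp
  finally show ?thesis .
qed

text \<open>Linear relations hold a priori only on the sphere. They extend to the whole space
  because all members are harmonic and homogeneous of the same degree.\<close>

lemma orthonormal_basis_frame:
  fixes Y :: "nat \<Rightarrow> real ^ 'm::finite \<Rightarrow> real"
  assumes m: "2 \<le> CARD('m)"
    and Y: "orthonormal_basis (spherical_harmonics l) Y"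
  shows "\<exists>P. harmonic_frame l (dim (spherical_harmonics l :: (real ^ 'm \<Rightarrow> real) set)) P \<and>
    (\<forall>i\<in>{1..dim (spherical_harmonics l :: (real ^ 'm \<Rightarrow> real) set)}. Y i = sphere_restrict (P i))"
proof -
  define d where "d = dim (spherical_harmonics l :: (real ^ 'm \<Rightarrow> real) set)"
  have on: "\<And>i j. i \<in> {1..d} \<Longrightarrow> j \<in> {1..d} \<Longrightarrow> sphere_inner (Y i) (Y j) = (if i = j then 1 else 0)"
    and sp: "span (Y ` {1..d}) = spherical_harmonics l"
    using Y by (auto simp: orthonormal_basis_def d_def)
  have "\<exists>p. harmonic l p \<and> Y i = sphere_restrict p" if "i \<in> {1..d}" for i
  proof -
    have "Y i \<in> spherical_harmonics l"
      unfolding sp[symmetric] using that by (intro span_base) auto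
    then show ?thesis by (auto simp: spherical_harmonics_def)
  qed
  then obtain P where P: "\<And>i. i \<in> {1..d} \<Longrightarrow> harmonic l (P i) \<and> Y i = sphere_restrict (P i)"
    by metis
  have "harmonic_frame l d P"
  proof
    show "2 \<le> CARD('m)" by fact
    show "harmonic l (P i)" if "i \<in> {1..d}" for i using P that by blast
    show "(LINT x|sphere_measure. P i x * P j x) = (if i = j then 1 else 0)"
      if ij: "i \<in> {1..d}" "j \<in> {1..d}" for i j
    proof -
      have pi: "real_polynomial_function (\<lambda>x. P i x * P j x)"
        using P ij harmonic_polynomial by (intro polynomial_intros) blast+
      have Ym: "Y k \<in> borel_measurable borel" if "k \<in> {1..d}" for k
      proof -
        have "P k \<in> borel_measurable borel" "sphere 0 1 \<in> sets (borel :: (real^'m) measure)"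
          using P[OF that] by (auto intro!: real_polynomial_function_measurable harmonic_polynomial borel_closed)
        then have "(\<lambda>x. if x \<in> sphere 0 1 then P k x else 0) \<in> borel_measurable borel"
          by (intro measurable_If_set) auto
        then show ?thesis using P[OF that] by (simp add: sphere_restrict_def)
      qed
      have "(LINT x|sphere_measure. P i x * P j x) = (LINT x|sphere_measure. Y i x * Y j x)"
      proof (rule integral_cong_AE)
        show "AE x in sphere_measure. P i x * P j x = Y i x * Y j x"
          using AE_sphere_measure by eventually_elim (use P ij in \<open>simp add: sphere_restrict_def\<close>)
      qed (use real_polynomial_function_measurable[OF pi] Ym ij in auto)
      then show ?thesis using on[OF ij] by (simp add: sphere_inner_def)
    qed
    show "\<exists>c. \<forall>x. p x = (\<Sum>i\<in>{1..d}. c i * P i x)" if hp: "harmonic l p" for p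
    proof -
      have "sphere_restrict p \<in> span (Y ` {1..d})"
        unfolding sp using hp by (auto simp: spherical_harmonics_def)
      then obtain c where c: "sphere_restrict p = (\<Sum>i\<in>{1..d}. c i *\<^sub>R Y i)"
        using in_span_image_imp[of _ Y "{1..d}"] by blast
      have on_sphere: "p x = (\<Sum>i\<in>{1..d}. c i * P i x)" if "norm x = 1" for x
      proof -
        have "p x = sphere_restrict p x" using that by (simp add: sphere_restrict_def)
        also have "\<dots> = (\<Sum>i\<in>{1..d}. c i * Y i x)"
          unfolding c by (simp add: sum_fun_apply scaleR_fun_def)
        also have "\<dots> = (\<Sum>i\<in>{1..d}. c i * P i x)"
          using P that by (intro sum.cong) (auto simp: sphere_restrict_def)
        finally show ?thesis .
      qed
      have "harmonic l (\<lambda>x. p x + (- 1) * (\<Sum>i\<in>{1..d}. c i * P i x))"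
        by (intro harmonic_add harmonic_cmult harmonic_sum hp) (use P in auto)
      then have "(\<lambda>x. p x + (- 1) * (\<Sum>i\<in>{1..d}. c i * P i x)) = (\<lambda>x. 0)"
        by (rule homogeneous_eq_0_of_sphere) (simp add: on_sphere)
      then have "\<forall>x. p x = (\<Sum>i\<in>{1..d}. c i * P i x)"
        by (simp add: fun_eq_iff)
      then show ?thesis by blast
    qed
  qed
  then show ?thesis using P unfolding d_def by blast
qed

section \<open>The ensemble of all degrees in the range\<close>

lemma finite_degree_range [simp]: "finite (degree_range \<alpha> d)"
  by (rule finite_subset[of _ "{..d}"]) (auto simp: degree_range_def)

lemma degree_in_degree_range:
  assumes "0 \<le> \<alpha>" "\<alpha> \<le> 1"
  shows "d \<in> degree_range \<alpha> d"
proof -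
  have "\<alpha> * real d \<le> real d" using assms by (simp add: mult_left_le_one_le)
  then show ?thesis by (simp add: degree_range_def floor_le_iff)
qed

text \<open>Each degree l below d / 2 is paired injectively with d - l + d mod 2 above d / 2. As d -
  l is even, the correction d mod 2 restores the parity of d, and the partner is reached from l in
  steps of two.\<close>

lemma sum_upper_half_ge:
  fixes D :: "nat \<Rightarrow> nat"
  assumes mono: "\<And>l. l \<in> degree_range \<alpha> d \<Longrightarrow> l + 2 \<in> degree_range \<alpha> d \<Longrightarrow> D l \<le> D (l + 2)"
  shows "(\<Sum>l\<in>degree_range \<alpha> d. real (D l)) \<le> 2 * (\<Sum>l\<in>{l \<in> degree_range \<alpha> d. d \<le> 2 * l}. real (D l))"
proof -
  let ?L = "degree_range \<alpha> d"
  let ?lo = "{l \<in> ?L. 2 * l < d}" and ?hi = "{l \<in> ?L. d \<le> 2 * l}"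
  let ?f = "\<lambda>l. d - l + d mod 2"
  have step: "D l \<le> D (l + 2 * k)" if "l \<in> ?L" "l + 2 * k \<le> d" for l k
    using that(2)
  proof (induction k)
    case (Suc k)
    have "l + 2 * k \<in> ?L" "l + 2 * k + 2 \<in> ?L"
      using that(1) Suc.prems by (auto simp: degree_range_def)
    then have "D (l + 2 * k) \<le> D (l + 2 * k + 2)" by (rule mono)
    moreover have "D l \<le> D (l + 2 * k)" using Suc by simp
    ultimately show ?case by simp
  qed simp
  have lo: "?f l \<in> ?hi \<and> D l \<le> D (?f l)" if "l \<in> ?lo" for l
  proof -
    have l: "l \<in> ?L" "2 * l < d" "l \<le> d" "even (d - l)" using that by (auto simp: degree_range_def)
    obtain a where a: "d - l = 2 * a" using l(4) by (elim dvdE)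
    define r b where "r = l mod 2" and "b = l div 2"
    have lb: "l = 2 * b + r" by (simp add: r_def b_def)
    have r: "r \<le> 1" by (simp add: r_def)
    have dl: "d = 2 * a + 2 * b + r" using a l(3) lb by simp
    have "d mod 2 = r" unfolding dl using r by presburger
    then have f: "?f l = 2 * a + r" using dl lb by simp
    have ba: "b \<le> a" using l(2) dl lb by linarith
    have "l + 2 * (a - b) = 2 * a + r" using ba lb by simp
    moreover have "2 * a + r \<le> d" using dl by simp
    moreover have "d \<le> 2 * (2 * a + r)" using ba dl by simp
    moreover have "l \<le> 2 * a + r" using ba lb by simp
    moreover have "d - (2 * a + r) = 2 * b" using dl by simp
    ultimately have ge: "l + 2 * (a - b) = ?f l" "?f l \<le> d" "d \<le> 2 * ?f l" "l \<le> ?f l" "d - ?f l = 2 * b"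
      by (simp_all only: f)
    have "even (d - ?f l)" using ge(5) by simp
    then have "?f l \<in> ?L"
      using l(1) ge(2,4) by (auto simp: degree_range_def)
    moreover have "D l \<le> D (?f l)"
      using step[OF l(1), of "a - b"] ge(1,2) by simp
    ultimately show ?thesis using ge by simp
  qed
  have inj: "inj_on ?f ?lo"
    by (auto simp: inj_on_def)
  have "(\<Sum>l\<in>?lo. real (D l)) \<le> (\<Sum>l\<in>?lo. real (D (?f l)))"
    using lo by (intro sum_mono) auto
  also have "\<dots> = (\<Sum>l\<in>?f ` ?lo. real (D l))"
    using sum.reindex[OF inj, of "\<lambda>l. real (D l)"] by simp
  also have "\<dots> \<le> (\<Sum>l\<in>?hi. real (D l))"
    using lo by (intro sum_mono2) (auto simp: finite_subset[OF _ finite_degree_range])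
  finally have "(\<Sum>l\<in>?lo. real (D l)) \<le> (\<Sum>l\<in>?hi. real (D l))" .
  moreover have "(\<Sum>l\<in>?L. real (D l)) = (\<Sum>l\<in>?lo. real (D l)) + (\<Sum>l\<in>?hi. real (D l))"
    by (subst sum.union_disjoint[symmetric]) (auto intro!: sum.cong)
  ultimately show ?thesis by simp
qed

section \<open>Variances and increments summed over the degrees\<close>

locale harmonic_ensemble =
  fixes \<alpha> :: real and d :: nat and D :: "nat \<Rightarrow> nat" and P :: "nat \<Rightarrow> nat \<Rightarrow> real ^ 'm::finite \<Rightarrow> real"
  assumes \<alpha>: "0 \<le> \<alpha>" "\<alpha> \<le> 1" and d_pos: "1 \<le> d" and card: "2 \<le> CARD('m)"
    and frame: "\<And>l. l \<in> degree_range \<alpha> d \<Longrightarrow> harmonic_frame l (D l) (P l)"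
begin

definition idx :: "(nat \<times> nat) set"
  where "idx = (SIGMA l:degree_range \<alpha> d. {1..D l})"

definition Q :: "nat \<times> nat \<Rightarrow> real ^ 'm \<Rightarrow> real"
  where "Q = (\<lambda>(l, i). P l i)"

definition \<kappa> :: real
  where "\<kappa> = (\<Sum>l\<in>degree_range \<alpha> d. real (D l)) / measure (sphere_measure :: (real ^ 'm) measure) UNIV"

lemma finite_idx [simp]: "finite idx"
  by (simp add: idx_def)

lemma sum_idx: "(\<Sum>a\<in>idx. g (Q a)) = (\<Sum>l\<in>degree_range \<alpha> d. \<Sum>i\<in>{1..D l}. g (P l i))"
  unfolding idx_def Q_def by (subst sum.Sigma) (auto simp: case_prod_unfold)

lemma Q_polynomial [intro, simp]: "a \<in> idx \<Longrightarrow> real_polynomial_function (Q a)"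
  using harmonic_frame.poly[OF frame] by (auto simp: idx_def Q_def)

lemma sum_dim_pos: "0 < (\<Sum>l\<in>degree_range \<alpha> d. real (D l))"
proof -
  have "d \<in> degree_range \<alpha> d" by (rule degree_in_degree_range[OF \<alpha>])
  then show ?thesis
    using harmonic_frame.dim_pos[OF frame] by (intro sum_pos) auto
qed

lemma \<kappa>_pos: "0 < \<kappa>"
  using sum_dim_pos measure_sphere_measure_pos[where 'm = 'm] by (simp add: \<kappa>_def)

lemma casimir_le: "l \<in> degree_range \<alpha> d \<Longrightarrow> casimir CARD('m) l \<le> 2 * real CARD('m) * (real d)\<^sup>2"
proof -
  assume "l \<in> degree_range \<alpha> d"
  then have l: "real l \<le> real d" by (simp add: degree_range_def)
  have "1 \<le> real d" using d_pos by simp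
  moreover have "2 \<le> real CARD('m)" using card by linarith
  \<comment> \<open>Expanded, this says d + m - 1 \<le> m d.\<close>
  ultimately have "0 \<le> (real CARD('m) - 1) * (real d - 1)" by simp
  then have "real l + real CARD('m) - 2 \<le> real CARD('m) * real d"
    using l by (simp add: algebra_simps)
  moreover have "0 \<le> real l + real CARD('m) - 2" using card by linarith
  ultimately have "real l * (real l + real CARD('m) - 2) \<le> real d * (real CARD('m) * real d)"
    using l by (intro mult_mono) auto
  then have "casimir CARD('m) l \<le> 2 * (real d * (real CARD('m) * real d))"
    by (rule mult_left_mono) simp
  then show ?thesis by (simp only: power2_eq_square mult_ac)
qed

lemma sum_Q_squared: "norm x = 1 \<Longrightarrow> (\<Sum>a\<in>idx. (Q a x)\<^sup>2) = \<kappa>"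
proof -
  assume x: "norm x = 1"
  have "(\<Sum>a\<in>idx. (Q a x)\<^sup>2) = (\<Sum>l\<in>degree_range \<alpha> d. harmonic_frame.kernel (D l) (P l) x)"
    unfolding sum_idx[where g = "\<lambda>p. (p x)\<^sup>2"]
    by (intro sum.cong refl) (simp add: harmonic_frame.kernel_def[OF frame])
  also have "\<dots> = \<kappa>"
    unfolding \<kappa>_def sum_divide_distrib
    by (intro sum.cong refl harmonic_frame.kernel_constant[OF frame] x)
  finally show ?thesis .
qed

lemma sum_Q_rot_deriv: "(\<Sum>a\<in>idx. Q a x * rot_deriv j k (Q a) x) = 0"
  unfolding sum_idx[where g = "\<lambda>p. p x * rot_deriv j k p x"]
  by (intro sum.neutral ballI harmonic_frame.kernel_skew[OF frame])

lemma sum_rot_deriv_Q_squared_le: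
  assumes x: "norm x = 1"
  shows "(\<Sum>a\<in>idx. (rot_deriv j k (Q a) x)\<^sup>2) \<le> 2 * real CARD('m) * (real d)\<^sup>2 * \<kappa>"
proof -
  have "(\<Sum>a\<in>idx. (rot_deriv j k (Q a) x)\<^sup>2) =
      (\<Sum>l\<in>degree_range \<alpha> d. \<Sum>i\<in>{1..D l}. (rot_deriv j k (P l i) x)\<^sup>2)"
    by (rule sum_idx)
  also have "\<dots> \<le> (\<Sum>l\<in>degree_range \<alpha> d. 2 * real CARD('m) * (real d)\<^sup>2 *
      (real (D l) / measure (sphere_measure :: (real ^ 'm) measure) UNIV))"
  proof (rule sum_mono)
    fix l assume l: "l \<in> degree_range \<alpha> d"
    interpret harmonic_frame l "D l" "P l" by (rule frame[OF l])
    have "(\<Sum>i\<in>{1..D l}. (rot_deriv j k (P l i) x)\<^sup>2) \<le> (\<Sum>k\<in>UNIV. \<Sum>i\<in>{1..D l}. (rot_deriv j k (P l i) x)\<^sup>2)"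
      by (rule member_le_sum[of k UNIV "\<lambda>k. \<Sum>i\<in>{1..D l}. (rot_deriv j k (P l i) x)\<^sup>2"])
        (auto intro: sum_nonneg)
    also have "\<dots> \<le> (\<Sum>j\<in>UNIV. \<Sum>k\<in>UNIV. \<Sum>i\<in>{1..D l}. (rot_deriv j k (P l i) x)\<^sup>2)"
      by (rule member_le_sum[of j UNIV "\<lambda>j. \<Sum>k\<in>UNIV. \<Sum>i\<in>{1..D l}. (rot_deriv j k (P l i) x)\<^sup>2"])
        (auto intro!: sum_nonneg)
    also have "\<dots> = casimir CARD('m) l * kernel x"
      by (rule sum_rot_deriv_kernel)
    also have "\<dots> \<le> 2 * real CARD('m) * (real d)\<^sup>2 * kernel x"
      by (rule mult_right_mono[OF casimir_le[OF l]]) (simp add: kernel_def sum_nonneg)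
    also have "kernel x = real (D l) / measure (sphere_measure :: (real ^ 'm) measure) UNIV"
      by (rule kernel_constant[OF x])
    finally show "(\<Sum>i\<in>{1..D l}. (rot_deriv j k (P l i) x)\<^sup>2) \<le> 2 * real CARD('m) * (real d)\<^sup>2 *
      (real (D l) / measure (sphere_measure :: (real ^ 'm) measure) UNIV)" .
  qed
  also have "\<dots> = 2 * real CARD('m) * (real d)\<^sup>2 * \<kappa>"
    by (simp only: \<kappa>_def sum_distrib_left[symmetric] sum_divide_distrib)
  finally show ?thesis .
qed

text \<open>Degrees l \<ge> d / 2 have Casimir value at least 2 l^2 \<ge> d^2 / 2, and they carry at
  least half of the total dimension.\<close>

lemma sum_casimir_ge:
  "(real d)\<^sup>2 / 4 * (\<Sum>l\<in>degree_range \<alpha> d. real (D l)) \<le>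
    (\<Sum>l\<in>degree_range \<alpha> d. casimir CARD('m) l * real (D l))"
proof -
  let ?hi = "{l \<in> degree_range \<alpha> d. d \<le> 2 * l}"
  have "(\<Sum>l\<in>degree_range \<alpha> d. real (D l)) \<le> 2 * (\<Sum>l\<in>?hi. real (D l))"
    by (rule sum_upper_half_ge) (rule frame_dim_mono[OF frame frame])
  then have "(real d)\<^sup>2 / 4 * (\<Sum>l\<in>degree_range \<alpha> d. real (D l)) \<le> (real d)\<^sup>2 / 4 * (2 * (\<Sum>l\<in>?hi. real (D l)))"
    by (intro mult_left_mono) auto
  also have "\<dots> = (\<Sum>l\<in>?hi. (real d)\<^sup>2 / 2 * real (D l))"
    by (simp add: sum_distrib_left mult.commute)
  also have "\<dots> \<le> (\<Sum>l\<in>?hi. casimir CARD('m) l * real (D l))"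
  proof (intro sum_mono mult_right_mono)
    fix l assume "l \<in> ?hi"
    then have l: "real d \<le> 2 * real l" by simp
    have "real d * real d \<le> (2 * real l) * (2 * real l)"
      using l by (intro mult_mono) auto
    moreover have "real l * real l \<le> real l * (real l + real CARD('m) - 2)"
      using card by (intro mult_left_mono) auto
    ultimately show "(real d)\<^sup>2 / 2 \<le> casimir CARD('m) l"
      by (simp add: power2_eq_square)
  qed simp
  also have "\<dots> \<le> (\<Sum>l\<in>degree_range \<alpha> d. casimir CARD('m) l * real (D l))"
    using card by (intro sum_mono2) auto
  finally show ?thesis .
qed

text \<open>Pigeonhole over the m^2 ordered pairs. Diagonal pairs contribute 0 while the claimed
  share is positive, so the pair found is a genuine plane.\<close>

lemma ex_good_rotation:
  "\<exists>j k. j \<noteq> k \<and> (\<Sum>l\<in>degree_range \<alpha> d. real (D l)) * (real d)\<^sup>2 / (4 * (real CARD('m))\<^sup>2) \<le>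
    (\<Sum>a\<in>idx. sqint (rot_deriv j k (Q a)))"
proof (rule ccontr)
  let ?N = "\<Sum>l\<in>degree_range \<alpha> d. real (D l)"
  let ?b = "?N * (real d)\<^sup>2 / (4 * (real CARD('m))\<^sup>2)"
  let ?s = "\<lambda>j k. \<Sum>a\<in>idx. sqint (rot_deriv j k (Q a))"
  assume "\<not> ?thesis"
  then have lt: "?s j k < ?b" if "j \<noteq> k" for j k using that by (auto simp: not_le)
  have b: "0 < ?b" using sum_dim_pos d_pos card by simp
  have lt': "?s j k < ?b" for j k
  proof (cases "j = k")
    case True
    then show ?thesis using b by (simp add: sqint_def)
  qed (rule lt)
  have "(\<Sum>l\<in>degree_range \<alpha> d. casimir CARD('m) l * real (D l)) =
      (\<Sum>l\<in>degree_range \<alpha> d. \<Sum>i\<in>{1..D l}. \<Sum>j\<in>UNIV. \<Sum>k\<in>UNIV. sqint (rot_deriv j k (P l i)))"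
    by (intro sum.cong refl harmonic_frame.sum_sqint_frame[OF frame, symmetric])
  also have "\<dots> = (\<Sum>a\<in>idx. \<Sum>j\<in>UNIV. \<Sum>k\<in>UNIV. sqint (rot_deriv j k (Q a)))"
    by (rule sum_idx[symmetric])
  also have "\<dots> = (\<Sum>j\<in>UNIV. \<Sum>a\<in>idx. \<Sum>k\<in>UNIV. sqint (rot_deriv j k (Q a)))"
    by (rule sum.swap)
  also have "\<dots> = (\<Sum>j\<in>UNIV. \<Sum>k\<in>UNIV. ?s j k)"
    by (rule sum.cong[OF refl], rule sum.swap)
  also have "\<dots> < (\<Sum>j\<in>(UNIV::'m set). \<Sum>k\<in>(UNIV::'m set). ?b)"
    by (intro sum_strict_mono lt') auto
  also have "\<dots> = (real d)\<^sup>2 / 4 * ?N"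
    using card by (simp add: power2_eq_square)
  finally show False using sum_casimir_ge by linarith
qed

text \<open>The angle 1 / (2 m^2 d) makes the fourth-order loss one third of the second-order gain:
  per unit of dimension 1 / (16 m^6) - 1 / (48 m^6) = 1 / (24 m^6). The plane may vary with d and
  the frame, the bound does not.\<close>

lemma rot_increment_ge:
  obtains j k where "j \<noteq> k"
    "(\<Sum>l\<in>degree_range \<alpha> d. real (D l)) / (24 * real CARD('m) ^ 6) \<le>
      (\<Sum>a\<in>idx. LINT x|sphere_measure. (Q a (rot j k (1 / (2 * (real CARD('m))\<^sup>2 * real d)) x) - Q a x)\<^sup>2)"
proof -
  let ?N = "\<Sum>l\<in>degree_range \<alpha> d. real (D l)"
  let ?m = "real CARD('m)"
  let ?t = "1 / (2 * ?m\<^sup>2 * real d)"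
  obtain j k where jk: "j \<noteq> k" and b: "?N * (real d)\<^sup>2 / (4 * ?m\<^sup>2) \<le> (\<Sum>a\<in>idx. sqint (rot_deriv j k (Q a)))"
    using ex_good_rotation by blast
  have one: "?t\<^sup>2 * sqint (rot_deriv j k (Q a)) - ?t ^ 4 * (2 * ?m * (real d)\<^sup>2)\<^sup>2 / 12 \<le>
      (LINT x|sphere_measure. (Q a (rot j k ?t x) - Q a x)\<^sup>2)" if a: "a \<in> idx" for a
  proof -
    obtain l i where li: "a = (l, i)" "l \<in> degree_range \<alpha> d" "i \<in> {1..D l}"
      using a by (auto simp: idx_def)
    interpret harmonic_frame l "D l" "P l" by (rule frame[OF li(2)])
    have c0: "0 \<le> casimir CARD('m) l" using card by (rule casimir_nonneg)
    have "(casimir CARD('m) l)\<^sup>2 \<le> (2 * ?m * (real d)\<^sup>2)\<^sup>2"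
      by (intro power_mono casimir_le li c0)
    then have "?t ^ 4 * (casimir CARD('m) l)\<^sup>2 * 1 / 12 \<le> ?t ^ 4 * (2 * ?m * (real d)\<^sup>2)\<^sup>2 / 12"
      unfolding mult_1_right by (intro divide_right_mono mult_left_mono) auto
    then show ?thesis
      using rot_difference_lower_bound[OF harm[OF li(3)] jk card, of ?t] sqint_P[OF li(3)]
      unfolding li(1) Q_def by simp
  qed
  have cardN: "real (card idx) = ?N"
    unfolding idx_def by simp
  have arith: "?N / (24 * ?m ^ 6) \<le> ?t\<^sup>2 * (?N * (real d)\<^sup>2 / (4 * ?m\<^sup>2)) - ?N * (?t ^ 4 * (2 * ?m * (real d)\<^sup>2)\<^sup>2 / 12)"
  proof -
    have "1 / (24 * m ^ 6) \<le> (1 / (2 * m\<^sup>2 * r))\<^sup>2 * (r\<^sup>2 / (4 * m\<^sup>2)) - (1 / (2 * m\<^sup>2 * r)) ^ 4 * (2 * m * r\<^sup>2)\<^sup>2 / 12"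
      if "m > 0" "r > 0" for m r :: real
    proof -
      have "(1 / (2 * m\<^sup>2 * r))\<^sup>2 * (r\<^sup>2 / (4 * m\<^sup>2)) = 1 / (16 * m ^ 6)"
        using that by (simp add: field_simps power2_eq_square eval_nat_numeral)
      moreover have "(1 / (2 * m\<^sup>2 * r)) ^ 4 * (2 * m * r\<^sup>2)\<^sup>2 / 12 = 1 / (48 * m ^ 6)"
        using that by (simp add: field_simps power2_eq_square eval_nat_numeral)
      moreover have "1 / (16 * m ^ 6) - 1 / (48 * m ^ 6) = 1 / (24 * m ^ 6)"
        using that by (simp add: field_simps)
      ultimately show ?thesis by simp
    qed
    from this[of ?m "real d"] d_pos card
    have "1 / (24 * ?m ^ 6) \<le> ?t\<^sup>2 * ((real d)\<^sup>2 / (4 * ?m\<^sup>2)) - ?t ^ 4 * (2 * ?m * (real d)\<^sup>2)\<^sup>2 / 12"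
      by linarith
    from mult_left_mono[OF this, of ?N] sum_dim_pos show ?thesis
      by (simp add: right_diff_distrib mult.left_commute)
  qed
  also have "\<dots> \<le> ?t\<^sup>2 * (\<Sum>a\<in>idx. sqint (rot_deriv j k (Q a))) - ?N * (?t ^ 4 * (2 * ?m * (real d)\<^sup>2)\<^sup>2 / 12)"
    by (intro diff_right_mono mult_left_mono b) auto
  also have "\<dots> = (\<Sum>a\<in>idx. ?t\<^sup>2 * sqint (rot_deriv j k (Q a)) - ?t ^ 4 * (2 * ?m * (real d)\<^sup>2)\<^sup>2 / 12)"
    by (simp only: sum_subtractf sum_distrib_left sum_constant cardN)
  also have "\<dots> \<le> (\<Sum>a\<in>idx. LINT x|sphere_measure. (Q a (rot j k ?t x) - Q a x)\<^sup>2)"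
    by (intro sum_mono one)
  finally show ?thesis using jk that by blast
qed

end

section \<open>Taylor expansion on the sphere\<close>

lemma poly_taylor_remainder:
  fixes p :: "real ^ 'm::finite \<Rightarrow> real"
  assumes p: "real_polynomial_function p"
  shows "\<exists>C\<ge>0. \<forall>x y. norm x = 1 \<longrightarrow> norm y = 1 \<longrightarrow>
    \<bar>p y - p x - (\<Sum>i\<in>UNIV. (y - x) $ i * pd i p x)\<bar> \<le> C * (norm (y - x))\<^sup>2"
proof -
  \<comment> \<open>Radius 3 suffices: the intermediate point is x + t (y - x) with |t| \<le> 1,
    where t may be negative, and |y - x| \<le> 2.\<close>
  have "\<exists>B. \<forall>i j. \<forall>z\<in>cball 0 3. \<bar>pd i (pd j p) z\<bar> \<le> B"
  proof -
    have "\<exists>B. \<forall>z\<in>cball 0 3. \<bar>pd i (pd j p) z\<bar> \<le> B" for i j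
    proof -
      have "compact (pd i (pd j p) ` cball 0 3)"
        using p by (intro compact_continuous_image continuous_on_real_polynomial_function) auto
      then show ?thesis
        by (meson bounded_real compact_imp_bounded imageI)
    qed
    then obtain B where B: "\<And>i j z. z \<in> cball 0 3 \<Longrightarrow> \<bar>pd i (pd j p) z\<bar> \<le> B i j"
      by metis
    have "\<bar>pd i (pd j p) z\<bar> \<le> (\<Sum>i\<in>UNIV. \<Sum>j\<in>UNIV. \<bar>B i j\<bar>)" if "z \<in> cball 0 3" for i j z
    proof -
      have "\<bar>pd i (pd j p) z\<bar> \<le> \<bar>B i j\<bar>" using B[OF that, of i j] by linarith
      also have "\<dots> \<le> (\<Sum>j\<in>UNIV. \<bar>B i j\<bar>)" by (rule member_le_sum) auto
      also have "\<dots> \<le> (\<Sum>i\<in>UNIV. \<Sum>j\<in>UNIV. \<bar>B i j\<bar>)"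
        by (rule member_le_sum[of i UNIV "\<lambda>i. \<Sum>j\<in>UNIV. \<bar>B i j\<bar>"]) (auto intro!: sum_nonneg)
      finally show ?thesis .
    qed
    then show ?thesis by blast
  qed
  then obtain B where B: "\<And>i j z. z \<in> cball 0 3 \<Longrightarrow> \<bar>pd i (pd j p) z\<bar> \<le> B" by blast
  have B0: "0 \<le> B" using B[of 0] by (auto intro: order_trans[OF abs_ge_zero])
  have "\<bar>p y - p x - (\<Sum>i\<in>UNIV. (y - x) $ i * pd i p x)\<bar> \<le> (real CARD('m))\<^sup>2 * B * (norm (y - x))\<^sup>2"
    if xy: "norm x = 1" "norm y = 1" for x y :: "real ^ 'm"
  proof -
    define v where "v = y - x"
    define Dv where "Dv = (\<lambda>(q :: real ^ 'm \<Rightarrow> real) z. \<Sum>i\<in>UNIV. v $ i * pd i q z)"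
    have poly_Dv: "real_polynomial_function (Dv q)" if "real_polynomial_function q" for q
      unfolding Dv_def using that by (intro polynomial_intros) auto
    have poly: "real_polynomial_function ((Dv ^^ n) p)" for n
      by (induction n) (auto intro: p poly_Dv)
    let ?diff = "\<lambda>n t. (Dv ^^ n) p (x + t *\<^sub>R v)"
    have "DERIV (?diff n) t :> ?diff (Suc n) t" for n t
    proof -
      have "((\<lambda>t. x + t *\<^sub>R v) has_vector_derivative v) (at t)"
        by (auto intro!: derivative_eq_intros simp: has_vector_derivative_def)
      from real_polynomial_function_along_curve[OF poly this] show ?thesis
        by (simp add: Dv_def)
    qed
    then obtain t where t: "\<bar>t\<bar> \<le> \<bar>1 :: real\<bar>"
      "?diff 0 1 = (\<Sum>n<2. (?diff n 0 / fact n) * 1 ^ n) + (?diff 2 t / fact 2) * 1 ^ 2"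
      using Maclaurin_all_le[where n = 2 and x = 1 and diff = ?diff, OF refl] by blast
    have nv: "norm v \<le> 2" using xy norm_triangle_ineq4[of y x] by (simp add: v_def)
    have "norm (x + t *\<^sub>R v) \<le> norm x + \<bar>t\<bar> * norm v"
      using norm_triangle_ineq[of x "t *\<^sub>R v"] by simp
    also have "\<dots> \<le> 1 + 1 * 2" using xy t nv by (intro add_mono mult_mono) auto
    finally have z: "x + t *\<^sub>R v \<in> cball 0 3" by simp
    have "p y = p x + Dv p x + Dv (Dv p) (x + t *\<^sub>R v) / 2"
      using t(2) by (simp add: numeral_2_eq_2 v_def)
    then have "\<bar>p y - p x - Dv p x\<bar> = \<bar>Dv (Dv p) (x + t *\<^sub>R v)\<bar> / 2" by simp
    also have "\<dots> \<le> \<bar>Dv (Dv p) (x + t *\<^sub>R v)\<bar>" by simp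
    also have "Dv (Dv p) (x + t *\<^sub>R v) = (\<Sum>i\<in>UNIV. \<Sum>j\<in>UNIV. v $ i * (v $ j * pd i (pd j p) (x + t *\<^sub>R v)))"
    proof -
      have "pd i (\<lambda>z. \<Sum>j\<in>UNIV. v $ j * pd j p z) = (\<lambda>z. \<Sum>j\<in>UNIV. v $ j * pd i (pd j p) z)" for i
        using p by (subst pd_sum) (auto simp: pd_cmult intro!: polynomial_intros)
      then show ?thesis by (simp add: Dv_def sum_distrib_left)
    qed
    also have "\<bar>\<dots>\<bar> \<le> (\<Sum>i\<in>UNIV. \<Sum>j\<in>UNIV. \<bar>v $ i * (v $ j * pd i (pd j p) (x + t *\<^sub>R v))\<bar>)"
      by (rule order_trans[OF sum_abs sum_mono[OF sum_abs]])
    also have "\<dots> \<le> (\<Sum>i\<in>(UNIV :: 'm set). \<Sum>j\<in>(UNIV :: 'm set). norm v * (norm v * B))"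
      unfolding abs_mult
      by (intro sum_mono mult_mono B z component_le_norm_cart mult_nonneg_nonneg) auto
    also have "\<dots> = (real CARD('m))\<^sup>2 * B * (norm (y - x))\<^sup>2"
      by (simp add: v_def power2_eq_square mult_ac)
    finally show ?thesis by (simp add: Dv_def v_def)
  qed
  then show ?thesis using B0 by (intro exI[of _ "(real CARD('m))\<^sup>2 * B"]) auto
qed

text \<open>Between unit vectors the normal component of y - x is - |y - x|^2 / 2. The radial
  derivative is therefore absorbed by the quadratic remainder, and only infinitesimal rotations
  remain at first order.\<close>

lemma sphere_taylor_remainder:
  fixes p :: "real ^ 'm::finite \<Rightarrow> real"
  assumes p: "real_polynomial_function p"
  shows "\<exists>C\<ge>0. \<forall>x y. norm x = 1 \<longrightarrow> norm y = 1 \<longrightarrow>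
    \<bar>p y - p x - tangent_deriv p x (y - x)\<bar> \<le> C * (norm (y - x))\<^sup>2"
proof -
  obtain C where C: "C \<ge> 0" "\<And>x y. norm x = 1 \<Longrightarrow> norm y = 1 \<Longrightarrow>
    \<bar>p y - p x - (\<Sum>i\<in>UNIV. (y - x) $ i * pd i p x)\<bar> \<le> C * (norm (y - x))\<^sup>2"
    using poly_taylor_remainder[OF p] by blast
  have "real_polynomial_function (\<lambda>x. \<Sum>j\<in>UNIV. x $ j * pd j p x)"
    using p by (intro polynomial_intros) auto
  then obtain E where E: "0 \<le> E" "\<And>x. norm x = 1 \<Longrightarrow> \<bar>\<Sum>j\<in>UNIV. x $ j * pd j p x\<bar> \<le> E"
    using bounded_on_sphere_polynomial by blast
  have "\<bar>p y - p x - tangent_deriv p x (y - x)\<bar> \<le> (C + E) * (norm (y - x))\<^sup>2"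
    if xy: "norm x = 1" "norm y = 1" for x y
  proof -
    have ip: "(y - x) \<bullet> x = - (norm (y - x))\<^sup>2 / 2"
      using xy by (simp add: power2_norm_eq_inner inner_diff_left inner_diff_right inner_commute norm_eq_1)
    have "p y - p x - tangent_deriv p x (y - x) =
        (p y - p x - (\<Sum>i\<in>UNIV. (y - x) $ i * pd i p x)) + ((y - x) \<bullet> x) * (\<Sum>j\<in>UNIV. x $ j * pd j p x)"
      unfolding tangent_deriv_eq[OF xy(1)] by simp
    also have "\<bar>\<dots>\<bar> \<le> C * (norm (y - x))\<^sup>2 + (norm (y - x))\<^sup>2 / 2 * E"
      unfolding ip by (rule order_trans[OF abs_triangle_ineq add_mono[OF C(2)[OF xy]]])
        (auto simp: abs_mult intro!: mult_left_mono E xy)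
    also have "\<dots> \<le> C * (norm (y - x))\<^sup>2 + (norm (y - x))\<^sup>2 * E"
      using E(1) by (intro add_left_mono mult_right_mono) auto
    finally show ?thesis by (simp add: algebra_simps)
  qed
  then show ?thesis using C(1) E(1) by (intro exI[of _ "C + E"]) auto
qed

section \<open>Nets on the sphere\<close>

text \<open>Halving moves both bases into [0, 1], where the m-th power is Lipschitz with constant
  m.\<close>

lemma power_diff_le:
  fixes h :: real
  assumes "0 \<le> h" "h \<le> 1"
  shows "(1 + h) ^ m - (1 - h) ^ m \<le> 2 ^ m * (real m * h)"
proof -
  have "norm (((1 + h) / 2) ^ m - ((1 - h) / 2) ^ m) \<le> real m * norm ((1 + h) / 2 - (1 - h) / 2)"
    using assms by (intro norm_power_diff) auto
  also have "(1 + h) / 2 - (1 - h) / 2 = h" by (simp add: field_simps)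
  finally have "((1 + h) / 2) ^ m - ((1 - h) / 2) ^ m \<le> real m * h"
    using assms by simp
  then have "2 ^ m * (((1 + h) / 2) ^ m - ((1 - h) / 2) ^ m) \<le> 2 ^ m * (real m * h)"
    by (intro mult_left_mono) auto
  then show ?thesis
    by (simp add: power_divide right_diff_distrib)
qed

text \<open>Disjoint balls of radius h = \<delta> / 2 lie in a shell of thickness 2 h, whose volume
  is of order h. One power of h cancels, which leaves the exponent m - 1.\<close>

lemma separated_card_le:
  fixes A :: "(real ^ 'm::finite) set"
  assumes A: "finite A" "A \<subseteq> sphere 0 1" and sep: "\<And>x y. x \<in> A \<Longrightarrow> y \<in> A \<Longrightarrow> x \<noteq> y \<Longrightarrow> \<delta> < dist x y"
    and \<delta>: "0 < \<delta>" "\<delta> \<le> 1"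
  shows "real (card A) * \<delta> ^ (CARD('m) - 1) \<le> 4 ^ CARD('m) * real CARD('m)"
proof -
  define h where "h = \<delta> / 2"
  have h: "0 < h" "h \<le> 1" using \<delta> by (auto simp: h_def)
  let ?m = "CARD('m)" and ?v = "unit_ball_vol (real CARD('m))"
  have v: "?v > 0" by (rule unit_ball_vol_pos) simp
  have fin: "emeasure lborel (cball (0 :: real ^ 'm) (1 + h)) < \<infinity>" by (rule emeasure_lborel_cball_finite)
  have meas: "cball (0 :: real ^ 'm) r \<in> fmeasurable lborel" "ball (0 :: real ^ 'm) r \<in> fmeasurable lborel" for r
    by (auto intro!: fmeasurableI emeasure_lborel_cball_finite emeasure_lborel_ball_finite)
  have finb: "emeasure lborel (ball a h) \<noteq> \<infinity>" for a :: "real ^ 'm"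
    using emeasure_lborel_ball_finite[of a h] by auto
  have "real (card A) * (?v * h ^ ?m) = (\<Sum>a\<in>A. measure lborel (ball a h))"
    using h by (simp add: content_ball)
  also have "\<dots> = measure lborel (\<Union>a\<in>A. ball a h)"
  proof (rule measure_finite_Union[symmetric])
    show "disjoint_family_on (\<lambda>a. ball a h) A"
      unfolding disjoint_family_on_def
    proof (intro ballI impI)
      fix a b assume ab: "a \<in> A" "b \<in> A" "a \<noteq> b"
      show "ball a h \<inter> ball b h = {}"
      proof (rule ccontr)
        assume "ball a h \<inter> ball b h \<noteq> {}"
        then obtain z where "dist a z < h" "dist b z < h" by auto
        then have "dist a b < 2 * h" using dist_triangle2[of a b z] by linarith
        then show False using sep[OF ab] by (simp add: h_def)
      qed
    qed
  qed (use A finb in auto)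
  also have "\<dots> \<le> measure lborel (cball (0 :: real ^ 'm) (1 + h) - ball 0 (1 - h))"
  proof (rule measure_mono_fmeasurable)
    show "(\<Union>a\<in>A. ball a h) \<subseteq> cball 0 (1 + h) - ball 0 (1 - h)"
    proof
      fix z assume "z \<in> (\<Union>a\<in>A. ball a h)"
      then obtain a where a: "a \<in> A" "dist a z < h" by auto
      then have "norm a = 1" using A by auto
      moreover have "norm (a - z) < h" using a by (simp add: dist_norm)
      ultimately have "\<bar>1 - norm z\<bar> < h"
        using norm_triangle_ineq3[of a z] by simp
      then show "z \<in> cball 0 (1 + h) - ball 0 (1 - h)" by auto
    qed
    show "(\<Union>a\<in>A. ball a h) \<in> sets lborel" using A by auto
    show "cball (0 :: real ^ 'm) (1 + h) - ball 0 (1 - h) \<in> fmeasurable lborel"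
      by (intro fmeasurable.Diff meas)
  qed
  also have "\<dots> = measure lborel (cball (0 :: real ^ 'm) (1 + h)) - measure lborel (ball (0 :: real ^ 'm) (1 - h))"
    using h by (intro measure_Diff) (auto simp: less_imp_neq[OF fin[unfolded infinity_ennreal_def]])
  also have "\<dots> = ?v * ((1 + h) ^ ?m - (1 - h) ^ ?m)"
    using h by (simp add: content_ball content_cball right_diff_distrib)
  also have "\<dots> \<le> ?v * (2 ^ ?m * (real ?m * h))"
    using h v by (intro mult_left_mono power_diff_le) auto
  finally have "?v * (real (card A) * h ^ ?m) \<le> ?v * (2 ^ ?m * (real ?m * h))"
    by (simp add: mult_ac)
  then have le: "real (card A) * h ^ ?m \<le> 2 ^ ?m * (real ?m * h)"
    using v by simp
  obtain k where k: "?m = Suc k" using not0_implies_Suc[of ?m] by auto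
  have "h * (real (card A) * h ^ k) \<le> h * (2 ^ ?m * real ?m)"
    using le by (simp add: k mult_ac)
  then have "real (card A) * h ^ k \<le> 2 ^ ?m * real ?m"
    using h by simp
  then have "2 ^ k * (real (card A) * h ^ k) \<le> 2 ^ k * (2 ^ ?m * real ?m)"
    by (intro mult_left_mono) auto
  also have "2 ^ k * (real (card A) * h ^ k) = real (card A) * \<delta> ^ k"
    by (simp add: h_def power_divide)
  also have "2 ^ k * (2 ^ ?m * real ?m) \<le> 2 ^ ?m * (2 ^ ?m * real ?m)"
    by (intro mult_right_mono) (auto simp: k)
  also have "\<dots> = 4 ^ ?m * real ?m"
    by (simp add: power_mult_distrib[symmetric] mult.assoc[symmetric])
  finally show ?thesis by (simp add: k)
qed

text \<open>A separated set of greatest cardinality is a net: an uncovered point could be added to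
  it.\<close>

lemma sphere_net:
  assumes \<delta>: "0 < \<delta>" "\<delta> \<le> 1"
  obtains N :: "(real ^ 'm::finite) set" where "finite N" "N \<subseteq> sphere 0 1"
    "sphere 0 1 \<subseteq> (\<Union>x\<in>N. cball x \<delta>)"
    "real (card N) * \<delta> ^ (CARD('m) - 1) \<le> 4 ^ CARD('m) * real CARD('m)"
proof -
  define sep where "sep A \<longleftrightarrow> finite A \<and> A \<subseteq> sphere 0 1 \<and> (\<forall>x\<in>A. \<forall>y\<in>A. x \<noteq> y \<longrightarrow> \<delta> < dist x y)"
    for A :: "(real ^ 'm) set"
  let ?b = "4 ^ CARD('m) * real CARD('m) / \<delta> ^ (CARD('m) - 1)"
  have bd: "card A \<le> nat \<lfloor>?b\<rfloor>" if "sep A" for A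
  proof -
    have "real (card A) * \<delta> ^ (CARD('m) - 1) \<le> 4 ^ CARD('m) * real CARD('m)"
      using that \<delta> by (intro separated_card_le) (auto simp: sep_def)
    then have "real (card A) \<le> ?b"
      using \<delta> by (simp add: pos_le_divide_eq)
    then show ?thesis by (simp add: le_nat_floor)
  qed
  have "sep {}" by (simp add: sep_def)
  then have "\<exists>N. sep N \<and> (\<forall>A. sep A \<longrightarrow> card A \<le> card N)"
    by (rule ex_has_greatest_nat[where b = "Suc (nat \<lfloor>?b\<rfloor>)"]) (use bd in \<open>simp add: less_Suc_eq_le\<close>)
  then obtain N where N: "sep N" and max: "\<And>A. sep A \<Longrightarrow> card A \<le> card N"
    by auto
  have fin: "finite N" "N \<subseteq> sphere 0 1" using N by (auto simp: sep_def)
  have "sphere 0 1 \<subseteq> (\<Union>x\<in>N. cball x \<delta>)"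
  proof (rule ccontr)
    assume "\<not> ?thesis"
    then obtain y where y: "y \<in> sphere 0 1" "\<And>x. x \<in> N \<Longrightarrow> \<delta> < dist x y"
      by (force simp: not_le)
    have "sep (insert y N)"
      using N \<delta> y by (auto simp: sep_def dist_commute)
    moreover have "y \<notin> N"
      using y(2)[of y] \<delta> by auto
    ultimately show False using max[of "insert y N"] fin by simp
  qed
  moreover have "real (card N) * \<delta> ^ (CARD('m) - 1) \<le> 4 ^ CARD('m) * real CARD('m)"
    using N \<delta> by (intro separated_card_le) (auto simp: sep_def)
  ultimately show ?thesis using fin that by blast
qed

section \<open>Bounding Hausdorff measure from above\<close>

lemma hausdorff_premeasure_le_finite_cover:
  fixes Z :: "'a::euclidean_space set"
  assumes N: "finite N" and cover: "Z \<subseteq> (\<Union>x\<in>N. cball x r)" and r: "0 \<le> r" "2 * r \<le> \<delta>"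
  shows "hausdorff_premeasure k \<delta> Z \<le>
    ennreal (unit_ball_vol (real k) * r ^ k) * of_nat (card {x \<in> N. cball x r \<inter> Z \<noteq> {}})"
proof -
  define A where "A = {x \<in> N. cball x r \<inter> Z \<noteq> {}}"
  have fin: "finite A" using N by (simp add: A_def)
  obtain e where e: "bij_betw e {0..<card A} A"
    using ex_bij_betw_nat_finite[OF fin] by blast
  \<comment> \<open>The definition asks for a sequence of sets; padding with the empty set adds
    weight 0.\<close>
  define U where "U i = (if i < card A then cball (e i) r else {})" for i
  have Zc: "Z \<subseteq> (\<Union>i. U i)"
  proof
    fix z assume z: "z \<in> Z"
    then obtain x where x: "x \<in> N" "z \<in> cball x r" using cover by auto
    then have "x \<in> A" using z by (auto simp: A_def)
    then obtain i where "i < card A" "e i = x"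
      using bij_betw_imp_surj_on[OF e] by (metis atLeastLessThan_iff imageE)
    then show "z \<in> (\<Union>i. U i)" using x by (auto simp: U_def)
  qed
  have UU: "bounded (U i) \<and> diameter (U i) \<le> \<delta>" for i
    using r by (auto simp: U_def diameter_cball)
  have "hausdorff_premeasure k \<delta> Z \<le> (\<Sum>i. hausdorff_weight k (U i))"
    unfolding hausdorff_premeasure_def using Zc UU by (intro INF_lower) auto
  also have "\<dots> = (\<Sum>i<card A. hausdorff_weight k (U i))"
    by (rule suminf_finite) (auto simp: U_def hausdorff_weight_def)
  also have "\<dots> = (\<Sum>i<card A. ennreal (unit_ball_vol (real k) * r ^ k))"
    using r by (intro sum.cong) (auto simp: U_def hausdorff_weight_def diameter_cball)
  also have "\<dots> = ennreal (unit_ball_vol (real k) * r ^ k) * of_nat (card A)"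
    by (simp add: mult.commute)
  finally show ?thesis by (simp add: A_def)
qed

text \<open>For each scale \<delta> the covers are eventually admissible, so the lower limit bounds
  every premeasure. The lower limit is what Fatou's lemma accepts.\<close>

lemma hausdorff_measure_le_liminf:
  fixes Z :: "'a::euclidean_space set"
  assumes N: "\<And>i. finite (N i)" and cover: "\<And>i. Z \<subseteq> (\<Union>x\<in>N i. cball x (r i))"
    and r: "\<And>i. 0 \<le> r i" "r \<longlonglongrightarrow> 0"
  shows "hausdorff_measure k Z \<le> liminf (\<lambda>i.
    ennreal (unit_ball_vol (real k) * r i ^ k) * of_nat (card {x \<in> N i. cball x (r i) \<inter> Z \<noteq> {}}))"
  unfolding hausdorff_measure_def
proof (rule SUP_least)
  fix \<delta> :: real assume "\<delta> \<in> {0<..}"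
  then have \<delta>: "0 < \<delta> / 2" by simp
  have "\<forall>\<^sub>F i in sequentially. hausdorff_premeasure k \<delta> Z \<le>
    ennreal (unit_ball_vol (real k) * r i ^ k) * of_nat (card {x \<in> N i. cball x (r i) \<inter> Z \<noteq> {}})"
    using order_tendstoD(2)[OF r(2) \<delta>]
  proof eventually_elim
    case (elim i)
    then show ?case
      by (intro hausdorff_premeasure_le_finite_cover N cover r) simp
  qed
  then show "hausdorff_premeasure k \<delta> Z \<le> liminf (\<lambda>i.
    ennreal (unit_ball_vol (real k) * r i ^ k) * of_nat (card {x \<in> N i. cball x (r i) \<inter> Z \<noteq> {}}))"
    by (rule Liminf_bounded)
qed

section \<open>Bounding Hausdorff measure from below by tubes\<close>

text \<open>The cone over the cap is covered by about 1 / r balls of radius 2 r centred along the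
  ray through y, of total volume of order r^m / r.\<close>

lemma sphere_measure_cball_le:
  fixes y :: "real ^ 'm::finite"
  assumes y: "norm y = 1" and r: "0 < r" "r \<le> 2"
  shows "emeasure sphere_measure (cball y r) \<le>
    ennreal (real CARD('m) * (5 * unit_ball_vol (real CARD('m)) * 2 ^ CARD('m)) * r ^ (CARD('m) - 1))"
proof -
  let ?m = "CARD('m)" and ?v = "unit_ball_vol (real CARD('m))"
  have v: "?v > 0" by (rule unit_ball_vol_pos) simp
  define K where "K = nat \<lfloor>1 / r\<rfloor>"
  have K: "real K \<le> 1 / r" using r by (simp add: K_def)
  have cov: "{x \<in> ball 0 1. sgn x \<in> cball y r} \<subseteq> (\<Union>k\<in>{..K}. cball ((real k * r) *\<^sub>R y) (2 * r))"
  proof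
    fix x assume "x \<in> {x \<in> ball 0 1. sgn x \<in> cball y r}"
    then have x: "norm x < 1" "dist y (sgn x) \<le> r" by auto
    define k where "k = nat \<lfloor>norm x / r\<rfloor>"
    have k: "real k \<le> norm x / r" "norm x / r < real k + 1"
      using r by (auto simp: k_def)
    have "k \<le> K"
      unfolding k_def K_def using x r by (intro nat_mono floor_mono divide_right_mono) auto
    have "\<bar>norm x - real k * r\<bar> \<le> r"
      using k r by (auto simp: field_simps abs_le_iff)
    have "x = norm x *\<^sub>R sgn x" by (cases "x = 0") (auto simp: sgn_div_norm)
    then have "x - (real k * r) *\<^sub>R y = norm x *\<^sub>R (sgn x - y) + (norm x - real k * r) *\<^sub>R y"
      by (simp add: algebra_simps)
    also have "norm \<dots> \<le> norm x * norm (sgn x - y) + \<bar>norm x - real k * r\<bar>"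
      using norm_triangle_ineq[of "norm x *\<^sub>R (sgn x - y)" "(norm x - real k * r) *\<^sub>R y"] y by simp
    also have "\<dots> \<le> 1 * r + r"
      using x \<open>\<bar>norm x - real k * r\<bar> \<le> r\<close>
      by (intro add_mono mult_mono) (auto simp: dist_norm norm_minus_commute)
    finally have "dist ((real k * r) *\<^sub>R y) x \<le> 2 * r"
      by (simp add: dist_norm norm_minus_commute)
    then show "x \<in> (\<Union>k\<in>{..K}. cball ((real k * r) *\<^sub>R y) (2 * r))"
      using \<open>k \<le> K\<close> by auto
  qed
  have "emeasure lborel {x \<in> ball 0 1. sgn x \<in> cball y r} \<le>
      emeasure lborel (\<Union>k\<in>{..K}. cball ((real k * r) *\<^sub>R y) (2 * r))"
    using cov by (rule emeasure_mono) auto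
  also have "\<dots> \<le> (\<Sum>k\<in>{..K}. emeasure lborel (cball ((real k * r) *\<^sub>R y) (2 * r)))"
    by (rule emeasure_subadditive_finite) auto
  also have "\<dots> = (\<Sum>k\<in>{..K}. ennreal (?v * (2 * r) ^ ?m))"
    using r by (simp add: emeasure_cball)
  also have "\<dots> = ennreal (real (Suc K) * (?v * (2 * r) ^ ?m))"
    using r v by (simp add: ennreal_of_nat_eq_real_of_nat ennreal_mult del: of_nat_Suc)
  also have "\<dots> \<le> ennreal ((5 / r) * (?v * (2 * r) ^ ?m))"
  proof (intro ennreal_leI mult_right_mono)
    \<comment> \<open>Since r \<le> 2, the extra ball is absorbed: K + 1 \<le> 1 / r + 2 /
      r.\<close>
    have "1 \<le> 2 / r" using r by simp
    then show "real (Suc K) \<le> 5 / r" using K by (simp add: field_simps)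
  qed (use r v in auto)
  also have "(5 / r) * (?v * (2 * r) ^ ?m) = 5 * ?v * 2 ^ ?m * r ^ (?m - 1)"
  proof -
    obtain k where k: "?m = Suc k" using not0_implies_Suc[of ?m] by auto
    show ?thesis using r by (simp add: k power_mult_distrib)
  qed
  finally have "of_nat ?m * emeasure lborel {x \<in> ball 0 1. sgn x \<in> cball y r} \<le>
      of_nat ?m * ennreal (5 * ?v * 2 ^ ?m * r ^ (?m - 1))"
    by (rule mult_left_mono) simp
  also have "\<dots> = ennreal (real ?m * (5 * ?v * 2 ^ ?m) * r ^ (?m - 1))"
    using r v by (simp add: ennreal_of_nat_eq_real_of_nat ennreal_mult[symmetric] mult.assoc)
  finally show ?thesis
    by (subst emeasure_sphere_measure) auto
qed

section \<open>Tubes swept out by rotations\<close>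

definition tube :: "'m \<Rightarrow> 'm \<Rightarrow> real \<Rightarrow> (real ^ 'm) set \<Rightarrow> (real ^ 'm) set"
  where "tube j k \<theta> U = (\<lambda>(t, u). rot j k (- t) u) ` ({0..\<theta>} \<times> U)"

lemma compact_tube:
  fixes U :: "(real ^ 'm::finite) set"
  assumes "compact U"
  shows "compact (tube j k \<theta> U)"
  unfolding tube_def
proof (rule compact_continuous_image)
  have "continuous_on X (\<lambda>z. rot j k (- fst z) (snd z) $ i)" for i and X :: "(real \<times> (real ^ 'm)) set"
    unfolding rot_nth by (cases "i = j"; cases "i = k") (auto intro!: continuous_intros)
  then show "continuous_on ({0..\<theta>} \<times> U) (\<lambda>(t, u). rot j k (- t) u)"
    by (subst continuous_on_componentwise) (auto simp: case_prod_unfold Basis_vec_def inner_axis)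
  show "compact ({0..\<theta>} \<times> U)"
    using assms by (intro compact_Times) auto
qed

text \<open>The factor 2 bounds the number of caps by 2 \<theta> / \<rho>, the bracket is the
  constant of \<open>sphere_measure_cball_le\<close>, and the power of 2 comes from caps of radius 2
  \<rho>.\<close>

definition tube_const :: "nat \<Rightarrow> real"
  where "tube_const m = 2 * (real m * (5 * unit_ball_vol (real m) * 2 ^ m)) * 2 ^ (m - 1)"

lemma tube_const_pos: "0 < m \<Longrightarrow> 0 < tube_const m"
  by (simp add: tube_const_def unit_ball_vol_pos)

text \<open>For \<rho> above the diameter of U, the orbit of one point of U is sampled at steps
  \<rho>. About \<theta> / \<rho> caps of radius 2 \<rho>, each of measure of order \<rho>^(m-1),
  then cover the tube.\<close>

lemma sphere_measure_tube_le:
  fixes U :: "(real ^ 'm::finite) set"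
  assumes jk: "j \<noteq> k" and m: "2 \<le> CARD('m)" and U: "U \<subseteq> sphere 0 1" "compact U" "diameter U < \<theta>" and \<theta>: "\<theta> \<le> 1"
    and ne: "U \<noteq> {}"
  shows "emeasure sphere_measure (tube j k \<theta> U) \<le> ennreal (tube_const CARD('m) * \<theta> * diameter U ^ (CARD('m) - 2))"
proof -
  let ?m = "CARD('m)"
  let ?c = "real ?m * (5 * unit_ball_vol (real ?m) * 2 ^ ?m)"
  have c: "0 < ?c" by (simp add: unit_ball_vol_pos)
  have bU: "bounded U" using U(2) by (rule compact_imp_bounded)
  have dU: "0 \<le> diameter U" using bU by (rule diameter_ge_0)
  obtain u0 where u0: "u0 \<in> U" using ne by auto
  have bound: "emeasure sphere_measure (tube j k \<theta> U) \<le> ennreal (tube_const ?m * \<theta> * \<rho> ^ (?m - 2))"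
    if \<rho>: "diameter U < \<rho>" "\<rho> \<le> \<theta>" for \<rho>
  proof -
    have \<rho>0: "0 < \<rho>" using \<rho> dU by linarith
    define K where "K = nat \<lfloor>\<theta> / \<rho>\<rfloor>"
    have K: "real K \<le> \<theta> / \<rho>" using \<rho>0 \<rho> by (simp add: K_def)
    have cov: "tube j k \<theta> U \<subseteq> (\<Union>i\<in>{..K}. cball (rot j k (- (real i * \<rho>)) u0) (2 * \<rho>))"
    proof
      fix y assume "y \<in> tube j k \<theta> U"
      then obtain t u where tu: "0 \<le> t" "t \<le> \<theta>" "u \<in> U" "y = rot j k (- t) u"
        by (auto simp: tube_def)
      define i where "i = nat \<lfloor>t / \<rho>\<rfloor>"
      have i: "real i \<le> t / \<rho>" "t / \<rho> < real i + 1"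
        using \<rho>0 tu by (auto simp: i_def)
      have iK: "i \<le> K"
        unfolding i_def K_def using tu \<rho>0 by (intro nat_mono floor_mono divide_right_mono) auto
      have ti: "\<bar>real i * \<rho> - t\<bar> \<le> \<rho>"
        using i \<rho>0 by (auto simp: field_simps abs_le_iff)
      have u1: "norm u = 1" using tu U by auto
      have "dist (rot j k (- (real i * \<rho>)) u0) y \<le>
          dist (rot j k (- (real i * \<rho>)) u0) (rot j k (- (real i * \<rho>)) u) + dist (rot j k (- (real i * \<rho>)) u) y"
        by (rule dist_triangle)
      also have "dist (rot j k (- (real i * \<rho>)) u0) (rot j k (- (real i * \<rho>)) u) = dist u0 u"
        using norm_rot[OF jk, of "- (real i * \<rho>)" "u0 - u"] by (simp add: dist_norm linear_diff[OF rot_linear])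
      also have "dist u0 u \<le> diameter U"
        by (rule diameter_bounded_bound[OF bU u0 tu(3)])
      also have "dist (rot j k (- (real i * \<rho>)) u) y \<le> \<bar>- (real i * \<rho>) - - t\<bar> * norm u"
        unfolding tu(4) by (rule dist_rot_le[OF jk])
      also have "\<dots> \<le> \<rho>" using ti u1 by (simp add: abs_minus_commute)
      finally have "dist (rot j k (- (real i * \<rho>)) u0) y \<le> 2 * \<rho>" using \<rho> by simp
      then show "y \<in> (\<Union>i\<in>{..K}. cball (rot j k (- (real i * \<rho>)) u0) (2 * \<rho>))" using iK by auto
    qed
    have "emeasure sphere_measure (tube j k \<theta> U) \<le>
        emeasure sphere_measure (\<Union>i\<in>{..K}. cball (rot j k (- (real i * \<rho>)) u0) (2 * \<rho>))"
      using cov by (rule emeasure_mono) auto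
    also have "\<dots> \<le> (\<Sum>i\<in>{..K}. emeasure sphere_measure (cball (rot j k (- (real i * \<rho>)) u0) (2 * \<rho>)))"
      by (rule emeasure_subadditive_finite) auto
    also have "\<dots> \<le> (\<Sum>i\<in>{..K}. ennreal (?c * (2 * \<rho>) ^ (?m - 1)))"
      using u0 U \<rho> \<rho>0 \<theta> jk by (intro sum_mono sphere_measure_cball_le) auto
    also have "\<dots> = ennreal (real (Suc K) * (?c * (2 * \<rho>) ^ (?m - 1)))"
      using \<rho>0 c by (simp add: ennreal_of_nat_eq_real_of_nat ennreal_mult del: of_nat_Suc)
    also have "\<dots> \<le> ennreal ((2 * \<theta> / \<rho>) * (?c * (2 * \<rho>) ^ (?m - 1)))"
    proof (intro ennreal_leI mult_right_mono)
      have "1 \<le> \<theta> / \<rho>" using \<rho> \<rho>0 by simp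
      then show "real (Suc K) \<le> 2 * \<theta> / \<rho>" using K by simp
    qed (use \<rho>0 c in auto)
    also have "(2 * \<theta> / \<rho>) * (?c * (2 * \<rho>) ^ (?m - 1)) = tube_const ?m * \<theta> * \<rho> ^ (?m - 2)"
    proof -
      obtain k where k: "?m = Suc (Suc k)" using m by (metis add_2_eq_Suc le_Suc_ex)
      show ?thesis using \<rho>0 by (simp add: k power_mult_distrib tube_const_def)
    qed
    finally show ?thesis .
  qed
  define e where "e = enn2real (emeasure sphere_measure (tube j k \<theta> U))"
  have e: "emeasure sphere_measure (tube j k \<theta> U) = ennreal e"
    unfolding e_def by (simp add: sphere_measure.emeasure_eq_measure)
  have \<theta>0: "0 < \<theta>" using dU U by linarith
  \<comment> \<open>The limit from above also reaches diameter 0, where the sampling step could not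
    be chosen equal to the diameter.\<close>
  have "e \<le> tube_const ?m * \<theta> * diameter U ^ (?m - 2)"
  proof (rule tendsto_lowerbound)
    show "((\<lambda>\<rho>. tube_const ?m * \<theta> * \<rho> ^ (?m - 2)) \<longlongrightarrow> tube_const ?m * \<theta> * diameter U ^ (?m - 2)) (at_right (diameter U))"
      by (intro tendsto_intros)
    show "\<forall>\<^sub>F \<rho> in at_right (diameter U). e \<le> tube_const ?m * \<theta> * \<rho> ^ (?m - 2)"
      unfolding eventually_at_right_field
    proof (intro exI[of _ \<theta>] conjI allI impI)
      fix \<rho> assume \<rho>: "diameter U < \<rho>" "\<rho> < \<theta>"
      have "0 \<le> tube_const ?m * \<theta> * \<rho> ^ (?m - 2)"
        using \<rho> dU \<theta>0 tube_const_pos[of ?m] by (intro mult_nonneg_nonneg) auto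
      then show "e \<le> tube_const ?m * \<theta> * \<rho> ^ (?m - 2)"
        using bound[of \<rho>] \<rho> by (simp add: e)
    qed (use U in auto)
  qed simp
  then show ?thesis unfolding e by (rule ennreal_leI)
qed

text \<open>Any cover of Z by small sets yields a cover of B by the tubes over them, and the surface
  measure of each tube is at most a fixed multiple of the Hausdorff weight of its base.\<close>

lemma hausdorff_measure_ge_tube:
  fixes Z B :: "(real ^ 'm::finite) set"
  assumes jk: "j \<noteq> k" and m: "2 \<le> CARD('m)" and \<theta>: "0 < \<theta>" "\<theta> \<le> 1"
    and Z: "Z \<subseteq> sphere 0 1" "closed Z" and B: "\<And>y. y \<in> B \<Longrightarrow> \<exists>t\<in>{0..\<theta>}. rot j k t y \<in> Z"
  shows "ennreal (unit_ball_vol (real (CARD('m) - 2)) / (2 ^ (CARD('m) - 2) * tube_const CARD('m) * \<theta>)) *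
      emeasure sphere_measure B \<le> hausdorff_measure (CARD('m) - 2) Z"
proof -
  let ?k = "CARD('m) - 2"
  let ?v = "unit_ball_vol (real ?k)"
  let ?c = "?v / (2 ^ ?k * tube_const CARD('m) * \<theta>)"
  have v: "0 < ?v" by (rule unit_ball_vol_pos) simp
  have tc: "0 < tube_const CARD('m)" by (rule tube_const_pos) simp
  have c: "0 < ?c" using v tc \<theta> by simp
  have compZ: "compact Z"
    using Z by (meson bounded_subset bounded_sphere compact_eq_bounded_closed)
  \<comment> \<open>The scale \<theta> / 2 gives the strict inequality between diameter and \<theta>
    that the tube bound asks for.\<close>
  have "ennreal ?c * emeasure sphere_measure B \<le> hausdorff_premeasure ?k (\<theta> / 2) Z"
    unfolding hausdorff_premeasure_def
  proof (rule INF_greatest)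
    fix U :: "nat \<Rightarrow> (real ^ 'm) set"
    assume "U \<in> {U. Z \<subseteq> (\<Union>i. U i) \<and> (\<forall>i. bounded (U i) \<and> diameter (U i) \<le> \<theta> / 2)}"
    then have U: "Z \<subseteq> (\<Union>i. U i)" "\<And>i. bounded (U i)" "\<And>i. diameter (U i) \<le> \<theta> / 2" by auto
    \<comment> \<open>Covering sets are arbitrary. The closure of their trace on Z is compact and
      lies on the sphere, so its tube is measurable, and its diameter is no larger.\<close>
    define V where "V i = closure (U i \<inter> Z)" for i
    have V: "compact (V i)" "V i \<subseteq> Z" "V i \<subseteq> sphere 0 1" for i
    proof -
      show "compact (V i)"
        unfolding V_def using U(2)[of i] by (meson bounded_Int compact_closure)
      show "V i \<subseteq> Z" unfolding V_def using Z by (intro closure_minimal) auto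
      then show "V i \<subseteq> sphere 0 1" using Z by auto
    qed
    have dV: "diameter (V i) \<le> diameter (U i)" for i
      unfolding V_def using U(2)[of i]
      by (subst diameter_closure) (auto intro: diameter_subset bounded_subset)
    have meas: "tube j k \<theta> (V i) \<in> sets borel" for i
      using compact_tube[OF V(1)] by (intro borel_compact)
    have "B \<subseteq> (\<Union>i. tube j k \<theta> (V i))"
    proof
      fix y assume "y \<in> B"
      then obtain t where t: "t \<in> {0..\<theta>}" "rot j k t y \<in> Z" using B by blast
      then obtain i where "rot j k t y \<in> U i" using U by auto
      then have "rot j k t y \<in> U i \<inter> Z" using t by simp
      then have "rot j k t y \<in> V i"
        unfolding V_def by (rule subsetD[OF closure_subset])
      moreover have "y = rot j k (- t) (rot j k t y)" using rot_add[OF jk, of "- t" t y] jk by simp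
      ultimately show "y \<in> (\<Union>i. tube j k \<theta> (V i))" using t by (force simp: tube_def)
    qed
    then have "emeasure sphere_measure B \<le> emeasure sphere_measure (\<Union>i. tube j k \<theta> (V i))"
    proof (rule emeasure_mono)
      show "(\<Union>i. tube j k \<theta> (V i)) \<in> sets sphere_measure"
        unfolding sets_sphere_measure by (rule sets.countable_UN') (use meas in auto)
    qed
    also have "\<dots> \<le> (\<Sum>i. emeasure sphere_measure (tube j k \<theta> (V i)))"
      using meas by (intro emeasure_subadditive_countably) auto
    finally have "ennreal ?c * emeasure sphere_measure B \<le> ennreal ?c * (\<Sum>i. emeasure sphere_measure (tube j k \<theta> (V i)))"
      by (rule mult_left_mono) simp
    also have "\<dots> = (\<Sum>i. ennreal ?c * emeasure sphere_measure (tube j k \<theta> (V i)))"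
      by simp
    also have "\<dots> \<le> (\<Sum>i. hausdorff_weight ?k (U i))"
    proof (intro suminf_le summableI)
      fix i
      show "ennreal ?c * emeasure sphere_measure (tube j k \<theta> (V i)) \<le> hausdorff_weight ?k (U i)"
      proof (cases "V i = {}")
        case True
        then show ?thesis by (simp add: tube_def)
      next
        case False
        then have Ui: "U i \<noteq> {}" by (auto simp: V_def)
        have d0: "0 \<le> diameter (V i)" using V(1)[of i] by (intro diameter_ge_0 compact_imp_bounded)
        have "ennreal ?c * emeasure sphere_measure (tube j k \<theta> (V i)) \<le>
            ennreal ?c * ennreal (tube_const CARD('m) * \<theta> * diameter (V i) ^ ?k)"
          using V dV[of i] U(3)[of i] \<theta> jk m False
          by (intro mult_left_mono sphere_measure_tube_le) auto
        also have "\<dots> = ennreal (?c * (tube_const CARD('m) * \<theta> * diameter (V i) ^ ?k))"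
          using c by (intro ennreal_mult'[symmetric]) auto
        also have "?c * (tube_const CARD('m) * \<theta> * diameter (V i) ^ ?k) = ?v * (diameter (V i) / 2) ^ ?k"
          using tc \<theta> by (simp add: power_divide)
        also have "ennreal \<dots> \<le> ennreal (?v * (diameter (U i) / 2) ^ ?k)"
          using v d0 dV[of i] by (intro ennreal_leI mult_left_mono power_mono divide_right_mono) auto
        finally show ?thesis using Ui by (simp add: hausdorff_weight_def)
      qed
    qed
    finally show "ennreal ?c * emeasure sphere_measure B \<le> (\<Sum>i. hausdorff_weight ?k (U i))" .
  qed
  also have "\<dots> \<le> hausdorff_measure ?k Z"
    unfolding hausdorff_measure_def using \<theta> by (intro SUP_upper) auto
  finally show ?thesis .
qed

section \<open>The random function and its zeros\<close>

lemma (in gaussian_family) comb_single: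
  assumes "i \<in> I"
  shows "comb (\<lambda>a. if a = i then 1 else 0) \<omega> = \<eta> i \<omega>"
    and "sqnorm (\<lambda>a. if a = i then 1 else 0) = 1"
  using assms finite_I
  by (simp_all add: comb_def sqnorm_def if_distrib[of "\<lambda>c. c * _"] if_distrib[of "\<lambda>c. c\<^sup>2"] cong: if_cong)

lemma (in gaussian_family) prob_abs_gt:
  assumes i: "i \<in> I" and u: "0 < u"
  shows "prob {\<omega>\<in>space M. u < \<bar>\<eta> i \<omega>\<bar>} \<le> 1 / u\<^sup>2"
proof -
  let ?c = "comb (\<lambda>a. if a = i then 1 else 0)"
  have c: "?c \<omega> = \<eta> i \<omega>" for \<omega> by (rule comb_single[OF i])
  have "prob {\<omega>\<in>space M. u < \<bar>\<eta> i \<omega>\<bar>} = expectation (indicator {\<omega>\<in>space M. u < \<bar>?c \<omega>\<bar>})"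
    by (simp add: c) (auto intro!: arg_cong[where f = prob])
  also have "\<dots> \<le> expectation (\<lambda>\<omega>. (?c \<omega>)\<^sup>2 / u\<^sup>2)"
  proof (rule integral_mono)
    show "integrable M (indicator {\<omega>\<in>space M. u < \<bar>?c \<omega>\<bar>} :: _ \<Rightarrow> real)"
      by (rule integrable_real_indicator) (auto simp: emeasure_eq_measure)
    show "integrable M (\<lambda>\<omega>. (?c \<omega>)\<^sup>2 / u\<^sup>2)"
      using integrable_comb_squared by simp
    fix \<omega>
    have "u\<^sup>2 \<le> (?c \<omega>)\<^sup>2" if "u < \<bar>?c \<omega>\<bar>"
      using that u by (subst abs_le_square_iff[symmetric]) simp
    then show "indicator {\<omega>\<in>space M. u < \<bar>?c \<omega>\<bar>} \<omega> \<le> (?c \<omega>)\<^sup>2 / u\<^sup>2"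
      using u by (auto split: split_indicator)
  qed
  also have "\<dots> = 1 / u\<^sup>2"
    using expectation_comb_squared[of "\<lambda>a. if a = i then 1 else 0"] comb_single(2)[OF i] by simp
  finally show ?thesis .
qed

text \<open>With V the area of the sphere: the constant of \<open>hausdorff_measure_ge_tube\<close>
  at \<theta> = 1 / (2 m^2 d), whose reciprocal supplies 2 m^2 and the factor d, times the expected
  measure of the set of sign changes.\<close>

definition lower_const :: "nat \<Rightarrow> real \<Rightarrow> real"
  where "lower_const m V = unit_ball_vol (real (m - 2)) / (2 ^ (m - 2) * tube_const m) *
    (2 * (real m)\<^sup>2) * ((std_normal_density 2)\<^sup>2 * V / (48 * real m ^ 6))"

text \<open>The weight of a unit ball, the size of a net, and a hitting probability per unit of
  radius: one term for each of the m^2 pairs, plus 1 for terms that vanish with the mesh.\<close>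

definition upper_const :: "nat \<Rightarrow> real"
  where "upper_const m = unit_ball_vol (real (m - 2)) * (4 ^ m * real m) *
    ((real m)\<^sup>2 * ((real m)\<^sup>2 * sqrt (2 * real m)) + 1)"

locale random_ensemble = harmonic_ensemble \<alpha> d D P +
    gaussian_family M "harmonic_ensemble.idx \<alpha> d D" \<eta>
  for \<alpha> :: real and d :: nat and D :: "nat \<Rightarrow> nat" and P :: "nat \<Rightarrow> nat \<Rightarrow> real ^ 'm::finite \<Rightarrow> real"
    and M :: "'w measure" and \<eta> :: "nat \<times> nat \<Rightarrow> 'w \<Rightarrow> real"
begin

definition F :: "'w \<Rightarrow> real ^ 'm \<Rightarrow> real"
  where "F \<omega> x = comb (\<lambda>a. Q a x) \<omega>"

lemma F_eq: "F \<omega> x = (\<Sum>a\<in>idx. Q a x * \<eta> a \<omega>)"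
  by (simp add: F_def comb_def)

lemma F_polynomial: "real_polynomial_function (F \<omega>)"
  unfolding F_eq[abs_def] by (intro polynomial_intros Q_polynomial) auto

lemma sqnorm_Q: "norm x = 1 \<Longrightarrow> sqnorm (\<lambda>a. Q a x) = \<kappa>"
  unfolding sqnorm_def by (rule sum_Q_squared)

lemma Q_measurable [measurable]: "a \<in> idx \<Longrightarrow> Q a \<in> borel_measurable borel"
  by (intro real_polynomial_function_measurable Q_polynomial)

lemma F_measurable:
  assumes [measurable]: "g \<in> borel_measurable borel"
  shows "(\<lambda>(\<omega>, y). F \<omega> (g y)) \<in> borel_measurable (M \<Otimes>\<^sub>M sphere_measure)"
proof -
  have "(\<lambda>z. \<Sum>a\<in>idx. Q a (g (snd z)) * \<eta> a (fst z)) \<in> borel_measurable (M \<Otimes>\<^sub>M sphere_measure)"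
  proof (intro borel_measurable_sum borel_measurable_times)
    fix a assume a: "a \<in> idx"
    have "(\<lambda>y. Q a (g y)) \<in> borel_measurable sphere_measure"
      using measurable_compose[OF assms Q_measurable[OF a]] by simp
    then show "(\<lambda>z. Q a (g (snd z))) \<in> borel_measurable (M \<Otimes>\<^sub>M sphere_measure)"
      by (rule measurable_compose[OF measurable_snd])
    show "(\<lambda>z. \<eta> a (fst z)) \<in> borel_measurable (M \<Otimes>\<^sub>M sphere_measure)"
      by (rule measurable_compose[OF measurable_fst \<eta>_measurable[OF a]])
  qed
  then show ?thesis by (simp add: F_eq case_prod_unfold)
qed

lemma continuous_rot: "continuous_on X (\<lambda>t. rot j k t (y :: real ^ 'm))"
proof -
  have "continuous_on X (\<lambda>t. rot j k t y $ i)" for i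
    unfolding rot_nth by (cases "i = j"; cases "i = k") (auto intro!: continuous_intros)
  then show ?thesis
    by (subst continuous_on_componentwise) (auto simp: Basis_vec_def inner_axis)
qed

lemma zero_on_rotation_path:
  assumes jk: "j \<noteq> k" and \<theta>: "0 < \<theta>" and y: "norm y = 1"
    and s: "F \<omega> y * F \<omega> (rot j k \<theta> y) < 0"
  shows "\<exists>t\<in>{0..\<theta>}. rot j k t y \<in> sphere_zeros (F \<omega>)"
proof -
  let ?g = "\<lambda>t. F \<omega> (rot j k t y)"
  have cont: "continuous_on {0..\<theta>} ?g"
    by (rule continuous_on_compose2[OF continuous_on_real_polynomial_function[OF F_polynomial, of UNIV]
        continuous_rot]) auto
  have g0: "?g 0 = F \<omega> y" using jk by simp
  have "\<exists>t. 0 \<le> t \<and> t \<le> \<theta> \<and> ?g t = 0"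
  proof (cases "?g 0 \<le> 0")
    case True
    then have "0 \<le> ?g \<theta>" using s g0 by (auto simp: mult_less_0_iff)
    then show ?thesis using IVT'[of ?g 0 0 \<theta>] True \<theta> cont by auto
  next
    case False
    then have "?g \<theta> \<le> 0" using s g0 by (auto simp: mult_less_0_iff)
    then show ?thesis using IVT2'[of ?g \<theta> 0 0] False \<theta> cont by auto
  qed
  then show ?thesis using jk y by (auto simp: sphere_zeros_def)
qed

text \<open>For fixed y the probability of opposite signs is at least a multiple of the squared
  increment of the Q_a at y. This is integrated over the sphere, and Fubini turns it into an
  expected measure. Measurability is part of the conclusion because a constant factor is later moved
  into the integral.\<close>

lemma expected_sign_changes_ge:
  obtains j k where "j \<noteq> k"
    "ennreal ((std_normal_density 2)\<^sup>2 * measure (sphere_measure :: (real ^ 'm) measure) UNIV / (48 * real CARD('m) ^ 6)) \<le>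
      (\<integral>\<^sup>+\<omega>. emeasure sphere_measure {y. norm y = 1 \<and>
        F \<omega> y * F \<omega> (rot j k (1 / (2 * (real CARD('m))\<^sup>2 * real d)) y) < 0} \<partial>M)"
    "(\<lambda>\<omega>. emeasure sphere_measure {y. norm y = 1 \<and>
        F \<omega> y * F \<omega> (rot j k (1 / (2 * (real CARD('m))\<^sup>2 * real d)) y) < 0}) \<in> borel_measurable M"
proof -
  let ?t = "1 / (2 * (real CARD('m))\<^sup>2 * real d)"
  let ?N = "\<Sum>l\<in>degree_range \<alpha> d. real (D l)"
  let ?c = "(std_normal_density 2)\<^sup>2"
  let ?V = "measure (sphere_measure :: (real ^ 'm) measure) UNIV"
  obtain j k where jk: "j \<noteq> k" and inc: "?N / (24 * real CARD('m) ^ 6) \<le>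
      (\<Sum>a\<in>idx. LINT x|sphere_measure. (Q a (rot j k ?t x) - Q a x)\<^sup>2)"
    using rot_increment_ge by blast
  define E where "E = {(\<omega>, y). norm y = 1 \<and> F \<omega> y * F \<omega> (rot j k ?t y) < 0}"
  interpret pair_sigma_finite M "sphere_measure :: (real ^ 'm) measure" ..
  have id: "(\<lambda>y :: real ^ 'm. y) \<in> borel_measurable borel" by simp
  \<comment> \<open>E also contains pairs with \<omega> outside the space of M, hence the
    intersection.\<close>
  have E [measurable]: "E \<inter> space (M \<Otimes>\<^sub>M sphere_measure) \<in> sets (M \<Otimes>\<^sub>M sphere_measure)"
  proof -
    have [measurable]: "(\<lambda>z. F (fst z) (snd z)) \<in> borel_measurable (M \<Otimes>\<^sub>M sphere_measure)"
      "(\<lambda>z. F (fst z) (rot j k ?t (snd z))) \<in> borel_measurable (M \<Otimes>\<^sub>M sphere_measure)"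
      using F_measurable[OF id] F_measurable[OF rot_measurable[of j k ?t]] by (simp_all add: case_prod_unfold)
    have [measurable]: "(\<lambda>z. norm (snd z)) \<in> borel_measurable (M \<Otimes>\<^sub>M (sphere_measure :: (real ^ 'm) measure))"
      by (rule measurable_compose[OF measurable_snd]) simp
    have "{z \<in> space (M \<Otimes>\<^sub>M sphere_measure). norm (snd z) = 1 \<and> F (fst z) (snd z) * F (fst z) (rot j k ?t (snd z)) < 0}
        \<in> sets (M \<Otimes>\<^sub>M sphere_measure)"
      by measurable
    then show ?thesis by (simp add: E_def Int_def conj_commute case_prod_unfold)
  qed
  have sec: "indicator (E \<inter> space (M \<Otimes>\<^sub>M sphere_measure)) (\<omega>, y) =
      (indicator {y. norm y = 1 \<and> F \<omega> y * F \<omega> (rot j k ?t y) < 0} y :: ennreal)" if "\<omega> \<in> space M" for \<omega> y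
    using that by (auto simp: E_def space_pair_measure split: split_indicator)
  have setB: "{y. norm y = 1 \<and> F \<omega> y * F \<omega> (rot j k ?t y) < 0} \<in> sets borel" for \<omega>
  proof -
    have [measurable]: "F \<omega> \<in> borel_measurable borel"
      by (rule real_polynomial_function_measurable[OF F_polynomial])
    have "{y \<in> space borel. norm y = 1 \<and> F \<omega> y * F \<omega> (rot j k ?t y) < 0} \<in> sets borel"
      by measurable
    then show ?thesis by simp
  qed
  have "ennreal (?c * ?V / (48 * real CARD('m) ^ 6)) \<le>
      ennreal (\<Sum>a\<in>idx. LINT x|sphere_measure. ?c * (Q a x - Q a (rot j k ?t x))\<^sup>2 / (2 * \<kappa>))"
  proof (rule ennreal_leI)
    have V: "0 < ?V" by (rule measure_sphere_measure_pos)
    \<comment> \<open>The total dimension cancels against \<kappa>, leaving the area; 48 is 2 times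
      24.\<close>
    have "?c * ?V / (48 * real CARD('m) ^ 6) = ?c / (2 * \<kappa>) * (?N / (24 * real CARD('m) ^ 6))"
      using V sum_dim_pos by (simp add: \<kappa>_def)
    also have "\<dots> \<le> ?c / (2 * \<kappa>) * (\<Sum>a\<in>idx. LINT x|sphere_measure. (Q a (rot j k ?t x) - Q a x)\<^sup>2)"
      using \<kappa>_pos by (intro mult_left_mono inc) auto
    also have "\<dots> = (\<Sum>a\<in>idx. LINT x|sphere_measure. ?c * (Q a x - Q a (rot j k ?t x))\<^sup>2 / (2 * \<kappa>))"
      unfolding sum_distrib_left
    proof (rule sum.cong[OF refl])
      fix a
      show "?c / (2 * \<kappa>) * (LINT x|sphere_measure. (Q a (rot j k ?t x) - Q a x)\<^sup>2) =
          (LINT x|sphere_measure. ?c * (Q a x - Q a (rot j k ?t x))\<^sup>2 / (2 * \<kappa>))"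
        by (subst integral_mult_right_zero[symmetric]) (simp add: power2_commute)
    qed
    finally show "?c * ?V / (48 * real CARD('m) ^ 6) \<le>
        (\<Sum>a\<in>idx. LINT x|sphere_measure. ?c * (Q a x - Q a (rot j k ?t x))\<^sup>2 / (2 * \<kappa>))" .
  qed
  also have "\<dots> = (\<integral>\<^sup>+x. ennreal (\<Sum>a\<in>idx. ?c * (Q a x - Q a (rot j k ?t x))\<^sup>2 / (2 * \<kappa>)) \<partial>sphere_measure)"
  proof -
    have int: "integrable sphere_measure (\<lambda>x. ?c * (Q a x - Q a (rot j k ?t x))\<^sup>2 / (2 * \<kappa>))" if "a \<in> idx" for a
    proof (intro integrable_sphere_measure continuous_intros)
      show "continuous_on UNIV (Q a)"
        by (rule continuous_on_real_polynomial_function[OF Q_polynomial[OF that]])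
      show "continuous_on UNIV (\<lambda>x. Q a (rot j k ?t x))"
        by (rule continuous_on_compose2[OF continuous_on_real_polynomial_function[OF Q_polynomial[OF that], of UNIV]])
          (auto intro!: linear_continuous_on linear_conv_bounded_linear[THEN iffD1] rot_linear)
    qed (use \<kappa>_pos in auto)
    have "(\<integral>\<^sup>+x. ennreal (\<Sum>a\<in>idx. ?c * (Q a x - Q a (rot j k ?t x))\<^sup>2 / (2 * \<kappa>)) \<partial>sphere_measure) =
        ennreal (LINT x|sphere_measure. (\<Sum>a\<in>idx. ?c * (Q a x - Q a (rot j k ?t x))\<^sup>2 / (2 * \<kappa>)))"
      using int \<kappa>_pos by (intro nn_integral_eq_integral Bochner_Integration.integrable_sum AE_I2 sum_nonneg) auto
    then show ?thesis
      using int by (simp add: Bochner_Integration.integral_sum)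
  qed
  also have "\<dots> \<le> (\<integral>\<^sup>+y. \<integral>\<^sup>+\<omega>. indicator (E \<inter> space (M \<Otimes>\<^sub>M sphere_measure)) (\<omega>, y) \<partial>M \<partial>sphere_measure)"
  proof (rule nn_integral_mono_AE, use AE_sphere_measure in eventually_elim)
    fix y :: "real ^ 'm" assume "y \<in> sphere 0 1"
    then have y: "norm y = 1" by simp
    have ev: "{\<omega> \<in> space M. comb (\<lambda>a. Q a y) \<omega> * comb (\<lambda>a. Q a (rot j k ?t y)) \<omega> < 0} \<in> events"
      by measurable
    have "(\<Sum>a\<in>idx. ?c * (Q a y - Q a (rot j k ?t y))\<^sup>2 / (2 * \<kappa>)) =
        ?c * sqnorm (\<lambda>a. Q a y - Q a (rot j k ?t y)) / (2 * \<kappa>)"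
      by (simp add: sqnorm_def sum_distrib_left sum_divide_distrib)
    also have "\<dots> \<le> prob {\<omega> \<in> space M. comb (\<lambda>a. Q a y) \<omega> * comb (\<lambda>a. Q a (rot j k ?t y)) \<omega> < 0}"
      using y jk by (intro prob_opposite_signs sqnorm_Q \<kappa>_pos) auto
    finally have "ennreal (\<Sum>a\<in>idx. ?c * (Q a y - Q a (rot j k ?t y))\<^sup>2 / (2 * \<kappa>)) \<le>
        emeasure M {\<omega> \<in> space M. comb (\<lambda>a. Q a y) \<omega> * comb (\<lambda>a. Q a (rot j k ?t y)) \<omega> < 0}"
      unfolding emeasure_eq_measure by (rule ennreal_leI)
    also have "\<dots> = (\<integral>\<^sup>+\<omega>. indicator {\<omega> \<in> space M. comb (\<lambda>a. Q a y) \<omega> * comb (\<lambda>a. Q a (rot j k ?t y)) \<omega> < 0} \<omega> \<partial>M)"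
      using ev by simp
    also have "\<dots> = (\<integral>\<^sup>+\<omega>. indicator (E \<inter> space (M \<Otimes>\<^sub>M sphere_measure)) (\<omega>, y) \<partial>M)"
      using y by (intro nn_integral_cong) (auto simp: E_def F_def space_pair_measure split: split_indicator)
    finally show "ennreal (\<Sum>a\<in>idx. ?c * (Q a y - Q a (rot j k ?t y))\<^sup>2 / (2 * \<kappa>)) \<le>
        (\<integral>\<^sup>+\<omega>. indicator (E \<inter> space (M \<Otimes>\<^sub>M sphere_measure)) (\<omega>, y) \<partial>M)" .
  qed
  also have "\<dots> = (\<integral>\<^sup>+\<omega>. \<integral>\<^sup>+y. indicator (E \<inter> space (M \<Otimes>\<^sub>M sphere_measure)) (\<omega>, y) \<partial>sphere_measure \<partial>M)"
    by (rule Fubini) measurable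
  also have "\<dots> = (\<integral>\<^sup>+\<omega>. emeasure sphere_measure {y. norm y = 1 \<and> F \<omega> y * F \<omega> (rot j k ?t y) < 0} \<partial>M)"
    using setB by (intro nn_integral_cong) (simp add: sec)
  finally have ge: "ennreal (?c * ?V / (48 * real CARD('m) ^ 6)) \<le>
      (\<integral>\<^sup>+\<omega>. emeasure sphere_measure {y. norm y = 1 \<and> F \<omega> y * F \<omega> (rot j k ?t y) < 0} \<partial>M)" .
  have "(\<lambda>\<omega>. \<integral>\<^sup>+y. indicator (E \<inter> space (M \<Otimes>\<^sub>M sphere_measure)) (\<omega>, y) \<partial>sphere_measure) \<in> borel_measurable M"
    by (rule sphere_measure.borel_measurable_nn_integral_fst) measurable
  also have "?this \<longleftrightarrow> (\<lambda>\<omega>. emeasure sphere_measure {y. norm y = 1 \<and> F \<omega> y * F \<omega> (rot j k ?t y) < 0}) \<in> borel_measurable M"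
    using setB by (intro measurable_cong) (simp add: sec)
  finally show ?thesis using jk ge that by blast
qed

lemma expected_volume_ge:
  "ennreal (lower_const CARD('m) (measure (sphere_measure :: (real ^ 'm) measure) UNIV) * real d) \<le> (\<integral>\<^sup>+\<omega>. hausdorff_measure (CARD('m) - 2) (sphere_zeros (F \<omega>)) \<partial>M)"
proof -
  let ?m = "real CARD('m)"
  let ?t = "1 / (2 * ?m\<^sup>2 * real d)"
  let ?e = "(std_normal_density 2)\<^sup>2 * measure (sphere_measure :: (real ^ 'm) measure) UNIV / (48 * ?m ^ 6)"
  let ?v = "unit_ball_vol (real (CARD('m) - 2))"
  let ?c = "?v / (2 ^ (CARD('m) - 2) * tube_const CARD('m) * ?t)"
  let ?B = "\<lambda>j k \<omega>. {y. norm y = 1 \<and> F \<omega> y * F \<omega> (rot j k ?t y) < 0}"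
  obtain j k where jk: "j \<noteq> k" and e: "ennreal ?e \<le> (\<integral>\<^sup>+\<omega>. emeasure sphere_measure (?B j k \<omega>) \<partial>M)"
    and meas: "(\<lambda>\<omega>. emeasure sphere_measure (?B j k \<omega>)) \<in> borel_measurable M"
    using expected_sign_changes_ge by blast
  have t: "0 < ?t" using d_pos card by simp
  have t1: "?t \<le> 1"
  proof -
    have "1 \<le> ?m" using card by simp
    then have "1 \<le> ?m\<^sup>2" by (rule one_le_power)
    then have "1 \<le> 2 * ?m\<^sup>2" by linarith
    then have "1 * 1 \<le> (2 * ?m\<^sup>2) * real d"
      using d_pos by (intro mult_mono) auto
    then show ?thesis by (subst divide_le_eq_1_pos) linarith+
  qed
  have tc: "0 < tube_const CARD('m)" by (rule tube_const_pos) simp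
  have v: "0 < ?v" by (rule unit_ball_vol_pos) simp
  have "lower_const CARD('m) (measure (sphere_measure :: (real ^ 'm) measure) UNIV) * real d = ?c * ?e"
    using tc d_pos by (simp add: lower_const_def)
  also have "ennreal (?c * ?e) = ennreal ?c * ennreal ?e"
    using tc v t by (intro ennreal_mult) auto
  also have "\<dots> \<le> ennreal ?c * (\<integral>\<^sup>+\<omega>. emeasure sphere_measure (?B j k \<omega>) \<partial>M)"
    by (rule mult_left_mono[OF e]) simp
  also have "\<dots> = (\<integral>\<^sup>+\<omega>. ennreal ?c * emeasure sphere_measure (?B j k \<omega>) \<partial>M)"
    by (rule nn_integral_cmult[symmetric, OF meas])
  also have "\<dots> \<le> (\<integral>\<^sup>+\<omega>. hausdorff_measure (CARD('m) - 2) (sphere_zeros (F \<omega>)) \<partial>M)"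
  proof (rule nn_integral_mono)
    fix \<omega>
    have "closed (sphere_zeros (F \<omega>))"
    proof -
      have "closed (sphere 0 1 \<inter> F \<omega> -` {0})"
        using continuous_on_real_polynomial_function[OF F_polynomial, of UNIV]
        by (intro closed_Int closed_vimage) auto
      then show ?thesis by (simp add: sphere_zeros_def vimage_def Int_def)
    qed
    then show "ennreal ?c * emeasure sphere_measure (?B j k \<omega>) \<le>
        hausdorff_measure (CARD('m) - 2) (sphere_zeros (F \<omega>))"
      using zero_on_rotation_path[OF jk t]
      by (intro hausdorff_measure_ge_tube[OF jk card t t1]) (auto simp: sphere_zeros_def)
  qed
  finally show ?thesis .
qed

text \<open>The deterministic core of the upper bound. The coefficients of the tangential derivative
  depend on the random zero y, so the largest of the m^2 terms is singled out: for one fixed pair,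
  L_jk f x is a Gaussian independent of f x.\<close>

lemma small_value_near_zero:
  fixes T :: "nat \<times> nat \<Rightarrow> real"
  assumes T: "\<And>a. a \<in> idx \<Longrightarrow> 0 \<le> T a"
    "\<And>a x y. a \<in> idx \<Longrightarrow> norm x = 1 \<Longrightarrow> norm y = 1 \<Longrightarrow>
      \<bar>Q a y - Q a x - tangent_deriv (Q a) x (y - x)\<bar> \<le> T a * (norm (y - x))\<^sup>2"
    and x: "norm x = 1" and y: "norm y = 1" "F \<omega> y = 0" "dist x y \<le> r"
    and r: "r * B * sum T idx \<le> \<epsilon>" and B: "\<And>a. a \<in> idx \<Longrightarrow> \<bar>\<eta> a \<omega>\<bar> \<le> B"
  shows "\<exists>j k. \<bar>F \<omega> x\<bar> \<le> r * (real CARD('m))\<^sup>2 * \<bar>comb (\<lambda>a. rot_deriv j k (Q a) x) \<omega>\<bar> + r * \<epsilon>"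
proof (rule ccontr)
  let ?V = "\<lambda>j k. comb (\<lambda>a. rot_deriv j k (Q a) x) \<omega>"
  let ?m = "real CARD('m)"
  assume "\<not> ?thesis"
  then have gt: "r * ?m\<^sup>2 * \<bar>?V j k\<bar> + r * \<epsilon> < \<bar>F \<omega> x\<bar>" for j k by (auto simp: not_le)
  have r0: "0 \<le> r" using y(3) zero_le_dist[of x y] by linarith
  have nyx: "norm (y - x) \<le> r" using y(3) by (simp add: dist_norm norm_minus_commute)
  have lin: "(\<Sum>a\<in>idx. \<eta> a \<omega> * tangent_deriv (Q a) x (y - x)) =
      (\<Sum>j\<in>UNIV. \<Sum>k\<in>UNIV. (y - x) $ k * x $ j * ?V j k)"
  proof -
    have "(\<Sum>a\<in>idx. \<eta> a \<omega> * tangent_deriv (Q a) x (y - x)) =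
        (\<Sum>a\<in>idx. \<Sum>j\<in>UNIV. \<Sum>k\<in>UNIV. (y - x) $ k * x $ j * (rot_deriv j k (Q a) x * \<eta> a \<omega>))"
      by (simp add: tangent_deriv_def sum_distrib_left mult_ac)
    also have "\<dots> = (\<Sum>j\<in>UNIV. \<Sum>a\<in>idx. \<Sum>k\<in>UNIV. (y - x) $ k * x $ j * (rot_deriv j k (Q a) x * \<eta> a \<omega>))"
      by (rule sum.swap)
    also have "\<dots> = (\<Sum>j\<in>UNIV. \<Sum>k\<in>UNIV. \<Sum>a\<in>idx. (y - x) $ k * x $ j * (rot_deriv j k (Q a) x * \<eta> a \<omega>))"
      by (rule sum.cong[OF refl], rule sum.swap)
    finally show ?thesis by (simp only: comb_def sum_distrib_left)
  qed
  have eq: "F \<omega> x + (\<Sum>j\<in>UNIV. \<Sum>k\<in>UNIV. (y - x) $ k * x $ j * ?V j k) =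
      - (\<Sum>a\<in>idx. \<eta> a \<omega> * (Q a y - Q a x - tangent_deriv (Q a) x (y - x)))"
  proof -
    have "(\<Sum>a\<in>idx. \<eta> a \<omega> * (Q a y - Q a x - tangent_deriv (Q a) x (y - x))) =
        F \<omega> y - F \<omega> x - (\<Sum>a\<in>idx. \<eta> a \<omega> * tangent_deriv (Q a) x (y - x))"
      by (simp add: F_eq right_diff_distrib sum_subtractf mult.commute)
    from this[unfolded lin] y(2) show ?thesis by linarith
  qed
  have "\<bar>F \<omega> x + (\<Sum>j\<in>UNIV. \<Sum>k\<in>UNIV. (y - x) $ k * x $ j * ?V j k)\<bar> \<le>
      (\<Sum>a\<in>idx. \<bar>\<eta> a \<omega> * (Q a y - Q a x - tangent_deriv (Q a) x (y - x))\<bar>)"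
    unfolding eq abs_minus_cancel by (rule sum_abs)
  also have "\<dots> \<le> (\<Sum>a\<in>idx. B * (T a * r\<^sup>2))"
  proof (rule sum_mono)
    fix a assume a: "a \<in> idx"
    have "\<bar>Q a y - Q a x - tangent_deriv (Q a) x (y - x)\<bar> \<le> T a * r\<^sup>2"
      using T(2)[OF a x y(1)] nyx T(1)[OF a]
      by (elim order_trans) (intro mult_left_mono power_mono, auto)
    then show "\<bar>\<eta> a \<omega> * (Q a y - Q a x - tangent_deriv (Q a) x (y - x))\<bar> \<le> B * (T a * r\<^sup>2)"
      unfolding abs_mult using B[OF a] by (intro mult_mono) auto
  qed
  also have "\<dots> = r * (r * B * sum T idx)"
    by (simp add: sum_distrib_left[symmetric] sum_distrib_right[symmetric] power2_eq_square mult_ac)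
  also have "\<dots> \<le> r * \<epsilon>" by (rule mult_left_mono[OF r r0])
  finally have 1: "\<bar>F \<omega> x\<bar> \<le> \<bar>\<Sum>j\<in>UNIV. \<Sum>k\<in>UNIV. (y - x) $ k * x $ j * ?V j k\<bar> + r * \<epsilon>" by linarith
  have "\<bar>\<Sum>j\<in>UNIV. \<Sum>k\<in>UNIV. (y - x) $ k * x $ j * ?V j k\<bar> \<le> (\<Sum>j\<in>UNIV. \<Sum>k\<in>UNIV. \<bar>(y - x) $ k * x $ j * ?V j k\<bar>)"
    by (rule order_trans[OF sum_abs sum_mono[OF sum_abs]])
  also have "\<dots> \<le> (\<Sum>j\<in>UNIV. \<Sum>k\<in>UNIV. r * \<bar>?V j k\<bar>)"
  proof (intro sum_mono)
    fix j k
    have "\<bar>(y - x) $ k\<bar> * \<bar>x $ j\<bar> \<le> r * 1"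
      using nyx x component_le_norm_cart[of "y - x" k] component_le_norm_cart[of x j] r0
      by (intro mult_mono) auto
    then show "\<bar>(y - x) $ k * x $ j * ?V j k\<bar> \<le> r * \<bar>?V j k\<bar>"
      unfolding abs_mult by (intro mult_right_mono) auto
  qed
  finally have 2: "\<bar>F \<omega> x\<bar> \<le> (\<Sum>j\<in>UNIV. \<Sum>k\<in>UNIV. r * \<bar>?V j k\<bar>) + r * \<epsilon>" using 1 by linarith
  have "(\<Sum>j\<in>(UNIV::'m set). \<Sum>k\<in>(UNIV::'m set). r * ?m\<^sup>2 * \<bar>?V j k\<bar> + r * \<epsilon>) <
      (\<Sum>j\<in>(UNIV::'m set). \<Sum>k\<in>(UNIV::'m set). \<bar>F \<omega> x\<bar>)"
    by (intro sum_strict_mono gt) auto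
  then have "?m\<^sup>2 * ((\<Sum>j\<in>UNIV. \<Sum>k\<in>UNIV. r * \<bar>?V j k\<bar>) + r * \<epsilon>) < ?m\<^sup>2 * \<bar>F \<omega> x\<bar>"
    by (simp add: sum.distrib sum_distrib_left power2_eq_square algebra_simps)
  then have "(\<Sum>j\<in>UNIV. \<Sum>k\<in>UNIV. r * \<bar>?V j k\<bar>) + r * \<epsilon> < \<bar>F \<omega> x\<bar>"
    by (rule mult_left_less_imp_less) simp
  then show False using 2 by linarith
qed

text \<open>A net of mesh r has at most order r^-(m-1) balls, each of weight of order r^(m-2). A
  hitting probability of order r d per ball therefore gives a bound of order d.\<close>

lemma expected_volume_le:
  "(\<integral>\<^sup>+\<omega>. hausdorff_measure (CARD('m) - 2) (sphere_zeros (F \<omega>)) \<partial>M) \<le> ennreal (upper_const CARD('m) * real d)"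
proof -
  let ?m = "real CARD('m)"
  let ?k = "CARD('m) - 2"
  let ?v = "unit_ball_vol (real ?k)"
  have v: "0 < ?v" by (rule unit_ball_vol_pos) simp
  define remainder where "remainder a C \<longleftrightarrow> 0 \<le> C \<and> (\<forall>x y. norm x = 1 \<longrightarrow> norm y = 1 \<longrightarrow>
      \<bar>Q a y - Q a x - tangent_deriv (Q a) x (y - x)\<bar> \<le> C * (norm (y - x))\<^sup>2)"
    for a C
  have "\<forall>a\<in>idx. \<exists>C. remainder a C"
    unfolding remainder_def using sphere_taylor_remainder[OF Q_polynomial] by blast
  then obtain T where "\<forall>a\<in>idx. remainder a (T a)"
    using bchoice[of idx remainder] by blast
  then have T: "\<And>a. a \<in> idx \<Longrightarrow> 0 \<le> T a"
    "\<And>a x y. a \<in> idx \<Longrightarrow> norm x = 1 \<Longrightarrow> norm y = 1 \<Longrightarrow>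
      \<bar>Q a y - Q a x - tangent_deriv (Q a) x (y - x)\<bar> \<le> T a * (norm (y - x))\<^sup>2"
    by (simp_all only: remainder_def)
  define T' where "T' = sum T idx + 1"
  have sT: "0 \<le> sum T idx" by (intro sum_nonneg T)
  then have T': "0 < T'" "sum T idx \<le> T'" by (auto simp: T'_def)
  \<comment> \<open>The exponents balance two demands. With r = \<epsilon>^4 and the cutoff B = 1 /
    (\<epsilon>^3 T') for the coefficients, the Taylor error is at most r \<epsilon>, while
    exceeding the cutoff has probability of order \<epsilon>^6 = r \<epsilon>^2, negligible against
    r even when counted in every ball. The added 1 keeps T' positive.\<close>
  define \<epsilon> where "\<epsilon> i = 1 / real (Suc i)" for i
  define r where "r i = \<epsilon> i ^ 4" for i
  have \<epsilon>: "0 < \<epsilon> i" "\<epsilon> i \<le> 1" for i by (auto simp: \<epsilon>_def)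
  have r: "0 < r i" "r i \<le> 1" for i
    using \<epsilon>[of i] by (auto simp: r_def power_le_one)
  have \<epsilon>_lim: "\<epsilon> \<longlonglongrightarrow> 0"
    unfolding \<epsilon>_def using LIMSEQ_Suc[OF lim_1_over_n] by simp
  have r_lim: "r \<longlonglongrightarrow> 0"
    unfolding r_def using tendsto_power[OF \<epsilon>_lim, of 4] by simp
  define is_net where "is_net i S \<longleftrightarrow> finite S \<and> S \<subseteq> sphere 0 1 \<and> sphere 0 1 \<subseteq> (\<Union>x\<in>S. cball x (r i)) \<and>
      real (card S) * r i ^ (CARD('m) - 1) \<le> 4 ^ CARD('m) * ?m" for i and S :: "(real ^ 'm) set"
  have "\<exists>S. is_net i S" for i
    by (rule sphere_net[OF r[of i], where 'm = 'm]) (auto simp: is_net_def)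
  then obtain N where "\<And>i. is_net i (N i)"
    by (meson choice)
  then have N: "\<And>i. finite (N i)" "\<And>i. N i \<subseteq> sphere 0 1"
    "\<And>i. sphere 0 1 \<subseteq> (\<Union>x\<in>N i. cball x (r i))"
    "\<And>i. real (card (N i)) * r i ^ (CARD('m) - 1) \<le> 4 ^ CARD('m) * ?m"
    by (simp_all only: is_net_def)
  define B where "B i = 1 / (\<epsilon> i ^ 3 * T')" for i
  have B: "0 < B i" for i using \<epsilon>[of i] T' by (simp add: B_def)
  have rBT: "r i * B i * sum T idx \<le> \<epsilon> i" for i
  proof -
    have "r i * B i * sum T idx \<le> r i * B i * T'"
      using r[of i] B[of i] T' by (intro mult_left_mono) auto
    also have "\<dots> = \<epsilon> i"
      using \<epsilon>[of i] T' by (simp add: r_def B_def eval_nat_numeral)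
    finally show ?thesis .
  qed
  define G where "G i = (\<Union>a\<in>idx. {\<omega>\<in>space M. B i < \<bar>\<eta> a \<omega>\<bar>})" for i
  define H where "H i x j k = {\<omega>\<in>space M. \<bar>comb (\<lambda>a. Q a x) \<omega>\<bar> \<le>
      r i * ?m\<^sup>2 * \<bar>comb (\<lambda>a. rot_deriv j k (Q a) x) \<omega>\<bar> + r i * \<epsilon> i}" for i x j k
  \<comment> \<open>Up to the event G of an exceptionally large coefficient, a ball around x can
    meet the zero set only if some H holds.\<close>
  define A where "A i x = G i \<union> (\<Union>j. \<Union>k. H i x j k)" for i x
  have G_ev: "G i \<in> events" for i
    unfolding G_def by (intro sets.finite_UN finite_idx) measurable
  have H_ev: "H i x j k \<in> events" for i x j k
    unfolding H_def by measurable
  have A_ev: "A i x \<in> events" for i x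
    unfolding A_def by (intro sets.Un G_ev sets.finite_UN H_ev) auto
  have prob_G: "prob (G i) \<le> real (card idx) * (T'\<^sup>2 * \<epsilon> i ^ 6)" for i
  proof -
    have "prob (G i) \<le> (\<Sum>a\<in>idx. prob {\<omega>\<in>space M. B i < \<bar>\<eta> a \<omega>\<bar>})"
      unfolding G_def by (intro finite_measure_subadditive_finite finite_idx) auto
    also have "\<dots> \<le> (\<Sum>a\<in>idx. 1 / (B i)\<^sup>2)"
      by (intro sum_mono prob_abs_gt B)
    also have "1 / (B i)\<^sup>2 = T'\<^sup>2 * \<epsilon> i ^ 6"
      by (simp add: B_def power_divide power_mult_distrib power_mult[symmetric])
    finally show ?thesis by simp
  qed
  have prob_H: "prob (H i x j k) \<le> r i * (?m\<^sup>2 * (sqrt (2 * ?m) * real d) + \<epsilon> i / sqrt \<kappa>)"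
    if x: "norm x = 1" for i x j k
  proof -
    have "prob (H i x j k) \<le> (r i * ?m\<^sup>2 * sqrt (sqnorm (\<lambda>a. rot_deriv j k (Q a) x)) + r i * \<epsilon> i) / sqrt (sqnorm (\<lambda>a. Q a x))"
      unfolding H_def
      using r[of i] \<epsilon>[of i] \<kappa>_pos sqnorm_Q[OF x]
      by (intro prob_abs_comb_le_abs_comb sum_Q_rot_deriv mult_nonneg_nonneg) auto
    also have "\<dots> \<le> (r i * ?m\<^sup>2 * (sqrt (2 * ?m) * real d * sqrt \<kappa>) + r i * \<epsilon> i) / sqrt \<kappa>"
    proof -
      have "sqnorm (\<lambda>a. rot_deriv j k (Q a) x) \<le> 2 * ?m * (real d)\<^sup>2 * \<kappa>"
        unfolding sqnorm_def by (rule sum_rot_deriv_Q_squared_le[OF x])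
      then have "sqrt (sqnorm (\<lambda>a. rot_deriv j k (Q a) x)) \<le> sqrt (2 * ?m * (real d)\<^sup>2 * \<kappa>)"
        by (rule real_sqrt_le_mono)
      also have "\<dots> = sqrt (2 * ?m) * real d * sqrt \<kappa>"
        by (simp only: real_sqrt_mult real_sqrt_abs)
      finally show ?thesis
        unfolding sqnorm_Q[OF x] using r[of i] \<kappa>_pos
        by (intro divide_right_mono add_right_mono mult_left_mono) auto
    qed
    also have "\<dots> = r i * (?m\<^sup>2 * (sqrt (2 * ?m) * real d) + \<epsilon> i / sqrt \<kappa>)"
      using \<kappa>_pos by (simp add: add_divide_distrib distrib_left)
    finally show ?thesis .
  qed
  define b where "b i = real (card idx) * (T'\<^sup>2 * \<epsilon> i ^ 2) + ?m\<^sup>2 * (?m\<^sup>2 * (sqrt (2 * ?m) * real d) + \<epsilon> i / sqrt \<kappa>)" for i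
  have prob_A: "prob (A i x) \<le> r i * b i" if x: "norm x = 1" for i x
  proof -
    have "prob (A i x) \<le> prob (G i) + prob (\<Union>j. \<Union>k. H i x j k)"
      unfolding A_def by (intro measure_Un_le G_ev sets.finite_UN H_ev) auto
    also have "prob (\<Union>j. \<Union>k. H i x j k) \<le> (\<Sum>j\<in>UNIV. prob (\<Union>k. H i x j k))"
      by (intro finite_measure_subadditive_finite) (auto intro!: sets.finite_UN H_ev)
    also have "\<dots> \<le> (\<Sum>j\<in>UNIV. \<Sum>k\<in>UNIV. prob (H i x j k))"
      by (intro sum_mono finite_measure_subadditive_finite) (auto intro: H_ev)
    also have "\<dots> \<le> (\<Sum>j\<in>(UNIV::'m set). \<Sum>k\<in>(UNIV::'m set). r i * (?m\<^sup>2 * (sqrt (2 * ?m) * real d) + \<epsilon> i / sqrt \<kappa>))"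
      by (intro sum_mono prob_H x)
    also have "\<dots> = r i * (?m\<^sup>2 * (?m\<^sup>2 * (sqrt (2 * ?m) * real d) + \<epsilon> i / sqrt \<kappa>))"
      by (simp add: power2_eq_square mult_ac)
    also have "prob (G i) \<le> r i * (real (card idx) * (T'\<^sup>2 * \<epsilon> i ^ 2))"
    proof -
      have "real (card idx) * (T'\<^sup>2 * \<epsilon> i ^ 6) = r i * (real (card idx) * (T'\<^sup>2 * \<epsilon> i ^ 2))"
        by (simp add: r_def eval_nat_numeral)
      then show ?thesis using prob_G[of i] by (simp only:)
    qed
    finally show ?thesis by (simp add: b_def distrib_left)
  qed
  \<comment> \<open>Counting the events A instead of the balls that meet the zero set gives a
    measurable majorant of the cover weights.\<close>
  define u where "u i \<omega> = ennreal (?v * r i ^ ?k) * (\<Sum>x\<in>N i. indicator (A i x) \<omega>)" for i \<omega>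
  have u_meas: "u i \<in> borel_measurable M" for i
    unfolding u_def using A_ev by (intro borel_measurable_times_ennreal borel_measurable_const borel_measurable_sum) auto
  have hits: "hausdorff_measure ?k (sphere_zeros (F \<omega>)) \<le> liminf (\<lambda>i. u i \<omega>)" if \<omega>: "\<omega> \<in> space M" for \<omega>
  proof -
    let ?Z = "sphere_zeros (F \<omega>)"
    have "hausdorff_measure ?k ?Z \<le> liminf (\<lambda>i. ennreal (?v * r i ^ ?k) *
        of_nat (card {x \<in> N i. cball x (r i) \<inter> ?Z \<noteq> {}}))"
    proof (rule hausdorff_measure_le_liminf[OF N(1) _ _ r_lim])
      show "?Z \<subseteq> (\<Union>x\<in>N i. cball x (r i))" for i
        using N(3)[of i] by (auto simp: sphere_zeros_def)
    qed (use r less_imp_le in blast)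
    also have "\<dots> \<le> liminf (\<lambda>i. u i \<omega>)"
    proof (intro Liminf_mono always_eventually allI)
      fix i
      have hit: "\<omega> \<in> A i x" if x: "x \<in> N i" "cball x (r i) \<inter> ?Z \<noteq> {}" for x
      proof (rule ccontr)
        assume nA: "\<omega> \<notin> A i x"
        have nx: "norm x = 1" using x N(2)[of i] by auto
        obtain y where y: "norm y = 1" "F \<omega> y = 0" "dist x y \<le> r i"
          using x(2) by (auto simp: sphere_zeros_def)
        have "\<bar>\<eta> a \<omega>\<bar> \<le> B i" if "a \<in> idx" for a
          using nA that \<omega> by (auto simp: A_def G_def not_less)
        then have "\<exists>j k. \<bar>F \<omega> x\<bar> \<le> r i * ?m\<^sup>2 * \<bar>comb (\<lambda>a. rot_deriv j k (Q a) x) \<omega>\<bar> + r i * \<epsilon> i"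
          by (intro small_value_near_zero[OF T nx y rBT])
        then show False
          using nA \<omega> by (auto simp: A_def H_def F_def)
      qed
      have "(of_nat (card {x \<in> N i. cball x (r i) \<inter> ?Z \<noteq> {}}) :: ennreal) =
          (\<Sum>x\<in>{x \<in> N i. cball x (r i) \<inter> ?Z \<noteq> {}}. 1)"
        by simp
      also have "\<dots> = (\<Sum>x\<in>{x \<in> N i. cball x (r i) \<inter> ?Z \<noteq> {}}. indicator (A i x) \<omega>)"
        using hit by (intro sum.cong) auto
      also have "\<dots> \<le> (\<Sum>x\<in>N i. indicator (A i x) \<omega>)"
        using N(1)[of i] by (intro sum_mono2) auto
      finally show "ennreal (?v * r i ^ ?k) * of_nat (card {x \<in> N i. cball x (r i) \<inter> ?Z \<noteq> {}}) \<le> u i \<omega>"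
        unfolding u_def by (rule mult_left_mono) simp
    qed
    finally show ?thesis .
  qed
  have int_u: "(\<integral>\<^sup>+\<omega>. u i \<omega> \<partial>M) \<le> ennreal (?v * (4 ^ CARD('m) * ?m) * b i)" for i
  proof -
    have b0: "0 \<le> b i"
      unfolding b_def using \<epsilon>[of i] \<kappa>_pos by (intro add_nonneg_nonneg mult_nonneg_nonneg) auto
    have "(\<integral>\<^sup>+\<omega>. u i \<omega> \<partial>M) = ennreal (?v * r i ^ ?k) * (\<Sum>x\<in>N i. emeasure M (A i x))"
      unfolding u_def using A_ev
      by (subst nn_integral_cmult) (auto simp: nn_integral_sum)
    also have "\<dots> \<le> ennreal (?v * r i ^ ?k) * (\<Sum>x\<in>N i. ennreal (r i * b i))"
      unfolding emeasure_eq_measure using N(2)[of i]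
      by (intro mult_left_mono sum_mono ennreal_leI prob_A) auto
    also have "\<dots> = ennreal (?v * r i ^ ?k * (real (card (N i)) * (r i * b i)))"
      using v r[of i] b0 by (simp add: ennreal_mult ennreal_of_nat_eq_real_of_nat)
    also have "?v * r i ^ ?k * (real (card (N i)) * (r i * b i)) =
        ?v * (real (card (N i)) * r i ^ (CARD('m) - 1)) * b i"
    proof -
      have "CARD('m) - 1 = Suc ?k" using card by simp
      then show ?thesis by (simp add: mult_ac)
    qed
    also have "ennreal \<dots> \<le> ennreal (?v * (4 ^ CARD('m) * ?m) * b i)"
      using v b0 by (intro ennreal_leI mult_right_mono mult_left_mono N(4)) auto
    finally show ?thesis .
  qed
  have "b \<longlonglongrightarrow> real (card idx) * (T'\<^sup>2 * 0 ^ 2) + ?m\<^sup>2 * (?m\<^sup>2 * (sqrt (2 * ?m) * real d) + 0 / sqrt \<kappa>)"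
    unfolding b_def[abs_def] using \<kappa>_pos by (intro tendsto_intros \<epsilon>_lim) auto
  \<comment> \<open>The limit is the m^2 term alone; the slack 1 is at most d and becomes the
    summand 1 in \<open>upper_const\<close>.\<close>
  then have "\<forall>\<^sub>F i in sequentially. b i < ?m\<^sup>2 * (?m\<^sup>2 * (sqrt (2 * ?m) * real d)) + 1"
    by (rule order_tendstoD(2)) simp
  then have ev: "\<forall>\<^sub>F i in sequentially. (\<integral>\<^sup>+\<omega>. u i \<omega> \<partial>M) \<le> ennreal (upper_const CARD('m) * real d)"
  proof eventually_elim
    case (elim i)
    have "b i \<le> ?m\<^sup>2 * (?m\<^sup>2 * (sqrt (2 * ?m) * real d)) + real d"
      using elim d_pos by simp
    also have "\<dots> = (?m\<^sup>2 * (?m\<^sup>2 * sqrt (2 * ?m)) + 1) * real d"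
      by (simp add: algebra_simps)
    finally have "?v * (4 ^ CARD('m) * ?m) * b i \<le> ?v * (4 ^ CARD('m) * ?m) * ((?m\<^sup>2 * (?m\<^sup>2 * sqrt (2 * ?m)) + 1) * real d)"
      using v by (intro mult_left_mono) auto
    also have "\<dots> = upper_const CARD('m) * real d"
      by (simp add: upper_const_def)
    finally show ?case
      using int_u[of i] by (meson ennreal_leI order_trans)
  qed
  have "(\<integral>\<^sup>+\<omega>. hausdorff_measure ?k (sphere_zeros (F \<omega>)) \<partial>M) \<le> (\<integral>\<^sup>+\<omega>. liminf (\<lambda>i. u i \<omega>) \<partial>M)"
    by (rule nn_integral_mono) (rule hits)
  also have "\<dots> \<le> liminf (\<lambda>i. \<integral>\<^sup>+\<omega>. u i \<omega> \<partial>M)"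
    by (rule nn_integral_liminf) (rule u_meas)
  also have "\<dots> \<le> limsup (\<lambda>i. \<integral>\<^sup>+\<omega>. u i \<omega> \<partial>M)"
    by (rule Liminf_le_Limsup) simp
  also have "\<dots> \<le> ennreal (upper_const CARD('m) * real d)"
    by (rule Limsup_bounded) (rule ev)
  finally show ?thesis .
qed

end

section \<open>From the definition of a random polynomial to the ensemble\<close>

lemma (in prob_space) standardized_law:
  assumes X: "distributed M lborel X (\<lambda>x. ennreal (normal_density 0 s x))" and s: "0 < s"
  shows "distr M borel (\<lambda>\<omega>. X \<omega> / s) = std_normal_distribution"
proof -
  have "distributed M lborel (\<lambda>\<omega>. (X \<omega> - 0) / s) std_normal_density"
    using X normal_standard_normal_convert[OF s, of X 0] by simp
  then have "distr M lborel (\<lambda>\<omega>. X \<omega> / s) = std_normal_distribution"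
    by (simp add: distributed_def)
  moreover have "distr M lborel (\<lambda>\<omega>. X \<omega> / s) = distr M borel (\<lambda>\<omega>. X \<omega> / s)"
    by (rule distr_cong) auto
  ultimately show ?thesis by simp
qed

text \<open>If \<open>D = 0\<close>, then \<open>1 / real D = 0\<close> and \<open>normal_density 0 0\<close> is the zero function.\<close>

lemma (in prob_space) normal_density_deviation_pos:
  assumes X: "distributed M lborel X (\<lambda>x. ennreal (normal_density 0 (sqrt (1 / real D)) x))"
  shows "0 < sqrt (1 / real D)"
proof (rule ccontr)
  assume "\<not> ?thesis"
  then have "D = 0" by simp
  then have "distr M lborel X = density lborel (\<lambda>x. 0)"
    using X by (simp add: distributed_def normal_density_def)
  then have "emeasure (distr M lborel X) UNIV = 0"
    by (simp add: emeasure_density)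
  moreover have "emeasure (distr M lborel X) UNIV = 1"
    using X by (subst emeasure_distr) (auto simp: distributed_def emeasure_space_1)
  ultimately show False by simp
qed

text \<open>Dividing all coefficients by their common standard deviation makes them standard
  Gaussians and divides \<open>f\<close> by a positive constant on the sphere, which leaves its
  zeros in place.\<close>

lemma random_polynomial_ensemble:
  fixes f :: "'w \<Rightarrow> real ^ 'm::finite \<Rightarrow> real"
  assumes rp: "random_polynomial M \<alpha> d f" and \<alpha>: "0 \<le> \<alpha>" "\<alpha> \<le> 1" and d: "1 \<le> d" and m: "2 \<le> CARD('m)"
  shows "\<exists>D (P :: nat \<Rightarrow> nat \<Rightarrow> real ^ 'm \<Rightarrow> real) \<eta>. random_ensemble \<alpha> d D P M \<eta> \<and>
    (\<forall>\<omega>\<in>space M. sphere_zeros (f \<omega>) = sphere_zeros (random_ensemble.F \<alpha> d D P \<eta> \<omega>))"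
proof -
  define L where "L = degree_range \<alpha> d"
  define D where "D l = dim (spherical_harmonics l :: (real ^ 'm \<Rightarrow> real) set)" for l
  define s where "s = sqrt (1 / real (dim (harmonics_range \<alpha> d :: (real ^ 'm \<Rightarrow> real) set)))"
  interpret prob_space M using rp by (simp add: random_polynomial_def)
  have "\<exists>(Y :: nat \<Rightarrow> nat \<Rightarrow> real ^ 'm \<Rightarrow> real) \<xi>.
      (\<forall>l\<in>L. orthonormal_basis (spherical_harmonics l) (Y l)) \<and>
      indep_vars (\<lambda>_. borel) (\<lambda>(l, i). \<xi> l i) (SIGMA l:L. {1..D l}) \<and>
      (\<forall>l\<in>L. \<forall>i\<in>{1..D l}. distributed M lborel (\<xi> l i) (\<lambda>x. ennreal (normal_density 0 s x))) \<and>
      (\<forall>\<omega>\<in>space M. f \<omega> = (\<Sum>l\<in>L. \<Sum>i\<in>{1..D l}. \<xi> l i \<omega> *\<^sub>R Y l i))"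
    using rp unfolding random_polynomial_def Let_def L_def D_def s_def by blast
  then obtain Y :: "nat \<Rightarrow> nat \<Rightarrow> real ^ 'm \<Rightarrow> real" and \<xi> where
    Y: "\<And>l. l \<in> L \<Longrightarrow> orthonormal_basis (spherical_harmonics l) (Y l)"
    and indep: "indep_vars (\<lambda>_. borel) (\<lambda>(l, i). \<xi> l i) (SIGMA l:L. {1..D l})"
    and law: "\<And>l i. l \<in> L \<Longrightarrow> i \<in> {1..D l} \<Longrightarrow> distributed M lborel (\<xi> l i) (\<lambda>x. ennreal (normal_density 0 s x))"
    and f: "\<And>\<omega>. \<omega> \<in> space M \<Longrightarrow> f \<omega> = (\<Sum>l\<in>L. \<Sum>i\<in>{1..D l}. \<xi> l i \<omega> *\<^sub>R Y l i)"
    by blast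
  have "\<forall>l\<in>L. \<exists>P. harmonic_frame l (D l) P \<and> (\<forall>i\<in>{1..D l}. Y l i = sphere_restrict (P i))"
    using orthonormal_basis_frame[OF m Y] by (simp add: D_def)
  then obtain P where "\<forall>l\<in>L. harmonic_frame l (D l) (P l) \<and> (\<forall>i\<in>{1..D l}. Y l i = sphere_restrict (P l i))"
    by (auto dest!: bchoice)
  then have P: "\<And>l. l \<in> L \<Longrightarrow> harmonic_frame l (D l) (P l)"
    "\<And>l i. l \<in> L \<Longrightarrow> i \<in> {1..D l} \<Longrightarrow> Y l i = sphere_restrict (P l i)"
    by blast+
  interpret harmonic_ensemble \<alpha> d D P
    by (rule harmonic_ensemble.intro) (use \<alpha> d m P in \<open>simp_all add: L_def\<close>)
  have idx: "idx = (SIGMA l:L. {1..D l})" by (simp add: idx_def L_def)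
  have dL: "d \<in> L" unfolding L_def by (rule degree_in_degree_range[OF \<alpha>])
  \<comment> \<open>Degree d supplies at least one coefficient. That it has a genuine law forces s >
    0, so \<open>dim (harmonics_range \<alpha> d)\<close> never has to be computed.\<close>
  have "1 \<in> {1..D d}" using harmonic_frame.dim_pos[OF P(1)[OF dL]] by simp
  from law[OF dL this] have s: "0 < s"
    unfolding s_def by (rule normal_density_deviation_pos)
  define \<eta> where "\<eta> = (\<lambda>a \<omega>. (case a of (l, i) \<Rightarrow> \<xi> l i \<omega>) / s)"
  interpret gaussian_family M idx \<eta>
  proof
    show "finite idx" by simp
    show "indep_vars (\<lambda>_. borel) \<eta> idx"
      unfolding \<eta>_def idx using indep_vars_compose2[OF indep, of "\<lambda>_ x. x / s" "\<lambda>_. borel"]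
      by (simp add: case_prod_unfold)
    show "distr M borel (\<eta> a) = std_normal_distribution" if a_idx: "a \<in> idx" for a
    proof -
      obtain l i where a: "a = (l, i)" "l \<in> L" "i \<in> {1..D l}" using a_idx by (auto simp: idx)
      show ?thesis
        using standardized_law[OF law[OF a(2,3)] s] by (simp add: \<eta>_def a(1))
    qed
  qed
  interpret random_ensemble \<alpha> d D P M \<eta> by unfold_locales
  have "sphere_zeros (f \<omega>) = sphere_zeros (F \<omega>)" if \<omega>: "\<omega> \<in> space M" for \<omega>
  proof -
    have "f \<omega> x = s * F \<omega> x" if x: "norm x = 1" for x
    proof -
      have "f \<omega> x = (\<Sum>l\<in>L. \<Sum>i\<in>{1..D l}. \<xi> l i \<omega> * Y l i x)"
        unfolding f[OF \<omega>] by (simp add: sum_fun_apply scaleR_fun_def)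
      also have "\<dots> = (\<Sum>l\<in>L. \<Sum>i\<in>{1..D l}. s * (P l i x * \<eta> (l, i) \<omega>))"
        using x s by (intro sum.cong refl) (simp add: P(2) sphere_restrict_def \<eta>_def)
      also have "\<dots> = s * (\<Sum>a\<in>idx. Q a x * \<eta> a \<omega>)"
        unfolding idx sum_distrib_left Q_def by (subst sum.Sigma) (auto simp: case_prod_unfold L_def)
      finally show ?thesis by (simp add: F_eq)
    qed
    then show ?thesis using s by (auto simp: sphere_zeros_def)
  qed
  then show ?thesis using random_ensemble_axioms by blast
qed

theorem theorem1:
  fixes n :: nat and \<alpha> :: real
  assumes "1 \<le> n" and "CARD('m::finite) = n + 1"
    and "0 \<le> \<alpha>" and "\<alpha> \<le> 1"
  shows "\<exists>c\<^sub>1 > 0. \<exists>c\<^sub>2 > 0. \<forall>\<^sub>F d :: nat in sequentially.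
    \<forall>(M :: 'w measure) (f :: 'w \<Rightarrow> real ^ 'm \<Rightarrow> real). random_polynomial M \<alpha> d f \<longrightarrow>
      ennreal (c\<^sub>1 * real d) \<le> (\<integral>\<^sup>+\<omega>. hausdorff_measure (n - 1) (sphere_zeros (f \<omega>)) \<partial>M) \<and>
      (\<integral>\<^sup>+\<omega>. hausdorff_measure (n - 1) (sphere_zeros (f \<omega>)) \<partial>M) \<le> ennreal (c\<^sub>2 * real d)"
proof -
  let ?c1 = "lower_const CARD('m) (measure (sphere_measure :: (real ^ 'm) measure) UNIV)"
  let ?c2 = "upper_const CARD('m)"
  have m: "2 \<le> CARD('m)" and n: "n - 1 = CARD('m) - 2" using assms by auto
  have v: "0 < unit_ball_vol (real (CARD('m) - 2))" by (rule unit_ball_vol_pos) simp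
  have c1: "0 < ?c1"
    unfolding lower_const_def using m v tube_const_pos[of "CARD('m)"] measure_sphere_measure_pos[where 'm = 'm]
    by (intro mult_pos_pos divide_pos_pos zero_less_power) (auto simp: normal_density_pos)
  have c2: "0 < ?c2"
    unfolding upper_const_def using m v by (intro mult_pos_pos add_nonneg_pos) auto
  have bounds: "ennreal (?c1 * real d) \<le> (\<integral>\<^sup>+\<omega>. hausdorff_measure (n - 1) (sphere_zeros (f \<omega>)) \<partial>M) \<and>
      (\<integral>\<^sup>+\<omega>. hausdorff_measure (n - 1) (sphere_zeros (f \<omega>)) \<partial>M) \<le> ennreal (?c2 * real d)"
    if d: "1 \<le> d" and rp: "random_polynomial M \<alpha> d f"
    for d and M :: "'w measure" and f :: "'w \<Rightarrow> real ^ 'm \<Rightarrow> real"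
  proof -
    obtain D and P :: "nat \<Rightarrow> nat \<Rightarrow> real ^ 'm \<Rightarrow> real" and \<eta> where
      ens: "random_ensemble \<alpha> d D P M \<eta>"
      and eq: "\<And>\<omega>. \<omega> \<in> space M \<Longrightarrow> sphere_zeros (f \<omega>) = sphere_zeros (random_ensemble.F \<alpha> d D P \<eta> \<omega>)"
      using random_polynomial_ensemble[OF rp assms(3,4) d m] by blast
    interpret random_ensemble \<alpha> d D P M \<eta> by (rule ens)
    have "(\<integral>\<^sup>+\<omega>. hausdorff_measure (n - 1) (sphere_zeros (f \<omega>)) \<partial>M) =
        (\<integral>\<^sup>+\<omega>. hausdorff_measure (CARD('m) - 2) (sphere_zeros (F \<omega>)) \<partial>M)"
      unfolding n by (intro nn_integral_cong) (simp add: eq)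
    then show ?thesis using expected_volume_ge expected_volume_le by simp
  qed
  show ?thesis
    by (intro exI[of _ ?c1] exI[of _ ?c2] conjI c1 c2 eventually_sequentiallyI[of 1] allI impI)
      (use bounds in blast)+
qed

end
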